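(* Let $n\geq 1$ and $k\geq 2$ be integers, and let $\mathcal{S}_{n,k}$ be the Stirling complex of type $(n,k)$. Its Betti numbers $\beta_i(\mathcal{S}_{n,k})=\dim_{\mathbb{Q}} H_i(\mathcal{S}_{n,k})$ are $$\beta_i(\mathcal{S}_{n,k}) = \begin{cases} |s_{n,k}| & \text{if } i=n,\\ 0 & \text{otherwise,}\end{cases}$$ where $|s_{n,k}|$ is the number of permutations of $\{1,\dots,n\}$ having exactly $k$ disjoint cycles (fixed points counted as cycles of length $1$).
   Context: All vector spaces are over $\mathbb{Q}$. For a finite set $X=\{x_1,\dots,x_m\}$, $\det(X)$ denotes the top exterior power of the vector space with basis $X$; it is one-dimensional, spanned by $x_1\wedge\dots\wedge x_m$. Trees. A graph consists of a finite non-empty set $V$ of vertices, a finite set $F$ of flags (half-edges), a map $F\to V$ (each flag is adjacent to a vertex), and an involution $\iota$ of $F$. Fixed points of $\iota$ are legs; two-element orbits $\{f,\iota(f)\}$ are edges. The valence of a vertex is its number of adjacent flags. A tree is a connected graph with $|E|=|V|-1$. A (stable) $n$-tree is a tree in which every vertex has valence at least $3$, with exactly $n+1$ legs, labeled bijectively by $\{0,1,\dots,n\}$. The leg labeled $0$ is the root. Each vertex has a unique output flag (the adjacent flag pointing toward the root; for the vertex adjacent to the root it is the root itself); all other flags adjacent to it are input flags. Thus each edge consists of one input flag and one output flag. Stirling trees. A Stirling tree of type $(n,k)$ is a triple $(\mathsf{t},v,A)$ where $\mathsf{t}$ is a stable $n$-tree, $v$ is a vertex of $\mathsf{t}$ (the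 distinguished vertex), and $A$ is a set of input flags adjacent to $v$ (the alternating flags) with $|A|=k\geq 2$. Isomorphisms preserve leg labels, the distinguished vertex and the set of alternating flags. Stirling complex. Let $$\mathcal{S}_{n,k,i}=\bigoplus_{(\mathsf{t},v,A)}\det(E(\mathsf{t}))\otimes\det(A),$$ the sum over isomorphism classes of Stirling trees of type $(n,k)$ with exactly $i$ edges. The complex $\mathcal{S}_{n,k}$ has $\mathcal{S}_{n,k,i}$ in total degree $i+k$, with differential $d\colon \mathcal{S}_{n,k,i}\to\mathcal{S}_{n,k,i-1}$ given on the summand of $(\mathsf{t},v,A)$ by $d=\sum_{e\in E(\mathsf{t})}d_e$, where $d_e$ is as follows. Let $\mathsf{t}/e$ be the tree obtained by contracting $e$ (its two end vertices are merged and the two flags of $e$ are deleted); its distinguished vertex is the image of $v$. (1) If neither flag of $e$ lies in $A$, then $d_e\colon\det(E(\mathsf{t}))\otimes\det(A)\to\det(E(\mathsf{t}/e))\otimes\det(A)$ removes $e$ from the last position of the wedge product of edges and is the identity on $\det(A)$. (2) If $e=\{a,b_0\}$ with input flag $a\in A$ and output flag $b_0$, let $B$ be the set of input flags at the vertex whose output is $b_0$, and for $b\in B$ let $A_b=(A\setminus\{a\})\cup\{b\}$. Then $d_e=\sum_{b\in B}d_{e,b}$, where $d_{e,b}\colon\det(E(\mathsf{t}))\otimes\det(A)\to\det(E(\mathsf{t}/e))\otimes\det(A_b)$ removes $e$ from the last position of the wedge product of edges, and on the second factor is the isomorphism induced by the bijection $A\to A_b$ sending $a$ to $b$ and fixing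 all other elements. *)

theory Defs
  imports
    Complex_Main
    "HOL-Library.FuncSet"
    "HOL-Library.Poly_Mapping"
    "HOL-Combinatorics.Permutations"
    "HOL-Combinatorics.Orbits"
begin

section \<open>Graphs with flags, trees, contraction\<close>

text \<open>\<open>lab\<close> is only meaningful on legs; \<open>adj\<close>, \<open>invol\<close> are only meaningful on \<open>flags\<close>.\<close>

record ('v, 'f) flag_graph =
  verts :: "'v set"
  flags :: "'f set"
  adj :: "'f \<Rightarrow> 'v"
  invol :: "'f \<Rightarrow> 'f"
  lab :: "'f \<Rightarrow> nat"

definition is_flag_graph :: "('v, 'f) flag_graph \<Rightarrow> bool" where
  "is_flag_graph G \<longleftrightarrow>
     finite (verts G) \<and> verts G \<noteq> {} \<and> finite (flags G) \<and>
     (\<forall>f\<in>flags G. adj G f \<in> verts G \<and> invol G f \<in> flags G \<and> invol G (invol G f) = f)"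

definition legs :: "('v, 'f) flag_graph \<Rightarrow> 'f set" where
  "legs G = {f \<in> flags G. invol G f = f}"

definition edges :: "('v, 'f) flag_graph \<Rightarrow> 'f set set" where
  "edges G = {{f, invol G f} | f. f \<in> flags G \<and> invol G f \<noteq> f}"

definition valence :: "('v, 'f) flag_graph \<Rightarrow> 'v \<Rightarrow> nat" where
  "valence G v = card {f \<in> flags G. adj G f = v}"

text \<open>One-step adjacency of vertices, using only flags from \<open>H\<close>.\<close>

definition links :: "('v, 'f) flag_graph \<Rightarrow> 'f set \<Rightarrow> ('v \<times> 'v) set" where
  "links G H = {(adj G f, adj G (invol G f)) | f. f \<in> H}"

definition is_flag_tree :: "('v, 'f) flag_graph \<Rightarrow> bool" where
  "is_flag_tree G \<longleftrightarrow>
     is_flag_graph G \<and>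
     (\<forall>u\<in>verts G. \<forall>w\<in>verts G. (u, w) \<in> (links G (flags G))\<^sup>*) \<and>
     card (edges G) + 1 = card (verts G)"

definition stable_tree :: "nat \<Rightarrow> ('v, 'f) flag_graph \<Rightarrow> bool" where
  "stable_tree n G \<longleftrightarrow>
     is_flag_tree G \<and> (\<forall>v\<in>verts G. 3 \<le> valence G v) \<and> bij_betw (lab G) (legs G) {0..n}"

definition root_flag :: "('v, 'f) flag_graph \<Rightarrow> 'f" where
  "root_flag G = (THE f. f \<in> legs G \<and> lab G f = 0)"

text \<open>A non-leg flag of a tree points towards the root iff, once its edge is removed, the
  vertex at the other end of that edge is still connected to the vertex carrying the root.\<close>

definition is_output :: "('v, 'f) flag_graph \<Rightarrow> 'f \<Rightarrow> bool" where
  "is_output G f \<longleftrightarrow>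
     f \<in> flags G \<and>
     (f = root_flag G \<or>
      invol G f \<noteq> f \<and>
      (adj G (invol G f), adj G (root_flag G)) \<in> (links G (flags G - {f, invol G f}))\<^sup>*)"

definition is_input :: "('v, 'f) flag_graph \<Rightarrow> 'f \<Rightarrow> bool" where
  "is_input G f \<longleftrightarrow> f \<in> flags G \<and> \<not> is_output G f"

definition in_end :: "('v, 'f) flag_graph \<Rightarrow> 'f set \<Rightarrow> 'f" where
  "in_end G e = (THE f. f \<in> e \<and> is_input G f)"

definition out_end :: "('v, 'f) flag_graph \<Rightarrow> 'f set \<Rightarrow> 'f" where
  "out_end G e = (THE f. f \<in> e \<and> is_output G f)"

text \<open>Contracting \<open>e\<close> merges its two end vertices; the merged vertex keeps the name of the
  end vertex at which \<open>e\<close> is an input. \<open>merge_vert G e\<close> is the quotient map on vertices.\<close>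

definition merge_vert :: "('v, 'f) flag_graph \<Rightarrow> 'f set \<Rightarrow> 'v \<Rightarrow> 'v" where
  "merge_vert G e x = (if x = adj G (out_end G e) then adj G (in_end G e) else x)"

definition contract :: "('v, 'f) flag_graph \<Rightarrow> 'f set \<Rightarrow> ('v, 'f) flag_graph" where
  "contract G e =
     \<lparr>verts = merge_vert G e ` verts G,
      flags = flags G - e,
      adj = (\<lambda>f. merge_vert G e (adj G f)),
      invol = invol G,
      lab = lab G\<rparr>"


section \<open>Stirling trees\<close>

record ('v, 'f) stirling_tree =
  st_tree :: "('v, 'f) flag_graph"
  st_vert :: 'v
  st_alt :: "'f set"

definition is_stirling_tree :: "nat \<Rightarrow> nat \<Rightarrow> ('v, 'f) stirling_tree \<Rightarrow> bool" where
  "is_stirling_tree n k S \<longleftrightarrow>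
     stable_tree n (st_tree S) \<and>
     st_vert S \<in> verts (st_tree S) \<and>
     st_alt S \<subseteq> {f. is_input (st_tree S) f \<and> adj (st_tree S) f = st_vert S} \<and>
     card (st_alt S) = k \<and> 2 \<le> k"

definition stirling_iso ::
    "('v \<Rightarrow> 'w) \<Rightarrow> ('f \<Rightarrow> 'g) \<Rightarrow> ('v, 'f) stirling_tree \<Rightarrow> ('w, 'g) stirling_tree \<Rightarrow> bool" where
  "stirling_iso \<phi> \<psi> S S' \<longleftrightarrow>
     (let G = st_tree S; G' = st_tree S' in
        bij_betw \<phi> (verts G) (verts G') \<and>
        bij_betw \<psi> (flags G) (flags G') \<and>
        (\<forall>f\<in>flags G. adj G' (\<psi> f) = \<phi> (adj G f) \<and> invol G' (\<psi> f) = \<psi> (invol G f)) \<and>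
        (\<forall>f\<in>legs G. lab G' (\<psi> f) = lab G f) \<and>
        st_vert S' = \<phi> (st_vert S) \<and>
        st_alt S' = \<psi> ` st_alt S)"


section \<open>Rational vector spaces with a given basis, and their subquotients\<close>

text \<open>\<open>'a \<Rightarrow>\<^sub>0 rat\<close> is the rational vector space with basis \<open>'a\<close>; the basis vector of
  \<open>x\<close> is \<open>Poly_Mapping.single x 1\<close>.\<close>

definition chain_scale :: "rat \<Rightarrow> ('a \<Rightarrow>\<^sub>0 rat) \<Rightarrow> ('a \<Rightarrow>\<^sub>0 rat)" where
  "chain_scale q c = Poly_Mapping.map ((*) q) c"

lemma lookup_chain_scale [simp]:
  "Poly_Mapping.lookup (chain_scale q c) x = q * Poly_Mapping.lookup c x"
  by (simp add: chain_scale_def Poly_Mapping.map.rep_eq when_def)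

interpretation chain: vector_space "chain_scale :: rat \<Rightarrow> ('a \<Rightarrow>\<^sub>0 rat) \<Rightarrow> ('a \<Rightarrow>\<^sub>0 rat)"
  by unfold_locales
    (auto intro!: poly_mapping_eqI simp: lookup_add algebra_simps)

text \<open>\<open>dim (Z / B) = m\<close>: the cosets of the elements of some \<open>m\<close>-element set \<open>X\<close>
  form a basis of the quotient space.\<close>

definition quotient_has_dim :: "('a \<Rightarrow>\<^sub>0 rat) set \<Rightarrow> ('a \<Rightarrow>\<^sub>0 rat) set \<Rightarrow> nat \<Rightarrow> bool" where
  "quotient_has_dim Z B m \<longleftrightarrow>
     chain.subspace Z \<and> chain.subspace B \<and> B \<subseteq> Z \<and>
     (\<exists>X. X \<subseteq> Z \<and> finite X \<and> card X = m \<and>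
          (\<forall>z\<in>Z. \<exists>!a. a \<in> X \<rightarrow>\<^sub>E UNIV \<and> z - (\<Sum>x\<in>X. chain_scale (a x) x) \<in> B))"


section \<open>The Stirling complex\<close>

text \<open>
  The top exterior power \<open>det X\<close> is presented by the generators
  \<open>x\<^sub>1 \<and> \<dots> \<and> x\<^sub>m\<close>, one for each ordering of \<open>X\<close>, subject to antisymmetry.
  Hence \<open>(S, [e\<^sub>1, \<dots>, e\<^sub>i], [a\<^sub>1, \<dots>, a\<^sub>k])\<close> stands for the element
  \<open>(e\<^sub>1 \<and> \<dots> \<and> e\<^sub>i) \<otimes> (a\<^sub>1 \<and> \<dots> \<and> a\<^sub>k)\<close> of \<open>det E \<otimes> det A\<close>,
  and the direct sum over isomorphism classes is the quotient of the space with basis these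
  triples by antisymmetry in both lists and by the identification of isomorphic Stirling trees.
  (A stable tree has no automorphism besides the identity, so the summand of an isomorphism
  class is \<open>det E \<otimes> det A\<close> itself.)
  Every Stirling tree is isomorphic to one whose vertices and flags are natural numbers.
\<close>

type_synonym oriented = "(nat, nat) stirling_tree \<times> nat set list \<times> nat list"

text \<open>The total degree \<open>j\<close> is the number of edges plus \<open>k\<close>.\<close>

definition oriented_trees :: "nat \<Rightarrow> nat \<Rightarrow> int \<Rightarrow> oriented set" where
  "oriented_trees n k j =
     {(S, es, as).
        is_stirling_tree n k S \<and>
        int (card (edges (st_tree S))) + int k = j \<and>
        distinct es \<and> set es = edges (st_tree S) \<and>
        distinct as \<and> set as = st_alt S}"

definition stirling_gens :: "nat \<Rightarrow> nat \<Rightarrow> int \<Rightarrow> (oriented \<Rightarrow>\<^sub>0 rat) set" where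
  "stirling_gens n k j = {c. Poly_Mapping.keys c \<subseteq> oriented_trees n k j}"

definition stirling_rels :: "nat \<Rightarrow> nat \<Rightarrow> int \<Rightarrow> (oriented \<Rightarrow>\<^sub>0 rat) set" where
  "stirling_rels n k j = chain.span
     ({Poly_Mapping.single (S, permute_list p es, permute_list q as) 1 -
         Poly_Mapping.single (S, es, as) (of_int (sign p * sign q)) | S es as p q.
         (S, es, as) \<in> oriented_trees n k j \<and>
         p permutes {..<length es} \<and> q permutes {..<length as}} \<union>
      {Poly_Mapping.single (S', map (image \<psi>) es, map \<psi> as) 1 -
         Poly_Mapping.single (S, es, as) 1 | S S' es as \<phi> \<psi>.
         (S, es, as) \<in> oriented_trees n k j \<and> is_stirling_tree n k S' \<and>
         stirling_iso \<phi> \<psi> S S'})"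

text \<open>\<open>d\<^sub>e\<close> for the \<open>i\<close>-th edge \<open>e\<close> (counted from \<open>0\<close>) of the list \<open>es\<close>. The sign is
  that of moving \<open>e\<close> to the last position of the wedge product before removing it. All elements
  of \<open>A\<close> are inputs, so \<open>e\<close> meets \<open>A\<close> iff its input flag \<open>a\<close> lies in \<open>A\<close>.\<close>

fun edge_bdry :: "oriented \<Rightarrow> nat \<Rightarrow> (oriented \<Rightarrow>\<^sub>0 rat)" where
  "edge_bdry (S, es, as) i =
     (let G = st_tree S; A = st_alt S; e = es ! i;
          G' = contract G e;
          v' = merge_vert G e (st_vert S);
          es' = take i es @ drop (Suc i) es;
          s = (- 1) ^ (length es - Suc i);
          a = in_end G e;
          B = {b. is_input G b \<and> adj G b = adj G (out_end G e)}
      in if e \<inter> A = {}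
         then Poly_Mapping.single (\<lparr>st_tree = G', st_vert = v', st_alt = A\<rparr>, es', as) s
         else (\<Sum>b\<in>B. Poly_Mapping.single
                 (\<lparr>st_tree = G', st_vert = v', st_alt = insert b (A - {a})\<rparr>,
                  es', map (\<lambda>x. if x = a then b else x) as) s))"

definition tree_bdry :: "oriented \<Rightarrow> (oriented \<Rightarrow>\<^sub>0 rat)" where
  "tree_bdry g = (\<Sum>i<length (fst (snd g)). edge_bdry g i)"

definition stirling_bdry :: "(oriented \<Rightarrow>\<^sub>0 rat) \<Rightarrow> (oriented \<Rightarrow>\<^sub>0 rat)" where
  "stirling_bdry c =
     (\<Sum>g\<in>Poly_Mapping.keys c. chain_scale (Poly_Mapping.lookup c g) (tree_bdry g))"

text \<open>The chain space of the complex in degree \<open>j\<close> is \<open>stirling_gens n k j / stirling_rels n k j\<close>.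
  The next two sets are the preimages in \<open>stirling_gens n k j\<close> of its cycles and boundaries, so
  that the homology is their quotient.\<close>

definition stirling_cycles :: "nat \<Rightarrow> nat \<Rightarrow> int \<Rightarrow> (oriented \<Rightarrow>\<^sub>0 rat) set" where
  "stirling_cycles n k j =
     {c \<in> stirling_gens n k j. stirling_bdry c \<in> stirling_rels n k (j - 1)}"

definition stirling_boundaries :: "nat \<Rightarrow> nat \<Rightarrow> int \<Rightarrow> (oriented \<Rightarrow>\<^sub>0 rat) set" where
  "stirling_boundaries n k j =
     {stirling_bdry c + r | c r. c \<in> stirling_gens n k (j + 1) \<and> r \<in> stirling_rels n k j}"

text \<open>\<open>stirling_betti n k j m\<close>: the \<open>j\<close>-th Betti number exists (the homology is
  finite-dimensional) and equals \<open>m\<close>. A relation is used because a dimension function with a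
  default value \<open>0\<close> in the infinite-dimensional case would make vanishing ambiguous.\<close>

definition stirling_betti :: "nat \<Rightarrow> nat \<Rightarrow> int \<Rightarrow> nat \<Rightarrow> bool" where
  "stirling_betti n k j m \<longleftrightarrow>
     quotient_has_dim (stirling_cycles n k j) (stirling_boundaries n k j) m"

text \<open>The orbits of \<open>p\<close> on \<open>{1..n}\<close> are its disjoint cycles, fixed points included.\<close>

definition num_cycles :: "nat \<Rightarrow> (nat \<Rightarrow> nat) \<Rightarrow> nat" where
  "num_cycles n p = card (orbit p ` {1..n})"

definition abs_stirling1 :: "nat \<Rightarrow> nat \<Rightarrow> nat" where
  "abs_stirling1 n k = card {p. p permutes {1..n} \<and> num_cycles n p = k}"

end

theory Submission
  imports Defs "HOL-Combinatorics.Stirling" "HOL-Library.Nat_Bijection"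
begin

text \<open>
  A stable \<open>n\<close>-tree is determined by the laminar family \<open>F\<close> of the label sets above its edges,
  and the alternating flags by their label sets \<open>A\<close>; contracting an edge removes its label set
  from \<open>F\<close>. So the Stirling complex has a basis of pairs \<open>(F, A)\<close>, and its homology is computed
  by an acyclic matching. If \<open>A\<close> does not cover \<open>{1..n}\<close>, toggle the set \<open>\<Union>A\<close> in \<open>F\<close>: the two
  terms differ by the contraction of the edge below a vertex whose inputs are exactly \<open>A\<close>.
  If \<open>A\<close> covers \<open>{1..n}\<close>, then \<open>F\<close> is a forest with \<open>k\<close> roots, and one recurses on \<open>n\<close>: when the
  leaf \<open>n\<close> is neither a root nor in a cherry \<open>{c, n}\<close>, toggle \<open>P - {n}\<close> for the smallest \<open>P\<close> in \<open>F\<close>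
  containing \<open>n\<close>; otherwise delete \<open>n\<close>. The unmatched forests satisfy the recursion
  \<open>s(n, k) = s(n - 1, k - 1) + (n - 1) s(n - 1, k)\<close> and all lie in degree \<open>n\<close>.
\<close>

section \<open>Linear extension of maps on basis vectors\<close>

text \<open>All unmatched cells sit in the single degree \<open>n\<close>, so no differential
  between them has to be computed and their number is the Betti number. The recursion keeps them
  there because an isolated last leaf accounts for one unit of \<open>k\<close> and a last leaf in a
  cherry for one member of \<open>F\<close>. A matched pair only needs a nonzero coefficient, so the
  matching is sign-free. Signs matter in two places. That the boundary squares to zero is shown on
  ordered lists of sets, where an alternating set is replaced in place and only the position of the
  deleted edge contributes a sign; \<open>orient\<close> then passes to unordered cells. And the
  chain spaces are given by generators modulo relations, so the map \<open>to_cells\<close> must be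
  shown to be onto and to kill exactly the relations. This rests on the fact that a stable tree is
  determined up to isomorphism by its label sets, which is obtained by taking directions from
  distances to the root vertex and counting edges.\<close>

definition lin :: "('a \<Rightarrow> ('b \<Rightarrow>\<^sub>0 rat)) \<Rightarrow> ('a \<Rightarrow>\<^sub>0 rat) \<Rightarrow> ('b \<Rightarrow>\<^sub>0 rat)" where
  "lin f c = (\<Sum>g\<in>Poly_Mapping.keys c. chain_scale (Poly_Mapping.lookup c g) (f g))"

lemma lookup_sum: "Poly_Mapping.lookup (\<Sum>x\<in>S. f x) y = (\<Sum>x\<in>S. Poly_Mapping.lookup (f x) y)"
  by (induction S rule: infinite_finite_induct) (auto simp: lookup_add)

lemma chain_scale_single [simp]: "chain_scale q (Poly_Mapping.single x r) = Poly_Mapping.single x (q * r)"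
  by (rule poly_mapping_eqI) (simp add: lookup_single when_def)

lemma keys_chain_scale: "Poly_Mapping.keys (chain_scale q c) \<subseteq> Poly_Mapping.keys c"
  by (auto simp: in_keys_iff)

lemma lin_superset:
  assumes "finite S" "Poly_Mapping.keys c \<subseteq> S"
  shows "lin f c = (\<Sum>g\<in>S. chain_scale (Poly_Mapping.lookup c g) (f g))"
  unfolding lin_def
  by (rule sum.mono_neutral_left) (use assms in \<open>auto simp: in_keys_iff\<close>)

lemma lookup_lin:
  "Poly_Mapping.lookup (lin f c) y =
    (\<Sum>g\<in>Poly_Mapping.keys c. Poly_Mapping.lookup c g * Poly_Mapping.lookup (f g) y)"
  by (simp add: lin_def lookup_sum)

lemma lin_add: "lin f (c + d) = lin f c + lin f d"
proof -
  let ?S = "Poly_Mapping.keys c \<union> Poly_Mapping.keys d"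
  have "Poly_Mapping.keys (c + d) \<subseteq> ?S" by (rule keys_add)
  then show ?thesis
    by (simp add: lin_superset[of ?S] lookup_add chain.scale_left_distrib sum.distrib)
qed

lemma lin_0 [simp]: "lin f 0 = 0"
  by (simp add: lin_def)

lemma lin_scale: "lin f (chain_scale q c) = chain_scale q (lin f c)"
proof -
  have "lin f (chain_scale q c) = (\<Sum>g\<in>Poly_Mapping.keys c. chain_scale (q * Poly_Mapping.lookup c g) (f g))"
    by (subst lin_superset[OF _ keys_chain_scale]) auto
  then show ?thesis
    by (simp add: lin_def chain.scale_sum_right)
qed

lemma lin_uminus: "lin f (- c) = - lin f c"
  by (metis add.right_inverse lin_0 lin_add neg_eq_iff_add_eq_0)

lemma lin_diff: "lin f (c - d) = lin f c - lin f d"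
  using lin_add[of f c "- d"] by (simp add: lin_uminus)

lemma lin_sum: "lin f (\<Sum>x\<in>S. c x) = (\<Sum>x\<in>S. lin f (c x))"
  by (induction S rule: infinite_finite_induct) (auto simp: lin_add)

lemma lin_single [simp]: "lin f (Poly_Mapping.single x q) = chain_scale q (f x)"
  by (cases "q = 0") (auto simp: lin_def)

lemma lin_cong: "(\<And>x. x \<in> Poly_Mapping.keys c \<Longrightarrow> f x = g x) \<Longrightarrow> lin f c = lin g c"
  by (simp add: lin_def)

lemma lin_lin: "lin f (lin g c) = lin (\<lambda>x. lin f (g x)) c"
  by (simp add: lin_def[of _ c] lin_sum lin_scale)

lemma lin_id: "lin (\<lambda>x. Poly_Mapping.single x 1) c = c"
  by (rule poly_mapping_eqI)
    (auto simp: lookup_lin lookup_single when_def in_keys_iff if_distrib sum.delta cong: if_cong)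

lemma keys_lin: "Poly_Mapping.keys (lin f c) \<subseteq> (\<Union>x\<in>Poly_Mapping.keys c. Poly_Mapping.keys (f x))"
proof
  fix y assume "y \<in> Poly_Mapping.keys (lin f c)"
  then have "(\<Sum>g\<in>Poly_Mapping.keys c. Poly_Mapping.lookup c g * Poly_Mapping.lookup (f g) y) \<noteq> 0"
    by (simp add: in_keys_iff lookup_lin)
  then obtain g where "g \<in> Poly_Mapping.keys c" "Poly_Mapping.lookup c g * Poly_Mapping.lookup (f g) y \<noteq> 0"
    by (meson sum.not_neutral_contains_not_neutral)
  then show "y \<in> (\<Union>x\<in>Poly_Mapping.keys c. Poly_Mapping.keys (f x))"
    by (auto simp: in_keys_iff)
qed

lemma subspace_supp: "chain.subspace {c :: 'a \<Rightarrow>\<^sub>0 rat. Poly_Mapping.keys c \<subseteq> X}"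
proof (rule chain.subspaceI)
  fix c d :: "'a \<Rightarrow>\<^sub>0 rat" assume "c \<in> {c. Poly_Mapping.keys c \<subseteq> X}" "d \<in> {c. Poly_Mapping.keys c \<subseteq> X}"
  then show "c + d \<in> {c. Poly_Mapping.keys c \<subseteq> X}" using keys_add[of c d] by auto
qed (auto dest: subsetD[OF keys_chain_scale])

lemma keys_diff_subset:
  fixes c d :: "'a \<Rightarrow>\<^sub>0 rat"
  assumes "Poly_Mapping.keys c \<subseteq> X" "Poly_Mapping.keys d \<subseteq> X"
  shows "Poly_Mapping.keys (c - d) \<subseteq> X"
  using chain.subspace_diff[OF subspace_supp[of X], of c d] assms by simp

lemma keys_sum_subset:
  fixes f :: "'b \<Rightarrow> ('a \<Rightarrow>\<^sub>0 rat)"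
  assumes "\<And>x. x \<in> S \<Longrightarrow> Poly_Mapping.keys (f x) \<subseteq> X"
  shows "Poly_Mapping.keys (sum f S) \<subseteq> X"
  using chain.subspace_sum[OF subspace_supp[of X], of S f] assms by simp

section \<open>Acyclic matchings\<close>

text \<open>\<open>E x y\<close> reads \<open>y occurs in the boundary of x\<close>. The rank \<open>\<rho>\<close> makes the matrix of the
  boundary from \<open>\<mu> ` L\<close> to \<open>L\<close> triangular.\<close>

definition acyclic_matching :: "'c set \<Rightarrow> ('c \<Rightarrow> 'c \<Rightarrow> bool) \<Rightarrow> 'c set \<Rightarrow> bool" where
  "acyclic_matching X E C \<longleftrightarrow> (\<exists>L \<mu> (\<rho> :: 'c \<Rightarrow> nat).
     L \<union> \<mu> ` L \<union> C = X \<and> L \<inter> \<mu> ` L = {} \<and> L \<inter> C = {} \<and> \<mu> ` L \<inter> C = {} \<and> inj_on \<mu> L \<and>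
     (\<forall>l\<in>L. E (\<mu> l) l) \<and> (\<forall>l\<in>L. \<forall>l'\<in>L. E (\<mu> l) l' \<longrightarrow> l' \<noteq> l \<longrightarrow> \<rho> l' < \<rho> l))"

lemma acyclic_matching_empty: "acyclic_matching {} E {}"
  unfolding acyclic_matching_def by (intro exI[of _ "{}"]) auto

text \<open>The cluster lemma of discrete Morse theory. Boundaries may lead from \<open>X2\<close>
  into \<open>X1\<close> but not back, so the ranks on \<open>X2\<close> can be shifted above all
  ranks on \<open>X1\<close>.\<close>

lemma acyclic_matching_union:
  assumes "finite X1" "X1 \<inter> X2 = {}"
    and noE: "\<And>x y. x \<in> X1 \<Longrightarrow> y \<in> X2 \<Longrightarrow> \<not> E x y"
    and "acyclic_matching X1 E C1" "acyclic_matching X2 E C2"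
  shows "acyclic_matching (X1 \<union> X2) E (C1 \<union> C2)"
proof -
  obtain L1 \<mu>1 and \<rho>1 :: "'a \<Rightarrow> nat" where 1:
    "L1 \<union> \<mu>1 ` L1 \<union> C1 = X1" "L1 \<inter> \<mu>1 ` L1 = {}" "L1 \<inter> C1 = {}" "\<mu>1 ` L1 \<inter> C1 = {}" "inj_on \<mu>1 L1"
    "\<forall>l\<in>L1. E (\<mu>1 l) l" "\<forall>l\<in>L1. \<forall>l'\<in>L1. E (\<mu>1 l) l' \<longrightarrow> l' \<noteq> l \<longrightarrow> \<rho>1 l' < \<rho>1 l"
    using assms(4) unfolding acyclic_matching_def by metis
  obtain L2 \<mu>2 and \<rho>2 :: "'a \<Rightarrow> nat" where 2:
    "L2 \<union> \<mu>2 ` L2 \<union> C2 = X2" "L2 \<inter> \<mu>2 ` L2 = {}" "L2 \<inter> C2 = {}" "\<mu>2 ` L2 \<inter> C2 = {}" "inj_on \<mu>2 L2"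
    "\<forall>l\<in>L2. E (\<mu>2 l) l" "\<forall>l\<in>L2. \<forall>l'\<in>L2. E (\<mu>2 l) l' \<longrightarrow> l' \<noteq> l \<longrightarrow> \<rho>2 l' < \<rho>2 l"
    using assms(5) unfolding acyclic_matching_def by metis
  have s1: "L1 \<subseteq> X1" "\<mu>1 ` L1 \<subseteq> X1" "C1 \<subseteq> X1" and s2: "L2 \<subseteq> X2" "\<mu>2 ` L2 \<subseteq> X2" "C2 \<subseteq> X2"
    using 1 2 by auto
  have fin: "finite L1" using s1 assms(1) finite_subset by blast
  \<comment> \<open>Every rank on the finite set \<open>L1\<close> is at most the sum of all of
    them, so this \<open>B\<close> exceeds each one.\<close>
  define B where "B = Suc (sum \<rho>1 L1)"
  have B: "\<rho>1 l < B" if "l \<in> L1" for l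
    using member_le_sum[OF that, of \<rho>1] fin unfolding B_def by auto
  define \<mu> where "\<mu> l = (if l \<in> X1 then \<mu>1 l else \<mu>2 l)" for l
  define \<rho> where "\<rho> l = (if l \<in> X1 then \<rho>1 l else B + \<rho>2 l)" for l
  have \<mu>1: "\<mu> l = \<mu>1 l" "\<mu>1 l \<in> X1" "l \<in> X1" "l \<notin> X2" "\<mu>1 l \<notin> X2" if "l \<in> L1" for l
    using that s1 assms(2) by (auto simp: \<mu>_def)
  have \<mu>2: "\<mu> l = \<mu>2 l" "\<mu>2 l \<in> X2" "l \<notin> X1" "l \<in> X2" "\<mu>2 l \<notin> X1" if "l \<in> L2" for l
    using that s2 assms(2) by (auto simp: \<mu>_def)
  have im: "\<mu> ` L1 = \<mu>1 ` L1" "\<mu> ` L2 = \<mu>2 ` L2" using \<mu>1(1) \<mu>2(1) by force+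
  have disj: "(A1 \<union> A2) \<inter> (B1 \<union> B2) = {}"
    if "A1 \<subseteq> X1" "A2 \<subseteq> X2" "B1 \<subseteq> X1" "B2 \<subseteq> X2" "A1 \<inter> B1 = {}" "A2 \<inter> B2 = {}" for A1 A2 B1 B2
    using that assms(2) by blast
  show ?thesis unfolding acyclic_matching_def
  proof (intro exI[of _ "L1 \<union> L2"] exI[of _ \<mu>] exI[of _ \<rho>] conjI ballI impI)
    show "L1 \<union> L2 \<union> \<mu> ` (L1 \<union> L2) \<union> (C1 \<union> C2) = X1 \<union> X2"
      unfolding image_Un im using 1 2 by auto
    show "(L1 \<union> L2) \<inter> \<mu> ` (L1 \<union> L2) = {}"
      unfolding image_Un im by (rule disj) (use 1(2) 2(2) s1 s2 in simp_all)
    show "(L1 \<union> L2) \<inter> (C1 \<union> C2) = {}"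
      by (rule disj) (use 1(3) 2(3) s1 s2 in simp_all)
    show "\<mu> ` (L1 \<union> L2) \<inter> (C1 \<union> C2) = {}"
      unfolding image_Un im by (rule disj) (use 1(4) 2(4) s1 s2 in simp_all)
    show "inj_on \<mu> (L1 \<union> L2)" (is ?inj)
    proof -
      have "inj_on \<mu> L1" "inj_on \<mu> L2"
        using 1(5) 2(5) \<mu>1(1) \<mu>2(1) by (auto simp: inj_on_def)
      moreover have "\<mu> ` L1 \<inter> \<mu> ` L2 = {}"
        unfolding im using Int_mono[OF s1(2) s2(2)] assms(2) by simp
      ultimately show ?inj unfolding inj_on_Un by blast
    qed
  next
    fix l assume "l \<in> L1 \<union> L2"
    then show "E (\<mu> l) l" using 1(6) 2(6) \<mu>1(1) \<mu>2(1) by auto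
  next
    fix l l' assume l: "l \<in> L1 \<union> L2" "l' \<in> L1 \<union> L2" and E: "E (\<mu> l) l'" "l' \<noteq> l"
    consider (a) "l \<in> L1" "l' \<in> L1" | (b) "l \<in> L1" "l' \<in> L2" | (c) "l \<in> L2" "l' \<in> L1" | (d) "l \<in> L2" "l' \<in> L2"
      using l by blast
    then show "\<rho> l' < \<rho> l"
    proof cases
      case a then show ?thesis using 1(7) E \<mu>1 by (simp add: \<rho>_def)
    next
      case b then show ?thesis using noE E \<mu>1 \<mu>2 by metis
    next
      case c then show ?thesis using B \<mu>1 \<mu>2 by (simp add: \<rho>_def trans_less_add1)
    next
      case d then show ?thesis using 2(7) E \<mu>2 by (simp add: \<rho>_def)
    qed
  qed
qed

text \<open>For pieces with no incidence between them in either direction, such as the forests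
  containing different cherries.\<close>

lemma acyclic_matching_UN:
  assumes "finite T" "\<And>t. t \<in> T \<Longrightarrow> finite (X t)" "\<And>t. t \<in> T \<Longrightarrow> acyclic_matching (X t) E (C t)"
    and "\<And>s t. s \<in> T \<Longrightarrow> t \<in> T \<Longrightarrow> s \<noteq> t \<Longrightarrow> X s \<inter> X t = {}"
    and "\<And>s t x y. s \<in> T \<Longrightarrow> t \<in> T \<Longrightarrow> s \<noteq> t \<Longrightarrow> x \<in> X s \<Longrightarrow> y \<in> X t \<Longrightarrow> \<not> E x y"
  shows "acyclic_matching (\<Union>t\<in>T. X t) E (\<Union>t\<in>T. C t)"
  using assms
proof (induction T rule: finite_induct)
  case empty then show ?case by (simp add: acyclic_matching_empty)
next
  case (insert t T)
  have "acyclic_matching (X t \<union> (\<Union>t\<in>T. X t)) E (C t \<union> (\<Union>t\<in>T. C t))"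
  proof (rule acyclic_matching_union)
    show "acyclic_matching (\<Union>t\<in>T. X t) E (\<Union>t\<in>T. C t)"
    proof (rule insert.IH)
      show "\<not> E x y" if "s \<in> T" "t \<in> T" "s \<noteq> t" "x \<in> X s" "y \<in> X t" for s t x y
        using insert.prems(4)[of s t x y] that by simp
    qed (use insert.prems in auto)
    show "X t \<inter> (\<Union>t\<in>T. X t) = {}" using insert.hyps insert.prems(3) by auto
    show "\<not> E x y" if "x \<in> X t" "y \<in> (\<Union>t\<in>T. X t)" for x y
      using that insert.hyps insert.prems(4) by (metis UN_E insertCI)
  qed (use insert.prems in auto)
  then show ?case by simp
qed

text \<open>Only incidence within \<open>X\<close> is compared, so \<open>h\<close> may map into a
  complex with other coefficients and further boundary terms. The matching is conjugated by
  \<open>h\<close>. Applied to the addition of a cherry and to the passage from \<open>F\<close> to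
  \<open>(F, roots n F)\<close>.\<close>

lemma acyclic_matching_image:
  assumes h: "inj_on h X" and E: "\<And>x y. x \<in> X \<Longrightarrow> y \<in> X \<Longrightarrow> E' (h x) (h y) \<longleftrightarrow> E x y"
    and M: "acyclic_matching X E C"
  shows "acyclic_matching (h ` X) E' (h ` C)"
proof -
  obtain L \<mu> and \<rho> :: "'a \<Rightarrow> nat" where *:
    "L \<union> \<mu> ` L \<union> C = X" "L \<inter> \<mu> ` L = {}" "L \<inter> C = {}" "\<mu> ` L \<inter> C = {}" "inj_on \<mu> L"
    "\<forall>l\<in>L. E (\<mu> l) l" "\<forall>l\<in>L. \<forall>l'\<in>L. E (\<mu> l) l' \<longrightarrow> l' \<noteq> l \<longrightarrow> \<rho> l' < \<rho> l"
    using M unfolding acyclic_matching_def by metis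
  have s: "L \<subseteq> X" "\<mu> ` L \<subseteq> X" "C \<subseteq> X" using * by auto
  define g where "g = inv_into X h"
  have g: "g (h x) = x" if "x \<in> X" for x using that h by (simp add: g_def)
  have gm: "h (\<mu> (g (h l))) = h (\<mu> l)" if "l \<in> L" for l using that s g by auto
  have im: "(\<lambda>x. h (\<mu> (g x))) ` h ` L = h ` \<mu> ` L"
    using gm by (force simp: image_image)
  show ?thesis unfolding acyclic_matching_def
  proof (intro exI[of _ "h ` L"] exI[of _ "\<lambda>x. h (\<mu> (g x))"] exI[of _ "\<lambda>x. \<rho> (g x)"] conjI)
    show "h ` L \<union> (\<lambda>x. h (\<mu> (g x))) ` h ` L \<union> h ` C = h ` X"
      unfolding im using *(1) by (metis image_Un)
    show "h ` L \<inter> (\<lambda>x. h (\<mu> (g x))) ` h ` L = {}"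
      unfolding im using s *(2) h by (metis image_empty inj_on_image_Int)
    show "h ` L \<inter> h ` C = {}" using s *(3) h by (metis image_empty inj_on_image_Int)
    show "(\<lambda>x. h (\<mu> (g x))) ` h ` L \<inter> h ` C = {}"
      unfolding im using s *(4) h by (metis image_empty inj_on_image_Int)
    show "inj_on (\<lambda>x. h (\<mu> (g x))) (h ` L)"
    proof (rule inj_onI)
      fix x y assume "x \<in> h ` L" "y \<in> h ` L" and eq: "h (\<mu> (g x)) = h (\<mu> (g y))"
      then obtain l l' where l: "l \<in> L" "l' \<in> L" "x = h l" "y = h l'" by auto
      then have "h (\<mu> l) = h (\<mu> l')" using eq gm by simp
      then have "\<mu> l = \<mu> l'" using h s l by (auto dest: inj_onD)
      then show "x = y" using *(5) l by (auto dest: inj_onD)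
    qed
    show "\<forall>l\<in>h ` L. E' (h (\<mu> (g l))) l"
    proof
      fix x assume "x \<in> h ` L"
      then obtain l where l: "l \<in> L" "x = h l" by auto
      moreover have "l \<in> X" "\<mu> l \<in> X" using l s by auto
      ultimately show "E' (h (\<mu> (g x))) x" using *(6) gm E by simp
    qed
    show "\<forall>l\<in>h ` L. \<forall>l'\<in>h ` L. E' (h (\<mu> (g l))) l' \<longrightarrow> l' \<noteq> l \<longrightarrow> \<rho> (g l') < \<rho> (g l)"
    proof (intro ballI impI)
      fix x y assume "x \<in> h ` L" "y \<in> h ` L" and e: "E' (h (\<mu> (g x))) y" "y \<noteq> x"
      then obtain l l' where l: "l \<in> L" "l' \<in> L" "x = h l" "y = h l'" by auto
      moreover have "l \<in> X" "\<mu> l \<in> X" "l' \<in> X" using l s by auto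
      ultimately have "E (\<mu> l) l'" "l' \<noteq> l" using e gm E by auto
      then show "\<rho> (g y) < \<rho> (g x)" using *(7) l g \<open>l \<in> X\<close> \<open>l' \<in> X\<close> by auto
    qed
  qed
qed

text \<open>Triangularity of the boundary from \<open>\<mu> ` L\<close> to \<open>L\<close> gives two facts: every chain can be
  changed by a boundary so as to avoid \<open>L\<close>, and a chain on \<open>\<mu> ` L\<close> whose boundary avoids \<open>L\<close>
  vanishes. Hence the homology is spanned by classes of cycles of the form \<open>c + u\<close> with \<open>c\<close>
  critical and \<open>u\<close> supported on \<open>\<mu> ` L\<close>.\<close>

lemma matching_homology:
  fixes D :: "'c \<Rightarrow> ('c \<Rightarrow>\<^sub>0 rat)" and deg :: "'c \<Rightarrow> int"
  assumes finX: "finite X"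
    and degD: "\<And>x. x \<in> X \<Longrightarrow> Poly_Mapping.keys (D x) \<subseteq> {y \<in> X. deg y = deg x - 1}"
    and DD: "\<And>x. x \<in> X \<Longrightarrow> lin D (D x) = 0"
    and M: "acyclic_matching X (\<lambda>x y. Poly_Mapping.lookup (D x) y \<noteq> 0) C"
    and degC: "\<And>c. c \<in> C \<Longrightarrow> deg c = N"
  obtains w where
    "\<And>c. c \<in> C \<Longrightarrow> Poly_Mapping.keys (w c) \<subseteq> {x \<in> X. deg x = N} \<and> lin D (w c) = 0"
    "\<And>j z Cj. Cj = (if j = N then C else {}) \<Longrightarrow>
       Poly_Mapping.keys z \<subseteq> {x \<in> X. deg x = j} \<Longrightarrow> lin D z = 0 \<Longrightarrow>
       \<exists>!a. a \<in> Cj \<rightarrow>\<^sub>E UNIV \<and>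
         (\<exists>y. Poly_Mapping.keys y \<subseteq> {x \<in> X. deg x = j + 1} \<and>
              z - (\<Sum>c\<in>Cj. chain_scale (a c) (w c)) = lin D y)"
proof -
  obtain L \<mu> and \<rho> :: "'c \<Rightarrow> nat" where *:
    "L \<union> \<mu> ` L \<union> C = X" "L \<inter> \<mu> ` L = {}" "L \<inter> C = {}" "\<mu> ` L \<inter> C = {}" "inj_on \<mu> L"
    "\<And>l. l\<in>L \<Longrightarrow> Poly_Mapping.lookup (D (\<mu> l)) l \<noteq> 0"
    "\<And>l l'. l\<in>L \<Longrightarrow> l'\<in>L \<Longrightarrow> Poly_Mapping.lookup (D (\<mu> l)) l' \<noteq> 0 \<Longrightarrow> l' \<noteq> l \<Longrightarrow> \<rho> l' < \<rho> l"
    using M unfolding acyclic_matching_def by metis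
  let ?K = "\<lambda>j. {x \<in> X. deg x = j}"
  let ?U = "\<lambda>j. {x \<in> \<mu> ` L. deg x = j}"
  have sub: "L \<subseteq> X" "\<mu> ` L \<subseteq> X" "C \<subseteq> X" using * by auto
  have finL: "finite L" using sub finX finite_subset by blast
  have deg\<mu>: "deg (\<mu> l) = deg l + 1" if "l \<in> L" for l
  proof -
    have "\<mu> l \<in> X" "l \<in> Poly_Mapping.keys (D (\<mu> l))" using sub that *(6)[OF that] by (auto simp: in_keys_iff)
    then show ?thesis using degD[of "\<mu> l"] by auto
  qed
  have keysD: "Poly_Mapping.keys (lin D y) \<subseteq> ?K (j - 1)" if "Poly_Mapping.keys y \<subseteq> ?K j" for y j
    using keys_lin[of D y] degD that by fastforce
  have DD': "lin D (lin D y) = 0" if "Poly_Mapping.keys y \<subseteq> X" for y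
  proof -
    have "lin D (lin D y) = lin (\<lambda>x. 0) y"
      unfolding lin_lin by (rule lin_cong) (use DD that in auto)
    then show ?thesis by (simp add: lin_def)
  qed
  have solve: "\<exists>u. Poly_Mapping.keys u \<subseteq> ?U (j+1) \<and> (\<forall>l\<in>L. Poly_Mapping.lookup (z - lin D u) l = 0)"
    if "Poly_Mapping.keys z \<subseteq> ?K j" "\<forall>l\<in>L. Poly_Mapping.lookup z l \<noteq> 0 \<longrightarrow> \<rho> l < r" for z j r
    using that
  proof (induction r arbitrary: z)
    case 0
    then show ?case by (intro exI[of _ 0]) auto
  next
    case (Suc r)
    define S where "S = {l \<in> L. deg l = j \<and> \<rho> l = r}"
    have finS: "finite S" using finL by (simp add: S_def)
    define q where "q l = Poly_Mapping.lookup z l / Poly_Mapping.lookup (D (\<mu> l)) l" for l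
    define u where "u = (\<Sum>l\<in>S. Poly_Mapping.single (\<mu> l) (q l))"
    have ku: "Poly_Mapping.keys u \<subseteq> ?U (j+1)"
      unfolding u_def by (rule keys_sum_subset) (auto simp: S_def deg\<mu>)
    have Du: "lin D u = (\<Sum>l\<in>S. chain_scale (q l) (D (\<mu> l)))"
      by (simp add: u_def lin_sum)
    define z' where "z' = z - lin D u"
    have "Poly_Mapping.keys (lin D u) \<subseteq> ?K j"
      using keysD[of u "j+1"] ku sub by auto
    then have kz: "Poly_Mapping.keys z' \<subseteq> ?K j"
      unfolding z'_def by (rule keys_diff_subset[OF Suc.prems(1)])
    have "\<rho> l < r" if l: "l \<in> L" and nz: "Poly_Mapping.lookup z' l \<noteq> 0" for l
    proof (rule ccontr)
      assume "\<not> \<rho> l < r"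
      then have r: "r \<le> \<rho> l" by simp
      have dl: "deg l = j" using kz nz by (auto simp: in_keys_iff)
      have "(\<Sum>l'\<in>S. q l' * Poly_Mapping.lookup (D (\<mu> l')) l)
          = (\<Sum>l'\<in>S. if l' = l then q l * Poly_Mapping.lookup (D (\<mu> l)) l else 0)"
      proof (rule sum.cong[OF refl])
        fix l' assume l': "l' \<in> S"
        then have "l' \<in> L" "\<rho> l' = r" by (auto simp: S_def)
        then show "q l' * Poly_Mapping.lookup (D (\<mu> l')) l
            = (if l' = l then q l * Poly_Mapping.lookup (D (\<mu> l)) l else 0)"
          using *(7)[of l' l] l r by auto
      qed
      also have "\<dots> = (if l \<in> S then Poly_Mapping.lookup z l else 0)"
        using finS *(6)[OF l] by (simp add: sum.delta q_def)
      finally have "Poly_Mapping.lookup z' l = Poly_Mapping.lookup z l - (if l \<in> S then Poly_Mapping.lookup z l else 0)"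
        by (simp add: z'_def lookup_minus Du lookup_sum)
      moreover have "Poly_Mapping.lookup z l = 0" if "l \<notin> S"
        using Suc.prems(2) l dl r that by (force simp: S_def)
      ultimately show False using nz by (auto split: if_splits)
    qed
    then obtain u' where u': "Poly_Mapping.keys u' \<subseteq> ?U (j+1)"
      "\<forall>l\<in>L. Poly_Mapping.lookup (z' - lin D u') l = 0"
      using Suc.IH[OF kz] by blast
    show ?case
    proof (intro exI[of _ "u + u'"] conjI)
      show "Poly_Mapping.keys (u + u') \<subseteq> ?U (j+1)" using keys_add[of u u'] ku u' by auto
      have "z - lin D (u + u') = z' - lin D u'" by (simp add: z'_def lin_add)
      then show "\<forall>l\<in>L. Poly_Mapping.lookup (z - lin D (u + u')) l = 0" using u' by simp
    qed
  qed
  have solve': "\<exists>u. Poly_Mapping.keys u \<subseteq> ?U (j+1) \<and> (\<forall>l\<in>L. Poly_Mapping.lookup (z - lin D u) l = 0)"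
    if "Poly_Mapping.keys z \<subseteq> ?K j" for z j
  proof (rule solve[OF that, of "Suc (sum \<rho> L)"])
    show "\<forall>l\<in>L. Poly_Mapping.lookup z l \<noteq> 0 \<longrightarrow> \<rho> l < Suc (sum \<rho> L)"
      using member_le_sum[of _ L \<rho>] finL by (auto simp: less_Suc_eq_le)
  qed
  \<comment> \<open>Among the \<open>l\<close> with \<open>\<mu> l\<close> in the support of
    \<open>u\<close>, one of maximal rank receives its coefficient in \<open>lin D u\<close> from
    \<open>\<mu> l\<close> alone, since any other contribution would come from a larger
    rank.\<close>
  have inj: "u = 0" if ku: "Poly_Mapping.keys u \<subseteq> \<mu> ` L"
    and z: "\<forall>l\<in>L. Poly_Mapping.lookup (lin D u) l = 0" for u
  proof (rule ccontr)
    assume "u \<noteq> 0"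
    let ?S = "{l \<in> L. \<mu> l \<in> Poly_Mapping.keys u}"
    have "?S \<noteq> {}" using ku \<open>u \<noteq> 0\<close> by (auto simp: keys_eq_empty[symmetric] simp del: keys_eq_empty)
    moreover have "finite ?S" using finL by simp
    ultimately have "Max (\<rho> ` ?S) \<in> \<rho> ` ?S" by (intro Max_in) auto
    then obtain l where l: "l \<in> ?S" and "\<rho> l = Max (\<rho> ` ?S)" by force
    then have mx: "\<rho> l' \<le> \<rho> l" if "l' \<in> ?S" for l'
      using that \<open>finite ?S\<close> by (metis (no_types, lifting) Max_ge finite_imageI imageI)
    have ks: "Poly_Mapping.keys u = \<mu> ` ?S" using ku by auto
    have inj: "inj_on \<mu> ?S" using *(5) by (auto simp: inj_on_def)
    have "Poly_Mapping.lookup (lin D u) l =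
        (\<Sum>l'\<in>?S. Poly_Mapping.lookup u (\<mu> l') * Poly_Mapping.lookup (D (\<mu> l')) l)"
      unfolding lookup_lin by (subst ks, subst sum.reindex[OF inj]) simp
    also have "\<dots> = (\<Sum>l'\<in>?S. if l' = l then Poly_Mapping.lookup u (\<mu> l) * Poly_Mapping.lookup (D (\<mu> l)) l else 0)"
    proof (rule sum.cong[OF refl])
      fix l' assume l': "l' \<in> ?S"
      then show "Poly_Mapping.lookup u (\<mu> l') * Poly_Mapping.lookup (D (\<mu> l')) l
          = (if l' = l then Poly_Mapping.lookup u (\<mu> l) * Poly_Mapping.lookup (D (\<mu> l)) l else 0)"
        using *(7)[of l' l] mx[OF l'] l by force
    qed
    also have "\<dots> = Poly_Mapping.lookup u (\<mu> l) * Poly_Mapping.lookup (D (\<mu> l)) l"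
      using \<open>finite ?S\<close> l by (simp add: sum.delta)
    finally show False using z l *(6)[of l] by (auto simp: in_keys_iff)
  qed
  have vanish: "z = 0" if "Poly_Mapping.keys z \<subseteq> X" "\<forall>x\<in>L \<union> C. Poly_Mapping.lookup z x = 0" "lin D z = 0" for z
  proof (rule inj)
    show "Poly_Mapping.keys z \<subseteq> \<mu> ` L" using that(1,2) *(1) by (force simp: in_keys_iff)
  qed (use that in simp)
  \<comment> \<open>The basis vector of \<open>c\<close> is corrected on the upper partners so that
    its boundary avoids \<open>L\<close>. That boundary also avoids \<open>C\<close>, since it lives
    in degree \<open>N - 1\<close> while all critical cells have degree \<open>N\<close>; being a
    cycle, it vanishes.\<close>
  have ex: "\<exists>v. Poly_Mapping.keys v \<subseteq> ?K N \<and> lin D v = 0 \<and> (\<forall>x\<in>L. Poly_Mapping.lookup v x = 0)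
      \<and> (\<forall>x\<in>C. Poly_Mapping.lookup v x = (if x = c then 1 else 0))" if c: "c \<in> C" for c
  proof -
    let ?c = "Poly_Mapping.single c (1::rat)"
    have kc: "Poly_Mapping.keys ?c \<subseteq> ?K N" using c degC sub by auto
    obtain u where u: "Poly_Mapping.keys u \<subseteq> ?U N" "\<forall>l\<in>L. Poly_Mapping.lookup (lin D ?c - lin D u) l = 0"
      using solve'[OF keysD[OF kc]] by auto
    define v where "v = ?c - u"
    have ku: "Poly_Mapping.keys u \<subseteq> ?K N" using u sub by auto
    have kv: "Poly_Mapping.keys v \<subseteq> ?K N" unfolding v_def by (rule keys_diff_subset[OF kc ku])
    have "lin D v = 0"
    proof (rule vanish)
      show "Poly_Mapping.keys (lin D v) \<subseteq> X" using keysD[OF kv] by auto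
      show "lin D (lin D v) = 0" using DD'[of v] kv by auto
      have "Poly_Mapping.lookup (lin D v) x = 0" if "x \<in> C" for x
        using keysD[OF kv] degC[OF that] by (force simp: in_keys_iff)
      then show "\<forall>x\<in>L \<union> C. Poly_Mapping.lookup (lin D v) x = 0"
        using u(2) by (auto simp: v_def lin_diff)
    qed
    moreover have "Poly_Mapping.lookup u x = 0" if "x \<in> L \<union> C" for x
      using u(1) that *(2,4) by (force simp: in_keys_iff)
    ultimately show ?thesis using kv c *(3)
      by (intro exI[of _ v]) (auto simp: v_def lookup_minus lookup_single when_def)
  qed
  obtain w where w0: "\<forall>c\<in>C. Poly_Mapping.keys (w c) \<subseteq> ?K N \<and> lin D (w c) = 0
      \<and> (\<forall>x\<in>L. Poly_Mapping.lookup (w c) x = 0)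
      \<and> (\<forall>x\<in>C. Poly_Mapping.lookup (w c) x = (if x = c then 1 else 0))"
    using bchoice[OF ballI[OF ex]] by (rule exE)
  have w: "Poly_Mapping.keys (w c) \<subseteq> ?K N" "lin D (w c) = 0"
     "\<And>x. x \<in> L \<Longrightarrow> Poly_Mapping.lookup (w c) x = 0"
     "\<And>x. x \<in> C \<Longrightarrow> Poly_Mapping.lookup (w c) x = (if x = c then 1 else 0)" if "c \<in> C" for c
    using w0[rule_format, OF that] by simp_all
  have finC: "finite C" using sub finX finite_subset by blast
  show ?thesis
  proof (rule that[of w])
    show "Poly_Mapping.keys (w c) \<subseteq> ?K N \<and> lin D (w c) = 0" if "c \<in> C" for c
      using w that by auto
    fix j z Cj
    assume Cj: "Cj = (if j = N then C else {})" and kz: "Poly_Mapping.keys z \<subseteq> ?K j" and Dz: "lin D z = 0"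
    let ?s = "\<lambda>a. \<Sum>c\<in>Cj. chain_scale (a c) (w c)"
    have CjC: "Cj \<subseteq> C" "\<And>c. c \<in> Cj \<Longrightarrow> j = N" by (auto simp: Cj split: if_splits)
    have finCj: "finite Cj" using finC CjC finite_subset by blast
    have ls: "Poly_Mapping.lookup (?s a) x = (if x \<in> Cj then a x else 0)" if "x \<in> L \<union> C" for a x
    proof -
      have "Poly_Mapping.lookup (?s a) x = (\<Sum>c\<in>Cj. if c = x then a c else 0)"
        unfolding lookup_sum
      proof (rule sum.cong[OF refl])
        fix c assume "c \<in> Cj"
        then show "Poly_Mapping.lookup (chain_scale (a c) (w c)) x = (if c = x then a c else 0)"
          using w(3,4)[of c x] that CjC *(3) by auto
      qed
      then show ?thesis using finCj by simp
    qed
    have ks: "Poly_Mapping.keys (?s a) \<subseteq> ?K j" for a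
    proof (rule keys_sum_subset)
      fix c assume "c \<in> Cj"
      then have "Poly_Mapping.keys (w c) \<subseteq> ?K j" using w(1) CjC by blast
      then show "Poly_Mapping.keys (chain_scale (a c) (w c)) \<subseteq> ?K j"
        using keys_chain_scale by (rule subset_trans[rotated])
    qed
    have Ds: "lin D (?s a) = 0" for a
      unfolding lin_sum lin_scale using w(2) CjC by (intro sum.neutral) auto
    obtain u where u: "Poly_Mapping.keys u \<subseteq> ?U (j+1)" "\<forall>l\<in>L. Poly_Mapping.lookup (z - lin D u) l = 0"
      using solve'[OF kz] by auto
    have ku: "Poly_Mapping.keys u \<subseteq> ?K (j+1)" using u sub by auto
    have kDu: "Poly_Mapping.keys (lin D u) \<subseteq> ?K j" using keysD[OF ku] by simp
    define z' where "z' = z - lin D u"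
    have kz': "Poly_Mapping.keys z' \<subseteq> ?K j" unfolding z'_def by (rule keys_diff_subset[OF kz kDu])
    \<comment> \<open>On \<open>L \<union> C\<close> each \<open>w c\<close> is the indicator of
      \<open>c\<close>, so the coefficients can only be the values of the reduced cycle at the
      critical cells.\<close>
    define a where "a = restrict (Poly_Mapping.lookup z') Cj"
    have "z' - ?s a = 0"
    proof (rule vanish)
      show "Poly_Mapping.keys (z' - ?s a) \<subseteq> X" using keys_diff_subset[OF kz' ks[of a]] by auto
      show "lin D (z' - ?s a) = 0"
        using Ds[of a] Dz DD'[of u] ku by (simp add: lin_diff z'_def subset_iff)
      show "\<forall>x\<in>L \<union> C. Poly_Mapping.lookup (z' - ?s a) x = 0"
      proof
        fix x assume x: "x \<in> L \<union> C"
        have "Poly_Mapping.lookup z' x = 0" if "x \<notin> Cj"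
        proof (cases "x \<in> L")
          case True then show ?thesis using u by (simp add: z'_def)
        next
          case False
          then have "x \<in> C" "j \<noteq> N" using x that Cj by auto
          then show ?thesis using kz' degC[of x] by (force simp: in_keys_iff)
        qed
        then show "Poly_Mapping.lookup (z' - ?s a) x = 0"
          using x by (simp add: lookup_minus ls a_def)
      qed
    qed
    then have za: "z - ?s a = lin D u" by (simp add: z'_def algebra_simps)
    show "\<exists>!a. a \<in> Cj \<rightarrow>\<^sub>E UNIV \<and> (\<exists>y. Poly_Mapping.keys y \<subseteq> ?K (j + 1) \<and> z - ?s a = lin D y)"
    proof (rule ex1I[of _ a])
      show "a \<in> Cj \<rightarrow>\<^sub>E UNIV \<and> (\<exists>y. Poly_Mapping.keys y \<subseteq> ?K (j + 1) \<and> z - ?s a = lin D y)"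
        using za ku by (auto simp: a_def)
      fix b assume b: "b \<in> Cj \<rightarrow>\<^sub>E UNIV \<and> (\<exists>y. Poly_Mapping.keys y \<subseteq> ?K (j + 1) \<and> z - ?s b = lin D y)"
      then obtain y where y: "Poly_Mapping.keys y \<subseteq> ?K (j + 1)" "z - ?s b = lin D y" by auto
      obtain y' where y': "Poly_Mapping.keys y' \<subseteq> ?U (j+1+1)"
        "\<forall>l\<in>L. Poly_Mapping.lookup ((y - u) - lin D y') l = 0"
        using solve'[OF keys_diff_subset[OF y(1) ku]] by auto
      have ky': "Poly_Mapping.keys y' \<subseteq> ?K (j+1+1)" using y' sub by auto
      have "Poly_Mapping.keys (lin D y') \<subseteq> ?K (j+1)" using keysD[OF ky'] by (simp only: add_diff_cancel_right')
      \<comment> \<open>For uniqueness, \<open>y - u\<close> is reduced so as to avoid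
        \<open>L\<close>. When \<open>Cj\<close> is nonempty, the remainder \<open>e\<close> has
        degree \<open>N + 1\<close>, where there are no critical cells, so it is supported on upper
        partners; its boundary is a combination of the \<open>w c\<close> and avoids
        \<open>L\<close>, which forces \<open>e = 0\<close>.\<close>
      define e where "e = (y - u) - lin D y'"
      have ke: "Poly_Mapping.keys e \<subseteq> ?K (j+1)"
        unfolding e_def by (intro keys_diff_subset y ku) fact
      have De: "lin D e = ?s a - ?s b"
        using y(2) za DD'[of y'] ky' by (simp add: e_def lin_diff lin_add subset_iff algebra_simps)
      have "a x = b x" for x
      proof (cases "x \<in> Cj")
        case True
        have "e = 0"
        proof (rule inj)
          show "Poly_Mapping.keys e \<subseteq> \<mu> ` L"
          proof
            fix x' assume x': "x' \<in> Poly_Mapping.keys e"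
            then have "x' \<in> X" "deg x' = N + 1" using ke CjC True by auto
            moreover have "x' \<notin> L" using x' y' unfolding e_def by (auto simp: in_keys_iff)
            ultimately show "x' \<in> \<mu> ` L" using *(1) degC[of x'] by auto
          qed
          show "\<forall>l\<in>L. Poly_Mapping.lookup (lin D e) l = 0"
            unfolding De using ls CjC *(3) by (auto simp: lookup_minus)
        qed
        then have "?s a = ?s b" using De by simp
        then show ?thesis using ls[of x a] ls[of x b] True CjC by auto
      next
        case False
        then show ?thesis using b by (auto simp: a_def dest: PiE_arb)
      qed
      then show "b = a" by auto
    qed
  qed
qed

section \<open>Counting permutations by cycles\<close>

text \<open>The permutation \<open>q\<close> inserts the new point \<open>a\<close> into the cycle
  of \<open>b\<close>, just before \<open>b\<close>: the preimage of \<open>b\<close> under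
  \<open>p\<close> now goes to \<open>a\<close>, and \<open>a\<close> goes to \<open>b\<close>. All
  other values on \<open>S\<close> are those of \<open>p\<close>.\<close>

lemma orbit_transpose_comp:
  assumes p: "p permutes S" "finite S" and a: "a \<notin> S" and b: "b \<in> S" and x: "x \<in> S"
  defines "q \<equiv> transpose a b \<circ> p"
  shows "orbit q x = (if b \<in> orbit p x then insert a (orbit p x) else orbit p x)"
proof -
  have pa: "p a = a" using p a by (auto simp: permutes_def)
  have qa: "q a = b" by (simp add: q_def pa)
  have q: "q y = (if p y = b then a else p y)" if "y \<in> S" for y
    using permutes_in_image[OF p(1), of y] that a by (auto simp: q_def transpose_def)
  have oS: "orbit p x \<subseteq> S" using permutes_orbit_subset[OF p(1) x] .
  have step: "p y \<in> orbit q x" if "q y \<in> orbit q x" "y \<in> S" for y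
    using that q[of y] qa orbit.step[of "q y" q x] by (auto split: if_splits)
  have 1: "y \<in> orbit q x" if "y \<in> orbit p x" for y
    using that
  proof induction
    case base then show ?case using step[OF orbit.base x] .
  next
    case (step y)
    then show ?case using \<open>\<And>y. q y \<in> orbit q x \<Longrightarrow> y \<in> S \<Longrightarrow> p y \<in> orbit q x\<close> oS orbit.step[OF step.IH] by auto
  qed
  have 2: "y \<in> (if b \<in> orbit p x then insert a (orbit p x) else orbit p x)" if "y \<in> orbit q x" for y
    using that
  proof induction
    case base
    then show ?case using q[OF x] orbit.base[of p x] by (auto split: if_splits)
  next
    case (step y)
    show ?case
    proof (cases "y = a")
      case True then show ?thesis using step.IH qa oS a by (auto split: if_splits)
    next
      case False
      then have y: "y \<in> orbit p x" using step.IH by (auto split: if_splits)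
      then show ?thesis using q[of y] oS orbit.step[OF y] by (auto split: if_splits)
    qed
  qed
  have 3: "a \<in> orbit q x" if b: "b \<in> orbit p x"
  proof -
    obtain y where y: "b = p y" "y = x \<or> y \<in> orbit p x" using b by cases auto
    then have "y \<in> S" using x oS by auto
    then have "q y = a" using q y by simp
    then show ?thesis using y(2) orbit.base[of q x] orbit.step[OF 1, of y] by auto
  qed
  show ?thesis
  proof (intro set_eqI iffI)
    fix y assume "y \<in> (if b \<in> orbit p x then insert a (orbit p x) else orbit p x)"
    then show "y \<in> orbit q x" using 1 3 by (auto split: if_splits)
  qed (rule 2)
qed

lemma card_orbits_transpose_comp:
  assumes p: "p permutes S" "finite S" and a: "a \<notin> S" and b: "b \<in> S"
  shows "card (orbit (transpose a b \<circ> p) ` insert a S) = card (orbit p ` S)"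
proof -
  let ?q = "transpose a b \<circ> p"
  let ?h = "\<lambda>X. if b \<in> X then insert a X else X"
  have pa: "p a = a" using p a by (auto simp: permutes_def)
  have "permutation ?q"
    using p b by (intro permutation_compose permutation_swap_id) (auto simp: permutation_permutes)
  \<comment> \<open>\<open>orbit f x\<close> is generated from \<open>f x\<close>, so that
    \<open>a\<close> lies in its own orbit has to be drawn from \<open>?q\<close> being a
    permutation with finite support.\<close>
  then have "orbit ?q (?q a) = orbit ?q a"
    by (intro self_in_orbit_step permutation_self_in_orbit)
  then have "orbit ?q a = orbit ?q b" by (simp add: pa)
  then have "orbit ?q ` insert a S = orbit ?q ` S" using b by auto
  also have "\<dots> = ?h ` orbit p ` S"
    unfolding image_image using orbit_transpose_comp[OF p a b] by (intro image_cong refl) auto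
  also have "card \<dots> = card (orbit p ` S)"
  proof (rule card_image, rule inj_onI)
    fix X Y assume XY: "X \<in> orbit p ` S" "Y \<in> orbit p ` S" "?h X = ?h Y"
    have "a \<notin> X" "a \<notin> Y" using XY a permutes_orbit_subset[OF p(1)] by auto
    moreover have "?h X - {a} = ?h Y - {a}" using XY by simp
    ultimately show "X = Y" by (auto split: if_splits)
  qed
  finally show ?thesis .
qed

lemma card_orbits_insert_fixed:
  assumes p: "p permutes S" "finite S" and a: "a \<notin> S"
  shows "card (orbit p ` insert a S) = Suc (card (orbit p ` S))"
proof -
  have "p a = a" using p a by (auto simp: permutes_def)
  then have "orbit p a = {a}" by (simp add: orbit_eq_singleton_iff)
  moreover have "{a} \<notin> orbit p ` S" using permutes_orbit_subset[OF p(1)] a by blast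
  ultimately show ?thesis using p(2) by simp
qed

text \<open>A permutation of \<open>{1..Suc n}\<close> is \<open>transpose (Suc n) b\<close> after a
  permutation of \<open>{1..n}\<close>, where \<open>b\<close> is the image of \<open>Suc n\<close>.
  The choice \<open>b = Suc n\<close> adds a fixed point and hence a cycle; each of the other
  \<open>n\<close> choices leaves the number of cycles unchanged. This is the recursion of
  \<open>stirling\<close>.\<close>

lemma abs_stirling1_eq_stirling: "abs_stirling1 n k = stirling n k"
proof (induction n k rule: stirling.induct)
  case 1
  have "{p. p permutes {1..0::nat} \<and> num_cycles 0 p = 0} = {id}" by (auto simp: num_cycles_def)
  then show ?case by (simp add: abs_stirling1_def)
next
  case (2 k)
  then show ?case by (simp add: abs_stirling1_def num_cycles_def)
next
  case (3 n)
  have "{p. p permutes {1..Suc n} \<and> num_cycles (Suc n) p = 0} = {}" by (auto simp: num_cycles_def)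
  then show ?case unfolding abs_stirling1_def by (simp only: card.empty stirling.simps)
next
  case (4 n k)
  let ?P = "\<lambda>k. {p. p permutes {1..n} \<and> num_cycles n p = k}"
  let ?a = "Suc n"
  let ?h = "\<lambda>(b, p). transpose ?a b \<circ> p"
  have fin: "finite (?P k)" for k
    by (rule finite_subset[OF _ finite_permutations[of "{1..n}"]]) auto
  have ins: "insert ?a {1..n} = {1..Suc n}" by auto
  have nc1: "num_cycles (Suc n) p = Suc (num_cycles n p)" if "p permutes {1..n}" for p
    using card_orbits_insert_fixed[OF that, of ?a] unfolding num_cycles_def ins by simp
  have nc2: "num_cycles (Suc n) (transpose ?a b \<circ> p) = num_cycles n p" if "p permutes {1..n}" "b \<in> {1..n}" for p b
    using card_orbits_transpose_comp[OF that(1) _ _ that(2), of ?a] unfolding num_cycles_def ins by simp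
  let ?S = "({?a} \<times> ?P k) \<union> ({1..n} \<times> ?P (Suc k))"
  have "{p. p permutes {1..Suc n} \<and> num_cycles (Suc n) p = Suc k} = ?h ` ?S"
  proof -
    have "{p. p permutes {1..Suc n} \<and> num_cycles (Suc n) p = Suc k}
        = {p \<in> {p. p permutes insert ?a {1..n}}. num_cycles (Suc n) p = Suc k}" unfolding ins by auto
    also have "\<dots> = ?h ` {x \<in> {(b, p). b \<in> insert ?a {1..n} \<and> p \<in> {p. p permutes {1..n}}}. num_cycles (Suc n) (?h x) = Suc k}"
      unfolding permutes_insert by auto
    also have "{x \<in> {(b, p). b \<in> insert ?a {1..n} \<and> p \<in> {p. p permutes {1..n}}}. num_cycles (Suc n) (?h x) = Suc k} = ?S"
      using nc1 nc2 by (auto simp del: atLeastAtMost_iff)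
    finally show ?thesis .
  qed
  moreover have "inj_on ?h ?S"
  proof (rule inj_onI)
    fix x y assume xy: "x \<in> ?S" "y \<in> ?S" "?h x = ?h y"
    obtain b p c q where x: "x = (b, p)" "y = (c, q)" by (cases x, cases y)
    have "p permutes {1..n}" "q permutes {1..n}" using xy x by auto
    then have "p ?a = ?a" "q ?a = ?a" by (auto simp: permutes_def)
    moreover have "(transpose ?a b \<circ> p) ?a = (transpose ?a c \<circ> q) ?a" using xy(3) x by simp
    ultimately have "b = c" by simp
    moreover have "transpose ?a b \<circ> (transpose ?a b \<circ> p) = transpose ?a b \<circ> (transpose ?a b \<circ> q)"
      using xy(3) x \<open>b = c\<close> by simp
    then have "p = q" by (simp add: o_assoc[symmetric] fun_eq_iff)
    ultimately show "x = y" using x by simp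
  qed
  ultimately have "abs_stirling1 (Suc n) (Suc k) = card ?S"
    unfolding abs_stirling1_def by (simp add: card_image)
  also have "\<dots> = card ({?a} \<times> ?P k) + card ({1..n} \<times> ?P (Suc k))"
    by (rule card_Un_disjoint) (use fin in auto)
  also have "\<dots> = stirling (Suc n) (Suc k)"
    using 4 by (simp add: card_cartesian_product abs_stirling1_def)
  finally show ?case .
qed

section \<open>Forests as laminar families\<close>

text \<open>A forest with leaves \<open>{1..n}\<close> is encoded by the leaf sets of its inner vertices.\<close>

definition singles :: "nat \<Rightarrow> nat set set" where
  "singles n = (\<lambda>i. {i}) ` {1..n}"

definition laminar :: "nat set set \<Rightarrow> bool" where
  "laminar F \<longleftrightarrow> (\<forall>X\<in>F. \<forall>Y\<in>F. X \<subseteq> Y \<or> Y \<subseteq> X \<or> X \<inter> Y = {})"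

definition forest :: "nat \<Rightarrow> nat set set \<Rightarrow> bool" where
  "forest n F \<longleftrightarrow> F \<subseteq> Pow {1..n} \<and> (\<forall>X\<in>F. 2 \<le> card X) \<and> laminar F"

text \<open>A leaf in no member of \<open>F\<close> is a root by itself. With this convention the
  roots of a hierarchy are exactly the inputs of the vertex \<open>{1..n}\<close>, see
  \<open>roots_eq_kids\<close>.\<close>

definition roots :: "nat \<Rightarrow> nat set set \<Rightarrow> nat set set" where
  "roots n F = {X \<in> F \<union> singles n. \<not> (\<exists>Y\<in>F. X \<subset> Y)}"

definition forests :: "nat \<Rightarrow> nat \<Rightarrow> nat set set set" where
  "forests n k = {F. forest n F \<and> card (roots n F) = k}"

text \<open>The incidence relation between cells whose alternating set consists of all roots, see
  \<open>prunes_iff_lookup\<close>. Contracting the edge of a root is excluded: it would replace the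
  root by one of its children and leave labels uncovered.\<close>

definition prunes :: "nat set set \<Rightarrow> nat set set \<Rightarrow> bool" where
  "prunes F F' \<longleftrightarrow> (\<exists>X\<in>F. (\<exists>Y\<in>F. X \<subset> Y) \<and> F' = F - {X})"

lemma laminarD: "laminar F \<Longrightarrow> X \<in> F \<Longrightarrow> Y \<in> F \<Longrightarrow> X \<subseteq> Y \<or> Y \<subseteq> X \<or> X \<inter> Y = {}"
  unfolding laminar_def by blast

lemma laminar_mono: "laminar F \<Longrightarrow> F' \<subseteq> F \<Longrightarrow> laminar F'"
  unfolding laminar_def by blast

lemma laminar_insert:
  "laminar F \<Longrightarrow> (\<And>Y. Y \<in> F \<Longrightarrow> X \<subseteq> Y \<or> Y \<subseteq> X \<or> X \<inter> Y = {}) \<Longrightarrow> laminar (insert X F)"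
  unfolding laminar_def by (simp add: Int_commute) blast

lemma finite_forest: "forest n F \<Longrightarrow> finite F"
  unfolding forest_def by (meson finite_Pow_iff finite_atLeastAtMost finite_subset)

lemma finite_singles [simp]: "finite (singles n)"
  by (simp add: singles_def)

lemma finite_roots: "forest n F \<Longrightarrow> finite (roots n F)"
  using finite_forest[of n F] by (simp add: roots_def)

lemma finite_forests: "finite (forests n k)"
  by (rule finite_subset[of _ "Pow (Pow {1..n})"]) (auto simp: forests_def forest_def)

lemma roots_remove:
  assumes "forest n F" "X \<in> F" "Y \<in> F" "X \<subset> Y"
  shows "roots n (F - {X}) = roots n F"
proof -
  have "X \<notin> singles n" using assms(1,2) by (auto simp: forest_def singles_def)
  moreover have "(\<exists>Z'\<in>F - {X}. Z \<subset> Z') \<longleftrightarrow> (\<exists>Z'\<in>F. Z \<subset> Z')" for Z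
    using assms(3,4) by (metis Diff_iff psubset_trans psubset_eq singletonD)
  ultimately show ?thesis using assms by (auto simp: roots_def)
qed

section \<open>The smallest inner vertex above a leaf\<close>

lemma Inter_chain_mem:
  assumes "finite S" "S \<noteq> {}" "\<And>X Y. X \<in> S \<Longrightarrow> Y \<in> S \<Longrightarrow> X \<subseteq> Y \<or> Y \<subseteq> X"
  shows "\<Inter>S \<in> S"
  using assms
proof (induction S rule: finite_ne_induct)
  case (insert X S)
  then have "\<Inter>S \<in> S" by simp
  then have "X \<subseteq> \<Inter>S \<or> \<Inter>S \<subseteq> X" using insert.prems by simp
  then have "\<Inter>(insert X S) = X \<or> \<Inter>(insert X S) = \<Inter>S" by auto
  then show ?case using \<open>\<Inter>S \<in> S\<close> by auto
qed simp

text \<open>Meaningful only for \<open>N\<close> in \<open>\<Union>F\<close>; otherwise the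
  intersection of the empty family is \<open>UNIV\<close>. Laminarity makes the members around
  \<open>N\<close> a chain, so the intersection is attained.\<close>

definition least_around :: "nat \<Rightarrow> nat set set \<Rightarrow> nat set" where
  "least_around N F = \<Inter>{X \<in> F. N \<in> X}"

lemma least_around:
  assumes "forest n F" "N \<in> \<Union>F"
  shows "least_around N F \<in> F" "N \<in> least_around N F"
    "\<And>X. X \<in> F \<Longrightarrow> N \<in> X \<Longrightarrow> least_around N F \<subseteq> X"
proof -
  have "\<Inter>{X \<in> F. N \<in> X} \<in> {X \<in> F. N \<in> X}"
  proof (rule Inter_chain_mem)
    fix X Y assume "X \<in> {X \<in> F. N \<in> X}" "Y \<in> {X \<in> F. N \<in> X}"
    then show "X \<subseteq> Y \<or> Y \<subseteq> X"
      using assms laminarD[of F X Y] by (auto simp: forest_def)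
  qed (use assms finite_forest in auto)
  then show "least_around N F \<in> F" "N \<in> least_around N F" by (auto simp: least_around_def)
qed (auto simp: least_around_def)

text \<open>With \<open>P\<close> the least member around \<open>N\<close>, the toggled set
  \<open>Z = P - {N}\<close> omits \<open>N\<close>, so toggling leaves \<open>P\<close> and
  therefore \<open>Z\<close> unchanged; as a proper subset of \<open>P\<close> it does not affect
  the roots, and \<open>3 \<le> card P\<close> makes it large enough to belong to a forest.
  Acyclicity: once \<open>Z\<close> is present, a different deletion can lead to a forest lacking
  its own toggled set only by deleting \<open>P\<close>, after which the least member around
  \<open>N\<close> is strictly larger.\<close>

lemma matching_deep:
  "acyclic_matching {F \<in> forests N k. N \<in> \<Union>F \<and> 3 \<le> card (least_around N F)} prunes {}"
proof -
  let ?P = "least_around N"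
  define X3 where "X3 = {F \<in> forests N k. N \<in> \<Union>F \<and> 3 \<le> card (?P F)}"
  define Z where "Z F = ?P F - {N}" for F
  define L where "L = {F \<in> X3. Z F \<notin> F}"
  define \<rho> where "\<rho> F = N - card (?P F)" for F
  have PF: "?P F \<in> F" "N \<in> ?P F" "\<And>X. X \<in> F \<Longrightarrow> N \<in> X \<Longrightarrow> ?P F \<subseteq> X" "?P F \<subseteq> {1..N}"
    "forest N F" "2 \<le> card (Z F)" "Z F \<subset> ?P F" "N \<notin> Z F" if "F \<in> X3" for F
  proof -
    show *: "forest N F" using that by (simp add: X3_def forests_def)
    have "N \<in> \<Union>F" "3 \<le> card (?P F)" using that by (auto simp: X3_def)
    note l = least_around[OF * this(1)]
    then show "?P F \<in> F" "N \<in> ?P F" "\<And>X. X \<in> F \<Longrightarrow> N \<in> X \<Longrightarrow> ?P F \<subseteq> X" by auto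
    show "?P F \<subseteq> {1..N}" using l(1) * by (auto simp: forest_def)
    then have "finite (?P F)" using finite_subset by blast
    then show "2 \<le> card (Z F)" using l(2) \<open>3 \<le> card (?P F)\<close> by (simp add: Z_def)
    show "Z F \<subset> ?P F" "N \<notin> Z F" using l(2) by (auto simp: Z_def)
  qed
  have Peq: "?P (insert X F) = ?P F" "?P (F - {X}) = ?P F" if "N \<notin> X" for X F
  proof -
    have "{Y \<in> insert X F. N \<in> Y} = {Y \<in> F. N \<in> Y}" "{Y \<in> F - {X}. N \<in> Y} = {Y \<in> F. N \<in> Y}"
      using that by auto
    then show "?P (insert X F) = ?P F" "?P (F - {X}) = ?P F" by (simp_all only: least_around_def)
  qed
  have up: "insert (Z F) F \<in> X3 \<and> Z (insert (Z F) F) = Z F" if F: "F \<in> X3" for F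
  proof -
    note P = PF[OF F]
    have Pe: "?P (insert (Z F) F) = ?P F" by (rule Peq) (use P in auto)
    have fo: "forest N (insert (Z F) F)"
      unfolding forest_def
    proof (intro conjI)
      show "insert (Z F) F \<subseteq> Pow {1..N}" using P by (auto simp: forest_def)
      show "\<forall>X\<in>insert (Z F) F. 2 \<le> card X" using P by (auto simp: forest_def)
      show "laminar (insert (Z F) F)"
      proof (rule laminar_insert)
        show "laminar F" using P by (simp add: forest_def)
        fix Y assume Y: "Y \<in> F"
        show "Z F \<subseteq> Y \<or> Y \<subseteq> Z F \<or> Z F \<inter> Y = {}"
        proof (cases "N \<in> Y")
          case True then show ?thesis using P(3)[OF Y] by (auto simp: Z_def)
        next
          case False
          then show ?thesis using laminarD[OF \<open>laminar F\<close> P(1) Y] P(2) by (auto simp: Z_def)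
        qed
      qed
    qed
    have "roots N (insert (Z F) F) = roots N F"
    proof (cases "Z F \<in> F")
      case True then show ?thesis by (simp add: insert_absorb)
    next
      case False
      then show ?thesis using roots_remove[OF fo, of "Z F" "?P F"] P by simp
    qed
    then show ?thesis using F fo Pe P(2) by (auto simp: X3_def forests_def Z_def)
  qed
  have down: "F - {Z F} \<in> L \<and> Z (F - {Z F}) = Z F" if F: "F \<in> X3" and Z: "Z F \<in> F" for F
  proof -
    note P = PF[OF F]
    have Pe: "?P (F - {Z F}) = ?P F" by (rule Peq) (use P in auto)
    have "forest N (F - {Z F})" using P(5) laminar_mono by (fastforce simp: forest_def)
    moreover have "roots N (F - {Z F}) = roots N F" using roots_remove[OF P(5) Z P(1,7)] .
    moreover have "N \<in> \<Union>(F - {Z F})" using P(1,2,7,8) by blast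
    ultimately show ?thesis using F Pe by (auto simp: L_def X3_def forests_def Z_def)
  qed
  have "acyclic_matching X3 prunes {}"
    unfolding acyclic_matching_def
  proof (intro exI[of _ L] exI[of _ "\<lambda>F. insert (Z F) F"] exI[of _ \<rho>] conjI ballI impI)
    have Lup: "insert (Z F) F \<in> X3" "Z (insert (Z F) F) = Z F" "Z F \<notin> F" "F \<in> X3" if "F \<in> L" for F
      using up that by (auto simp: L_def)
    show "L \<union> (\<lambda>F. insert (Z F) F) ` L \<union> {} = X3"
    proof (intro equalityI subsetI)
      fix F assume F: "F \<in> X3"
      show "F \<in> L \<union> (\<lambda>F. insert (Z F) F) ` L \<union> {}"
      proof (cases "Z F \<in> F")
        case True
        have "F = insert (Z (F - {Z F})) (F - {Z F})" using down[OF F True] True by auto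
        then show ?thesis using down[OF F True] by blast
      qed (use F in \<open>simp add: L_def\<close>)
    qed (use Lup in auto)
    show "L \<inter> (\<lambda>F. insert (Z F) F) ` L = {}"
    proof -
      have "insert (Z F) F \<notin> L" if "F \<in> L" for F using Lup(2)[OF that] by (simp add: L_def)
      then show ?thesis by blast
    qed
    show "inj_on (\<lambda>F. insert (Z F) F) L"
      by (rule inj_onI) (metis Lup(2,3) insert_ident)
    fix F assume F: "F \<in> L"
    note P = PF[OF Lup(4)[OF F]]
    show "prunes (insert (Z F) F) F"
      unfolding prunes_def using Lup(3)[OF F] P(1,7) by blast
    fix F' assume F': "F' \<in> L" and E: "prunes (insert (Z F) F) F'" "F' \<noteq> F"
    note P' = PF[OF Lup(4)[OF F']]
    obtain X where X: "F' = insert (Z F) F - {X}" using E by (auto simp: prunes_def)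
    with E Lup(3)[OF F] have XZ: "X \<noteq> Z F" by auto
    have "?P F' \<in> F" using P'(1,2) X P(8) by auto
    then have "?P F \<subseteq> ?P F'" using P(3) P'(2) by blast
    \<comment> \<open>If the least member had survived, the toggled set of \<open>F'\<close> would
      still be \<open>Z F\<close>, which lies in \<open>F'\<close>.\<close>
    moreover have "?P F \<noteq> ?P F'"
      using Lup(3)[OF F'] X XZ by (auto simp: Z_def)
    moreover have fin: "finite (?P F')" using P'(4) finite_subset by blast
    ultimately have "card (?P F) < card (?P F')" by (meson psubsetI psubset_card_mono)
    moreover have "card (?P F') \<le> N" using card_mono[OF _ P'(4)] by simp
    ultimately show "\<rho> F' < \<rho> F" by (simp add: \<rho>_def)
  qed auto
  then show ?thesis by (simp add: X3_def)
qed

section \<open>Forests with a cherry at the last leaf\<close>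

definition graft :: "nat \<Rightarrow> nat \<Rightarrow> nat set \<Rightarrow> nat set" where
  "graft N c X = (if c \<in> X then insert N X else X)"

text \<open>The leaf \<open>c\<close> becomes an inner vertex with children \<open>c\<close> and
  \<open>N\<close>: the singleton \<open>{c}\<close>, inserted before grafting, turns into the
  member \<open>{c, N}\<close>, and every vertex above \<open>c\<close> acquires
  \<open>N\<close>.\<close>

definition add_cherry :: "nat \<Rightarrow> nat \<Rightarrow> nat set set \<Rightarrow> nat set set" where
  "add_cherry N c F = graft N c ` insert {c} F"

text \<open>On sets without \<open>N\<close>, grafting is an order embedding. Containment, and with
  it roots and prunings, transfers along it.\<close>

lemma graft_subset_iff: "N \<notin> X \<Longrightarrow> N \<notin> Y \<Longrightarrow> graft N c X \<subseteq> graft N c Y \<longleftrightarrow> X \<subseteq> Y"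
  by (auto simp: graft_def)

lemma graft_eq_iff: "N \<notin> X \<Longrightarrow> N \<notin> Y \<Longrightarrow> graft N c X = graft N c Y \<longleftrightarrow> X = Y"
  using graft_subset_iff[of N X Y c] graft_subset_iff[of N Y X c] by auto

lemma graft_psubset_iff: "N \<notin> X \<Longrightarrow> N \<notin> Y \<Longrightarrow> graft N c X \<subset> graft N c Y \<longleftrightarrow> X \<subset> Y"
  using graft_subset_iff[of N X Y c] graft_eq_iff[of N X Y c] by (simp add: psubset_eq)

lemma forest_mem:
  assumes "forest m F" "X \<in> F"
  shows "Suc m \<notin> X" "X \<subseteq> {1..m}" "2 \<le> card X" "X \<noteq> {}" "X \<noteq> {c}" "finite X"
proof -
  show *: "X \<subseteq> {1..m}" "2 \<le> card X" using assms by (auto simp: forest_def)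
  then show "Suc m \<notin> X" "X \<noteq> {}" "X \<noteq> {c}" by auto
  show "finite X" using * finite_subset by blast
qed

context
  fixes m c :: nat
  assumes c: "c \<in> {1..m}"
begin

lemma c_ne: "c \<noteq> Suc m" "Suc m \<noteq> c" using c by auto

lemma graft_c: "graft (Suc m) c {c} = {c, Suc m}"
  by (auto simp: graft_def)

lemma inj_graft:
  assumes "forest m F"
  shows "inj_on (graft (Suc m) c) (insert {c} (F \<union> singles m))"
  by (rule inj_onI, subst (asm) graft_eq_iff) (use c_ne forest_mem(1)[OF assms] in \<open>auto simp: singles_def\<close>)

lemma forest_add_cherry:
  assumes F: "forest m F"
  shows "forest (Suc m) (add_cherry (Suc m) c F)"
  unfolding forest_def
proof (intro conjI ballI)
  show "add_cherry (Suc m) c F \<subseteq> Pow {1..Suc m}"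
    using forest_mem(2)[OF F] c by (fastforce simp: add_cherry_def graft_def split: if_splits)
  show "2 \<le> card X" if X: "X \<in> add_cherry (Suc m) c F" for X
  proof -
    obtain Y where Y: "X = graft (Suc m) c Y" "Y = {c} \<or> Y \<in> F" using X by (auto simp: add_cherry_def)
    from Y(2) show ?thesis
    proof
      assume "Y = {c}" then show ?thesis using Y(1) graft_c c_ne by simp
    next
      assume "Y \<in> F"
      from forest_mem[OF F this] show ?thesis using Y(1) by (simp add: graft_def)
    qed
  qed
  have ne: "Suc m \<notin> X" if "X \<in> insert {c} F" for X using that forest_mem(1)[OF F] c_ne by auto
  show "laminar (add_cherry (Suc m) c F)"
    unfolding laminar_def
  proof (intro ballI)
    fix X Y assume "X \<in> add_cherry (Suc m) c F" "Y \<in> add_cherry (Suc m) c F"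
    then obtain X' Y' where XY: "X = graft (Suc m) c X'" "Y = graft (Suc m) c Y'"
      "X' \<in> insert {c} F" "Y' \<in> insert {c} F" by (auto simp: add_cherry_def)
    have "X' \<subseteq> Y' \<or> Y' \<subseteq> X' \<or> X' \<inter> Y' = {}"
      using XY(3,4) F laminarD[of F X' Y'] by (auto simp: forest_def)
    moreover have "graft (Suc m) c X' \<inter> graft (Suc m) c Y' = {}" if "X' \<inter> Y' = {}"
      using that ne[OF XY(3)] ne[OF XY(4)] unfolding graft_def by auto
    ultimately show "X \<subseteq> Y \<or> Y \<subseteq> X \<or> X \<inter> Y = {}"
      unfolding XY(1,2) graft_subset_iff[OF ne[OF XY(3)] ne[OF XY(4)]]
        graft_subset_iff[OF ne[OF XY(4)] ne[OF XY(3)]] by blast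
  qed
qed

text \<open>The only member that is not grafted from \<open>F\<close> comes from the singleton
  \<open>{c}\<close>, and no nonempty set lies properly inside a singleton.\<close>

lemma add_cherry_psubset:
  assumes F: "forest m F" and X: "X \<in> F \<union> singles m"
  shows "(\<exists>Y\<in>add_cherry (Suc m) c F. graft (Suc m) c X \<subset> Y) \<longleftrightarrow> (\<exists>Y\<in>F. X \<subset> Y)"
proof -
  have X': "Suc m \<notin> X" "X \<noteq> {}" using X forest_mem(1,4)[OF F, of X] by (auto simp: singles_def)
  have "(\<exists>Y\<in>add_cherry (Suc m) c F. graft (Suc m) c X \<subset> Y) \<longleftrightarrow> (\<exists>Y\<in>insert {c} F. X \<subset> Y)"
    using graft_psubset_iff[OF X'(1), of _ c] forest_mem(1)[OF F] c_ne by (auto simp: add_cherry_def)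
  then show ?thesis using X' by auto
qed

lemma card_roots_add_cherry:
  assumes F: "forest m F"
  shows "card (roots (Suc m) (add_cherry (Suc m) c F)) = card (roots m F)"
proof -
  let ?g = "graft (Suc m) c"
  \<comment> \<open>The old leaf \<open>{c}\<close> reappears as the inner vertex of the cherry; the
    singletons \<open>{c}\<close> and \<open>{Suc m}\<close> on the right are its two leaves and lie
    below it, so neither is a root.\<close>
  have *: "add_cherry (Suc m) c F \<union> singles (Suc m) = ?g ` (F \<union> singles m) \<union> {{c}, {Suc m}}"
  proof -
    have "singles (Suc m) = insert {Suc m} (singles m)"
      by (auto simp: singles_def atLeastAtMostSuc_conv)
    moreover have "?g ` singles m \<union> {{c}} = insert (?g {c}) (singles m)"
    proof -
      have "?g X = X" if "X \<in> singles m" "X \<noteq> {c}" for X using that by (auto simp: singles_def graft_def)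
      moreover have "{c} \<in> singles m" using c by (simp add: singles_def)
      ultimately have "?g ` (singles m - {{c}}) = singles m - {{c}}" "singles m = insert {c} (singles m - {{c}})"
        by (auto intro!: trans[OF image_cong[OF refl] image_ident])
      then have "?g ` singles m = insert (?g {c}) (singles m - {{c}})" by (metis image_insert)
      then show ?thesis using \<open>{c} \<in> singles m\<close> by blast
    qed
    then have "?g ` (F \<union> singles m) \<union> {{c}} = insert (?g {c}) (?g ` F \<union> singles m)" by auto
    ultimately show ?thesis by (auto simp: add_cherry_def)
  qed
  have cN: "{c, Suc m} \<in> add_cherry (Suc m) c F" using graft_c by (auto simp: add_cherry_def)
  have nr: "{c} \<subset> {c, Suc m}" "{Suc m} \<subset> {c, Suc m}" using c_ne by auto
  have "roots (Suc m) (add_cherry (Suc m) c F)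
      = {X \<in> ?g ` (F \<union> singles m). \<not> (\<exists>Y\<in>add_cherry (Suc m) c F. X \<subset> Y)}"
    unfolding roots_def * using nr cN by auto
  also have "\<dots> = ?g ` roots m F"
  proof -
    have *: "{y \<in> ?g ` S. P y} = ?g ` {x \<in> S. Q x}" if "\<And>x. x \<in> S \<Longrightarrow> P (?g x) \<longleftrightarrow> Q x" for S P Q
      using that by auto
    show ?thesis unfolding roots_def by (rule *) (simp only: add_cherry_psubset[OF F])
  qed
  also have "card \<dots> = card (roots m F)"
    by (rule card_image, rule inj_on_subset[OF inj_graft[OF F]]) (auto simp: roots_def)
  finally show ?thesis .
qed

lemma card_add_cherry:
  assumes F: "forest m F"
  shows "card (add_cherry (Suc m) c F) = Suc (card F)"
proof -
  have "card (add_cherry (Suc m) c F) = card (insert {c} F)"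
    unfolding add_cherry_def by (rule card_image, rule inj_on_subset[OF inj_graft[OF F]]) auto
  moreover have "{c} \<notin> F" using forest_mem(5)[OF F, of "{c}"] by auto
  ultimately show ?thesis using finite_forest[OF F] by simp
qed

lemma add_cherry_inj:
  assumes "forest m F" "forest m G" "add_cherry (Suc m) c F = add_cherry (Suc m) c G"
  shows "F = G"
proof -
  have inj: "inj_on (graft (Suc m) c) {X. Suc m \<notin> X}"
    by (rule inj_onI) (simp add: graft_eq_iff)
  have "insert {c} F = insert {c} G"
  proof (rule iffD1[OF inj_on_image_eq_iff[OF inj]])
    show "graft (Suc m) c ` insert {c} F = graft (Suc m) c ` insert {c} G"
      using assms(3) by (simp only: add_cherry_def)
    have "Suc m \<notin> X" if "X \<in> insert {c} F" for X
      using that c_ne forest_mem(1)[OF assms(1), of X] by blast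
    then show "insert {c} F \<subseteq> {X. Suc m \<notin> X}" by blast
    have "Suc m \<notin> X" if "X \<in> insert {c} G" for X
      using that c_ne forest_mem(1)[OF assms(2), of X] by blast
    then show "insert {c} G \<subseteq> {X. Suc m \<notin> X}" by blast
  qed
  moreover have "{c} \<notin> F" "{c} \<notin> G"
    using forest_mem(5)[OF assms(1), of "{c}" c] forest_mem(5)[OF assms(2), of "{c}" c] by auto
  ultimately show ?thesis using insert_ident by metis
qed

text \<open>Both families contain the cherry, so a pruning between them never deletes it and must
  delete the grafted copy of a member of \<open>F\<close>.\<close>

lemma prunes_add_cherry:
  assumes F: "forest m F" and G: "forest m G"
  shows "prunes (add_cherry (Suc m) c F) (add_cherry (Suc m) c G) \<longleftrightarrow> prunes F G"
proof
  let ?g = "graft (Suc m) c"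
  have rem: "add_cherry (Suc m) c F - {?g X} = add_cherry (Suc m) c (F - {X})" if "X \<in> F" for X
  proof -
    have "X \<noteq> {c}" using forest_mem(5)[OF F that] .
    then have "insert {c} F - {X} = insert {c} (F - {X})" by auto
    moreover have "?g ` (insert {c} F - {X}) = ?g ` insert {c} F - ?g ` {X}"
      by (rule inj_on_image_set_diff[OF inj_graft[OF F]]) (use that in auto)
    ultimately show ?thesis by (simp add: add_cherry_def)
  qed
  show "prunes (add_cherry (Suc m) c F) (add_cherry (Suc m) c G)" if E: "prunes F G"
  proof -
    obtain X where X: "X \<in> F" "\<exists>Y\<in>F. X \<subset> Y" "G = F - {X}" using E by (auto simp: prunes_def)
    then show ?thesis unfolding prunes_def
      using rem[OF X(1)] add_cherry_psubset[OF F, of X]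
      by (intro bexI[of _ "?g X"]) (auto simp: add_cherry_def)
  qed
  show "prunes F G" if E: "prunes (add_cherry (Suc m) c F) (add_cherry (Suc m) c G)"
  proof -
    obtain Y where Y: "Y \<in> add_cherry (Suc m) c F" "\<exists>Y'\<in>add_cherry (Suc m) c F. Y \<subset> Y'"
      "add_cherry (Suc m) c G = add_cherry (Suc m) c F - {Y}" using E by (auto simp: prunes_def)
    have "?g {c} \<in> add_cherry (Suc m) c G" by (simp add: add_cherry_def)
    then have "Y \<noteq> ?g {c}" using Y by auto
    then obtain X where X: "X \<in> F" "Y = ?g X" using Y(1) by (auto simp: add_cherry_def)
    have fX: "forest m (F - {X})" using F laminar_mono by (fastforce simp: forest_def)
    have "add_cherry (Suc m) c G = add_cherry (Suc m) c (F - {X})" using Y(3) rem[OF X(1)] X by simp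
    then have "G = F - {X}" using add_cherry_inj[OF G fX] by simp
    moreover have "\<exists>Y\<in>F. X \<subset> Y" using add_cherry_psubset[OF F, of X] X Y(2) by auto
    ultimately show ?thesis using X by (auto simp: prunes_def)
  qed
qed

text \<open>By laminarity every member other than the cherry contains both \<open>c\<close> and
  \<open>Suc m\<close> or neither. Deleting \<open>Suc m\<close> everywhere therefore loses no
  information; the members that contained it have at least three elements and keep at least
  two.\<close>

lemma cherry_forest:
  assumes F: "forest (Suc m) F" and cF: "{c, Suc m} \<in> F"
  shows "\<exists>G. forest m G \<and> F = add_cherry (Suc m) c G"
proof -
  let ?N = "Suc m"
  define G where "G = (\<lambda>X. X - {?N}) ` (F - {{c, ?N}})"
  have mem: "X \<subseteq> {1..?N}" "2 \<le> card X" "finite X" if "X \<in> F" for X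
    using that F finite_subset[of X "{1..?N}"] by (auto simp: forest_def)
  have lam: "laminar F" using F by (simp add: forest_def)
  have iff: "c \<in> X \<longleftrightarrow> ?N \<in> X" and ge: "?N \<in> X \<Longrightarrow> 3 \<le> card X"
    if X: "X \<in> F - {{c, ?N}}" for X
  proof -
    have "\<not> X \<subseteq> {c, ?N}"
    proof
      assume s: "X \<subseteq> {c, ?N}"
      have "card {c, ?N} \<le> card X" using mem(2)[of X] X c_ne by simp
      then show False using X card_seteq[OF _ s] by auto
    qed
    then consider "{c, ?N} \<subset> X" | "X \<inter> {c, ?N} = {}"
      using laminarD[OF lam _ cF, of X] X by auto
    note * = this
    then show "c \<in> X \<longleftrightarrow> ?N \<in> X" by cases auto
    show "3 \<le> card X" if "?N \<in> X"
    proof -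
      have "{c, ?N} \<subset> X" using * that by cases auto
      then have "card {c, ?N} < card X" using mem(3)[of X] X psubset_card_mono by blast
      then show ?thesis using c_ne by simp
    qed
  qed
  have gr: "graft ?N c (X - {?N}) = X" if "X \<in> F - {{c, ?N}}" for X
    using iff[OF that] c_ne by (auto simp: graft_def)
  have "graft ?N c ` G = F - {{c, ?N}}"
    unfolding G_def image_image using gr by force
  then have FG: "F = add_cherry ?N c G"
    unfolding add_cherry_def using cF graft_c by auto
  have "forest m G" unfolding forest_def
  proof (intro conjI ballI)
    show "G \<subseteq> Pow {1..m}"
    proof -
      have "X - {?N} \<subseteq> {1..m}" if "X \<in> F" for X using mem(1)[OF that] by fastforce
      then show ?thesis by (auto simp: G_def)
    qed
    fix X assume "X \<in> G"
    then obtain Y where Y: "Y \<in> F - {{c, ?N}}" "X = Y - {?N}" by (auto simp: G_def)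
    then show "2 \<le> card X" using ge[OF Y(1)] mem[of Y] by (cases "?N \<in> Y") auto
  next
    show "laminar G" unfolding laminar_def
    proof (intro ballI)
      fix X Y assume "X \<in> G" "Y \<in> G"
      then obtain X' Y' where "X' \<in> F" "Y' \<in> F" "X = X' - {?N}" "Y = Y' - {?N}" by (auto simp: G_def)
      then show "X \<subseteq> Y \<or> Y \<subseteq> X \<or> X \<inter> Y = {}" using laminarD[OF lam, of X' Y'] by auto
    qed
  qed
  then show ?thesis using FG by blast
qed

lemma cherry_forests:
  "{F \<in> forests (Suc m) k. {c, Suc m} \<in> F} = add_cherry (Suc m) c ` forests m k"
proof (intro equalityI subsetI)
  fix F assume "F \<in> {F \<in> forests (Suc m) k. {c, Suc m} \<in> F}"
  then show "F \<in> add_cherry (Suc m) c ` forests m k"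
    using cherry_forest[of F] card_roots_add_cherry by (auto simp: forests_def)
next
  fix F assume "F \<in> add_cherry (Suc m) c ` forests m k"
  then show "F \<in> {F \<in> forests (Suc m) k. {c, Suc m} \<in> F}"
    using forest_add_cherry card_roots_add_cherry graft_c by (auto simp: forests_def add_cherry_def)
qed

end

section \<open>The isolated last leaf, and the recursion\<close>

lemma roots_Suc_outside:
  assumes F: "forest m F"
  shows "roots (Suc m) F = insert {Suc m} (roots m F)"
proof -
  have "singles (Suc m) = insert {Suc m} (singles m)"
    by (auto simp: singles_def atLeastAtMostSuc_conv)
  then show ?thesis using forest_mem(1)[OF F] by (auto simp: roots_def)
qed

text \<open>The leaf \<open>Suc m\<close> is here itself a root, which shifts the number of roots by
  one and rules out having none.\<close>

lemma outside_forests: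
  "{F \<in> forests (Suc m) (Suc k). Suc m \<notin> \<Union>F} = forests m k"
  "{F \<in> forests (Suc m) 0. Suc m \<notin> \<Union>F} = {}"
proof -
  have f: "forest m F" if F: "forest (Suc m) F" "Suc m \<notin> \<Union>F" for F
  proof -
    have "X \<subseteq> {1..m}" if "X \<in> F" for X
    proof
      fix y assume y: "y \<in> X"
      have "X \<subseteq> {1..Suc m}" "Suc m \<notin> X" using F that unfolding forest_def by blast+
      with y have "y \<in> {1..Suc m}" "y \<noteq> Suc m" by blast+
      then show "y \<in> {1..m}" by auto
    qed
    then show ?thesis using F by (auto simp: forest_def)
  qed
  have g: "forest (Suc m) F" "Suc m \<notin> \<Union>F" if F: "forest m F" for F
    using F forest_mem(1,2)[OF F] by (fastforce simp: forest_def)+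
  have r: "card (roots (Suc m) F) = Suc (card (roots m F))" if F: "forest m F" for F
  proof -
    have "{Suc m} \<notin> roots m F" using forest_mem(1)[OF F] by (auto simp: roots_def singles_def)
    then show ?thesis using roots_Suc_outside[OF F] finite_roots[OF F] by simp
  qed
  show "{F \<in> forests (Suc m) (Suc k). Suc m \<notin> \<Union>F} = forests m k"
  proof (intro equalityI subsetI)
    fix F assume "F \<in> {F \<in> forests (Suc m) (Suc k). Suc m \<notin> \<Union>F}"
    then have F: "forest (Suc m) F" "Suc m \<notin> \<Union>F" "card (roots (Suc m) F) = Suc k" by (auto simp: forests_def)
    then show "F \<in> forests m k" using f[OF F(1,2)] r[OF f[OF F(1,2)]] by (simp add: forests_def)
  next
    fix F assume "F \<in> forests m k"
    then have F: "forest m F" "card (roots m F) = k" by (auto simp: forests_def)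
    then show "F \<in> {F \<in> forests (Suc m) (Suc k). Suc m \<notin> \<Union>F}"
      using g[OF F(1)] r[OF F(1)] by (simp add: forests_def)
  qed
  show "{F \<in> forests (Suc m) 0. Suc m \<notin> \<Union>F} = {}"
  proof -
    have False if "forest (Suc m) F" "Suc m \<notin> \<Union>F" "card (roots (Suc m) F) = 0" for F
      using f[OF that(1,2)] r[OF f[OF that(1,2)]] that(3) by simp
    then show ?thesis unfolding forests_def by blast
  qed
qed

text \<open>Prunings only delete sets that lie below another member. Hence they can neither create a
  cherry, nor remove the last leaf from \<open>\<Union>F\<close>, nor exchange one cherry for
  another, so the classes can be glued in the order deep, isolated, cherry. The count
  \<open>card F + k = n\<close> survives because the isolated leaf uses up one root and the cherry
  one member of \<open>F\<close>.\<close>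

theorem forests_matching:
  "\<exists>C. acyclic_matching (forests n k) prunes C \<and> card C = stirling n k \<and> (\<forall>F\<in>C. card F + k = n)"
proof (induction n arbitrary: k)
  case 0
  have "forest 0 F \<longleftrightarrow> F = {}" for F
  proof
    assume F: "forest 0 F"
    have "X \<notin> F" for X
    proof
      assume "X \<in> F"
      then have "X \<subseteq> {}" "2 \<le> card X" using F by (auto simp: forest_def)
      then show False by simp
    qed
    then show "F = {}" by blast
  qed (simp add: forest_def laminar_def)
  moreover have "roots 0 {} = {}" by (simp add: roots_def singles_def)
  ultimately have "forests 0 k = (if k = 0 then {{}} else {})" by (auto simp: forests_def)
  moreover have "stirling 0 k = (if k = 0 then 1 else 0)" by (cases k) auto
  moreover have "acyclic_matching X prunes X" for X
    unfolding acyclic_matching_def by (intro exI[of _ "{}"]) auto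
  ultimately show ?case by (intro exI[of _ "forests 0 k"]) auto
next
  case (Suc m)
  let ?N = "Suc m"
  define X1 where "X1 = {F \<in> forests ?N k. ?N \<notin> \<Union>F}"
  define X2 where "X2 c = {F \<in> forests ?N k. {c, ?N} \<in> F}" for c
  define X3 where "X3 = {F \<in> forests ?N k. ?N \<in> \<Union>F \<and> 3 \<le> card (least_around ?N F)}"
  have sub: "F' \<subseteq> F" if "prunes F F'" for F F' using that by (auto simp: prunes_def)
  have lam: "laminar F" "forest ?N F" if "F \<in> forests ?N k" for F using that by (auto simp: forests_def forest_def)
  have split: "forests ?N k = X3 \<union> (X1 \<union> (\<Union>c\<in>{1..m}. X2 c))"
  proof (intro equalityI subsetI)
    fix F assume F: "F \<in> forests ?N k"
    note fo = lam(2)[OF F]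
    show "F \<in> X3 \<union> (X1 \<union> (\<Union>c\<in>{1..m}. X2 c))"
    proof (cases "?N \<in> \<Union>F \<and> card (least_around ?N F) < 3")
      case True
      note l = least_around[OF fo, of ?N]
      have P: "least_around ?N F \<in> F" "?N \<in> least_around ?N F" using True l by auto
      then have "2 \<le> card (least_around ?N F)" "least_around ?N F \<subseteq> {1..?N}" using fo by (auto simp: forest_def)
      then have "card (least_around ?N F) = 2" using True by simp
      then obtain x y where "least_around ?N F = {x, y}" "x \<noteq> y" by (auto simp: card_2_iff)
      then obtain c where c: "least_around ?N F = {c, ?N}" "c \<noteq> ?N" using P(2) by auto
      then have "c \<in> {1..m}" using \<open>least_around ?N F \<subseteq> {1..?N}\<close> by auto
      then show ?thesis using c P(1) F by (auto simp: X2_def)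
    qed (use F in \<open>auto simp: X1_def X3_def\<close>)
  qed (auto simp: X1_def X2_def X3_def)
  have cherry: "card (least_around ?N F) \<le> 2" "?N \<in> \<Union>F" if "F \<in> forests ?N k" "{c, ?N} \<in> F" for F c
  proof -
    show "?N \<in> \<Union>F" using that by auto
    have "least_around ?N F \<subseteq> {c, ?N}" using that by (auto simp: least_around_def)
    then have "card (least_around ?N F) \<le> card {c, ?N}" by (intro card_mono) auto
    then show "card (least_around ?N F) \<le> 2" by (simp add: card_insert_if split: if_splits)
  qed
  have two: "c = c'" if "F \<in> forests ?N k" "{c, ?N} \<in> F" "{c', ?N} \<in> F" "c \<in> {1..m}" "c' \<in> {1..m}" for F c c'
    using laminarD[OF lam(1)[OF that(1)] that(2,3)] that(4,5) by auto
  \<comment> \<open>For \<open>k = 0\<close> truncated subtraction would give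
    \<open>stirling m 0\<close>, which is \<open>1\<close> for \<open>m = 0\<close>, whereas
    \<open>X1\<close> is empty because the isolated leaf is a root.\<close>
  have "\<exists>C1. acyclic_matching X1 prunes C1 \<and> card C1 = (if k = 0 then 0 else stirling m (k - 1)) \<and> (\<forall>F\<in>C1. card F + k = ?N)"
  proof (cases k)
    case 0
    then have "X1 = {}" using outside_forests(2) by (simp add: X1_def)
    then show ?thesis using 0 acyclic_matching_empty by (intro exI[of _ "{}"]) auto
  next
    case (Suc k')
    then have "X1 = forests m k'" using outside_forests(1) by (simp add: X1_def)
    then show ?thesis using Suc Suc.IH[of k'] by auto
  qed
  then obtain C1 where C1: "acyclic_matching X1 prunes C1"
    "card C1 = (if k = 0 then 0 else stirling m (k - 1))" "\<And>F. F \<in> C1 \<Longrightarrow> card F + k = ?N" by auto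
  obtain C where C: "acyclic_matching (forests m k) prunes C" "card C = stirling m k" "\<And>F. F \<in> C \<Longrightarrow> card F + k = m"
    using Suc.IH[of k] by auto
  have Csub: "C' \<subseteq> X" if "acyclic_matching X E C'" for X C' and E :: "nat set set \<Rightarrow> nat set set \<Rightarrow> bool"
    using that unfolding acyclic_matching_def by blast
  define C2 where "C2 c = add_cherry ?N c ` C" for c
  have inj: "inj_on (add_cherry ?N c) (forests m k)" if "c \<in> {1..m}" for c
    by (rule inj_onI, rule add_cherry_inj[OF that]) (auto simp: forests_def)
  have M2: "acyclic_matching (X2 c) prunes (C2 c)" if c: "c \<in> {1..m}" for c
    unfolding X2_def C2_def cherry_forests[OF c]
    by (rule acyclic_matching_image[OF inj[OF c] _ C(1)])
      (use prunes_add_cherry[OF c] in \<open>auto simp: forests_def\<close>)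
  have card2: "card (C2 c) = stirling m k" if c: "c \<in> {1..m}" for c
    unfolding C2_def using card_image[OF inj_on_subset[OF inj[OF c] Csub[OF C(1)]]] C(2) by simp
  have deg2: "card F + k = ?N" if "c \<in> {1..m}" "F \<in> C2 c" for c F
    using that card_add_cherry[OF that(1)] C(3) Csub[OF C(1)] by (auto simp: C2_def forests_def)
  have fin: "finite X1" "finite (X2 c)" "finite X3" for c
    using finite_forests by (simp_all add: X1_def X2_def X3_def)
  have dis2: "X2 c \<inter> X2 c' = {}" if "c \<in> {1..m}" "c' \<in> {1..m}" "c \<noteq> c'" for c c'
    using two that by (auto simp: X2_def)
  have M2': "acyclic_matching (\<Union>c\<in>{1..m}. X2 c) prunes (\<Union>c\<in>{1..m}. C2 c)"
  proof (rule acyclic_matching_UN)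
    fix c c' F F' assume "c \<in> {1..m}" "c' \<in> {1..m}" "c \<noteq> c'" "F \<in> X2 c" "F' \<in> X2 c'"
    then show "\<not> prunes F F'" using two[of F c c'] sub[of F F'] by (auto simp: X2_def)
  qed (use fin M2 dis2 in auto)
  have M12: "acyclic_matching (X1 \<union> (\<Union>c\<in>{1..m}. X2 c)) prunes (C1 \<union> (\<Union>c\<in>{1..m}. C2 c))"
  proof (rule acyclic_matching_union[OF fin(1) _ _ C1(1) M2'])
    show "X1 \<inter> (\<Union>c\<in>{1..m}. X2 c) = {}" by (auto simp: X1_def X2_def)
    fix F F' assume "F \<in> X1" "F' \<in> (\<Union>c\<in>{1..m}. X2 c)"
    then obtain c where "?N \<notin> \<Union>F" "{c, ?N} \<in> F'" by (auto simp: X1_def X2_def)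
    then show "\<not> prunes F F'" using sub[of F F'] by blast
  qed
  have M3: "acyclic_matching X3 prunes {}" unfolding X3_def by (rule matching_deep)
  have "acyclic_matching (forests ?N k) prunes ({} \<union> (C1 \<union> (\<Union>c\<in>{1..m}. C2 c)))"
    unfolding split
  proof (rule acyclic_matching_union[OF fin(3) _ _ M3 M12])
    show "X3 \<inter> (X1 \<union> (\<Union>c\<in>{1..m}. X2 c)) = {}"
    proof -
      have "F \<notin> X2 c" if "F \<in> X3" for F c
        using cherry(1)[of F c] that by (auto simp: X3_def X2_def)
      then show ?thesis by (auto simp: X1_def X3_def)
    qed
    fix F F' assume F: "F \<in> X3" and F': "F' \<in> X1 \<union> (\<Union>c\<in>{1..m}. X2 c)"
    show "\<not> prunes F F'"
    proof
      assume E: "prunes F F'"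
      then obtain X Y where X: "F' = F - {X}" "Y \<in> F" "X \<subset> Y" by (auto simp: prunes_def)
      have "?N \<in> \<Union>F" using F by (simp add: X3_def)
      then have "?N \<in> \<Union>F'" using X by (cases "?N \<in> X") auto
      then obtain c where "F' \<in> X2 c" using F' by (auto simp: X1_def)
      then have "{c, ?N} \<in> F" using sub[OF E] by (auto simp: X2_def)
      then show False using cherry(1)[of F c] F by (auto simp: X3_def)
    qed
  qed
  moreover have "card ({} \<union> (C1 \<union> (\<Union>c\<in>{1..m}. C2 c))) = stirling ?N k"
  proof -
    have s2: "C2 c \<subseteq> X2 c" if "c \<in> {1..m}" for c using Csub[OF M2[OF that]] .
    have "card (\<Union>c\<in>{1..m}. C2 c) = (\<Sum>c\<in>{1..m}. card (C2 c))"
    proof (rule card_UN_disjoint)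
      show "\<forall>c\<in>{1..m}. finite (C2 c)" using s2 fin(2) finite_subset by blast
      show "\<forall>c\<in>{1..m}. \<forall>c'\<in>{1..m}. c \<noteq> c' \<longrightarrow> C2 c \<inter> C2 c' = {}" using s2 dis2 by blast
    qed simp
    also have "\<dots> = m * stirling m k" using card2 by simp
    finally have "card (\<Union>c\<in>{1..m}. C2 c) = m * stirling m k" .
    moreover have "card (C1 \<union> (\<Union>c\<in>{1..m}. C2 c)) = card C1 + card (\<Union>c\<in>{1..m}. C2 c)"
    proof (rule card_Un_disjoint)
      show "finite C1" using Csub[OF C1(1)] fin(1) finite_subset by blast
      show "finite (\<Union>c\<in>{1..m}. C2 c)" using s2 fin(2) finite_subset by (metis finite_UN_I finite_atLeastAtMost)
      show "C1 \<inter> (\<Union>c\<in>{1..m}. C2 c) = {}"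
        using Csub[OF C1(1)] s2 by (fastforce simp: X1_def X2_def)
    qed
    \<comment> \<open>For \<open>k = 0\<close> the remaining term \<open>m * stirling m 0\<close>
      vanishes: either \<open>m\<close> is \<open>0\<close> or \<open>stirling m 0\<close>
      is.\<close>
    ultimately show ?thesis using C1(2) by (cases k) (cases m; simp)+
  qed
  ultimately show ?case using C1(3) deg2
    by (intro exI[of _ "{} \<union> (C1 \<union> (\<Union>c\<in>{1..m}. C2 c))"]) auto
qed

section \<open>Hierarchies\<close>

text \<open>A stable \<open>n\<close>-tree is encoded by the sets of labels above its edges. The vertices of the
  tree correspond to \<open>insert {1..n} F\<close> and its input flags to \<open>inputs n F\<close>; the input flag \<open>X\<close>
  is adjacent to the vertex \<open>par n F X\<close>.\<close>

definition hier :: "nat \<Rightarrow> nat set set \<Rightarrow> bool" where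
  "hier n F \<longleftrightarrow> forest n F \<and> {1..n} \<notin> F \<and> 2 \<le> n"

definition inputs :: "nat \<Rightarrow> nat set set \<Rightarrow> nat set set" where
  "inputs n F = F \<union> singles n"

definition par :: "nat \<Rightarrow> nat set set \<Rightarrow> nat set \<Rightarrow> nat set" where
  "par n F X = \<Inter>{Y \<in> insert {1..n} F. X \<subset> Y}"

definition kids :: "nat \<Rightarrow> nat set set \<Rightarrow> nat set \<Rightarrow> nat set set" where
  "kids n F P = {X \<in> inputs n F. par n F X = P}"

lemma hier_forest: "hier n F \<Longrightarrow> forest n F"
  by (simp add: hier_def)

lemma hier_finite: "hier n F \<Longrightarrow> finite F"
  using finite_forest hier_forest by blast

lemma hier_finite_inputs: "hier n F \<Longrightarrow> finite (inputs n F)"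
  using hier_finite by (simp add: inputs_def)

lemma hier_remove: "hier n F \<Longrightarrow> hier n (F - {Y})"
  using laminar_mono[of F "F - {Y}"] by (auto simp: hier_def forest_def)

lemma hier_vertex:
  assumes "hier n F" "X \<in> insert {1..n} F"
  shows "X \<subseteq> {1..n}" "2 \<le> card X" "finite X" "X \<noteq> {}" "X \<noteq> {i}"
proof -
  show *: "X \<subseteq> {1..n}" "2 \<le> card X" using assms by (auto simp: hier_def forest_def)
  then show "finite X" using finite_subset by blast
  show "X \<noteq> {}" "X \<noteq> {i}" using *(2) by auto
qed

lemma singlesE:
  assumes "X \<in> singles n" obtains i where "i \<in> {1..n}" "X = {i}"
  using assms by (auto simp: singles_def)

lemma hier_input:
  assumes "hier n F" "X \<in> inputs n F"
  shows "X \<subset> {1..n}" "finite X" "X \<noteq> {}"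
proof -
  have n: "2 \<le> n" "{1..n} \<notin> F" using assms(1) by (auto simp: hier_def)
  consider "X \<in> F" | "X \<in> singles n" using assms(2) by (auto simp: inputs_def)
  then have *: "X \<subset> {1..n} \<and> finite X \<and> X \<noteq> {}"
  proof cases
    case 1
    then show ?thesis using hier_vertex[OF assms(1), of X] n(2) by blast
  next
    case 2
    then obtain i where i: "i \<in> {1..n}" "X = {i}" by (rule singlesE)
    have "card X < card {1..n}" using i n by simp
    then show ?thesis using i by (metis psubsetI less_irrefl empty_subsetI insert_subset finite.emptyI finite.insertI insert_not_empty)
  qed
  then show "X \<subset> {1..n}" "finite X" "X \<noteq> {}" by auto
qed

lemma not_singles: "hier n F \<Longrightarrow> X \<in> insert {1..n} F \<Longrightarrow> X \<notin> singles n"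
  using hier_vertex(5) singlesE by metis

lemma inputs_remove: "hier n F \<Longrightarrow> Y \<in> F \<Longrightarrow> inputs n (F - {Y}) = inputs n F - {Y}"
  using not_singles[of n F Y] by (auto simp: inputs_def)

lemma inputs_laminar:
  assumes "hier n F" "X \<in> insert {1..n} (inputs n F)" "Y \<in> insert {1..n} (inputs n F)"
  shows "X \<subseteq> Y \<or> Y \<subseteq> X \<or> X \<inter> Y = {}"
proof -
  have s: "X \<subseteq> {1..n}" "Y \<subseteq> {1..n}"
    using hier_input(1)[OF assms(1)] assms(2,3) by (metis insert_iff order_refl psubset_imp_subset)+
  have "X \<in> F \<or> X \<in> singles n \<or> X = {1..n}" "Y \<in> F \<or> Y \<in> singles n \<or> Y = {1..n}"
    using assms(2,3) by (auto simp: inputs_def)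
  moreover have ?thesis if "X \<in> singles n" using that by (rule singlesE) auto
  moreover have ?thesis if "Y \<in> singles n" using that by (rule singlesE) auto
  moreover have ?thesis if "X \<in> F" "Y \<in> F"
    using laminarD[of F X Y] that assms(1) by (simp add: hier_def forest_def)
  ultimately show ?thesis using s by blast
qed

lemma psubset_input:
  assumes "hier n F" "X \<in> inputs n F" "Y \<in> inputs n F" "X \<subset> Y"
  shows "Y \<in> F"
proof (rule ccontr)
  assume "Y \<notin> F"
  then have "Y \<in> singles n" using assms(3) by (auto simp: inputs_def)
  then show False using assms(4) hier_input(3)[OF assms(1,2)] by (metis singlesE psubset_imp_subset psubsetE subset_singletonD)
qed

text \<open>The vertices properly containing the nonempty set \<open>X\<close> pairwise intersect,
  so laminarity makes them a finite chain and the intersection defining \<open>par\<close> is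
  attained.\<close>

lemma par:
  assumes "hier n F" "X \<in> inputs n F"
  shows "par n F X \<in> insert {1..n} F" "X \<subset> par n F X"
    "\<And>Y. Y \<in> insert {1..n} F \<Longrightarrow> X \<subset> Y \<Longrightarrow> par n F X \<subseteq> Y"
proof -
  have "par n F X \<in> {Y \<in> insert {1..n} F. X \<subset> Y}"
    unfolding par_def
  proof (rule Inter_chain_mem)
    show "finite {Y \<in> insert {1..n} F. X \<subset> Y}" using hier_finite[OF assms(1)] by simp
    show "{Y \<in> insert {1..n} F. X \<subset> Y} \<noteq> {}" using hier_input(1)[OF assms] by blast
    fix Y Z assume "Y \<in> {Y \<in> insert {1..n} F. X \<subset> Y}" "Z \<in> {Y \<in> insert {1..n} F. X \<subset> Y}"
    then have "Y \<in> insert {1..n} (inputs n F)" "Z \<in> insert {1..n} (inputs n F)" "X \<subseteq> Y \<inter> Z"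
      by (auto simp: inputs_def)
    then show "Y \<subseteq> Z \<or> Z \<subseteq> Y"
      using inputs_laminar[OF assms(1), of Y Z] hier_input(3)[OF assms] by blast
  qed
  then show "par n F X \<in> insert {1..n} F" "X \<subset> par n F X" by blast+
  show "\<And>Y. Y \<in> insert {1..n} F \<Longrightarrow> X \<subset> Y \<Longrightarrow> par n F X \<subseteq> Y"
    unfolding par_def by blast
qed

lemma par_eqI:
  assumes "P \<in> insert {1..n} F" "X \<subset> P" "\<And>Y. Y \<in> insert {1..n} F \<Longrightarrow> X \<subset> Y \<Longrightarrow> P \<subseteq> Y"
  shows "par n F X = P"
  unfolding par_def using assms by (intro equalityI Inter_lower Inter_greatest) auto

text \<open>Contracting the edge \<open>Y\<close> hands the inputs of the vertex \<open>Y\<close>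
  over to its parent and changes nothing else. This matches \<open>merge_vert\<close>, which keeps
  the name of the vertex at which the edge is an input.\<close>

lemma par_remove:
  assumes h: "hier n F" and Y: "Y \<in> F" and Z: "Z \<in> inputs n F" "Z \<noteq> Y"
  shows "par n (F - {Y}) Z = (if par n F Z = Y then par n F Y else par n F Z)"
proof (cases "par n F Z = Y")
  case True
  have Yi: "Y \<in> inputs n F" using Y by (simp add: inputs_def)
  note pZ = par[OF h Z(1)] and pY = par[OF h Yi]
  have "par n (F - {Y}) Z = par n F Y"
  proof (rule par_eqI)
    show "par n F Y \<in> insert {1..n} (F - {Y})" using pY(1,2) by blast
    show "Z \<subset> par n F Y" using pZ(2) pY(2) True by blast
    fix W assume W: "W \<in> insert {1..n} (F - {Y})" "Z \<subset> W"
    then have "Y \<subseteq> W" using pZ(3)[of W] True by blast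
    moreover have "W \<noteq> Y" using W Y h by (auto simp: hier_def)
    ultimately show "par n F Y \<subseteq> W" using pY(3)[of W] W by blast
  qed
  then show ?thesis using True by simp
next
  case False
  note pZ = par[OF h Z(1)]
  have "par n (F - {Y}) Z = par n F Z"
  proof (rule par_eqI)
    show "par n F Z \<in> insert {1..n} (F - {Y})" using pZ(1) False by blast
    show "Z \<subset> par n F Z" by (rule pZ(2))
    show "par n F Z \<subseteq> W" if "W \<in> insert {1..n} (F - {Y})" "Z \<subset> W" for W
    proof (rule pZ(3))
      show "W \<in> insert {1..n} F" using that(1) by blast
    qed (rule that(2))
  qed
  then show ?thesis using False by simp
qed

lemma kids_sub: "kids n F P \<subseteq> inputs n F"
  by (auto simp: kids_def)

lemma finite_kids: "hier n F \<Longrightarrow> finite (kids n F P)"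
  using finite_subset[OF kids_sub hier_finite_inputs] .

lemma kids_psubset: "hier n F \<Longrightarrow> X \<in> kids n F P \<Longrightarrow> X \<subset> P"
  using par(2)[of n F X] by (simp add: kids_def)

lemma kids_remove:
  assumes h: "hier n F" and Y: "Y \<in> F" and XY: "X \<noteq> Y"
  shows "kids n (F - {Y}) X = (kids n F X - {Y}) \<union> (if Y \<in> kids n F X then kids n F Y else {})"
proof (intro set_eqI)
  fix Z
  have Yi: "Y \<in> inputs n F" using Y by (simp add: inputs_def)
  have YY: "par n F Y \<noteq> Y" using par(2)[OF h Yi] by blast
  show "Z \<in> kids n (F - {Y}) X \<longleftrightarrow> Z \<in> (kids n F X - {Y}) \<union> (if Y \<in> kids n F X then kids n F Y else {})"
  proof (cases "Z \<in> inputs n F \<and> Z \<noteq> Y")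
    case True
    show ?thesis
    proof (cases "par n F Z = Y")
      case pZ: True
      then have "par n (F - {Y}) Z = par n F Y" using par_remove[OF h Y, of Z] True by simp
      then show ?thesis
        unfolding kids_def inputs_remove[OF h Y] using True pZ Yi XY by auto
    next
      case pZ: False
      then have "par n (F - {Y}) Z = par n F Z" using par_remove[OF h Y, of Z] True by simp
      then show ?thesis
        unfolding kids_def inputs_remove[OF h Y] using True pZ by auto
    qed
  next
    case False
    then show ?thesis unfolding kids_def inputs_remove[OF h Y] using YY by auto
  qed
qed

text \<open>A properly larger sibling would itself be a vertex around the smaller set, so the parent
  of the smaller one would lie inside it and could not be the common parent.\<close>

lemma siblings_disjoint:
  assumes h: "hier n F" and "X \<in> inputs n F" "Y \<in> inputs n F" "par n F X = par n F Y" "X \<noteq> Y"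
  shows "X \<inter> Y = {}"
proof -
  have *: "\<not> X \<subset> Y" if "X \<in> inputs n F" "Y \<in> inputs n F" "par n F X = par n F Y" for X Y
  proof
    assume XY: "X \<subset> Y"
    have "Y \<in> F" using psubset_input[OF h that(1,2) XY] .
    then have "par n F X \<subseteq> Y" using par(3)[OF h that(1), of Y] XY by blast
    then show False using par(2)[OF h that(2)] that(3) by blast
  qed
  show ?thesis
    using inputs_laminar[OF h, of X Y] *[of X Y] *[of Y X] assms by blast
qed

lemma kids_cover:
  assumes h: "hier n F" and P: "P \<in> insert {1..n} F"
  shows "\<Union>(kids n F P) = P"
proof (intro equalityI subsetI)
  fix i assume i: "i \<in> P"
  \<comment> \<open>A maximal input around \<open>i\<close> properly inside \<open>P\<close> has
    parent \<open>P\<close>; the leaf \<open>{i}\<close> shows that such inputs exist.\<close>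
  let ?S = "{X \<in> inputs n F. i \<in> X \<and> X \<subset> P}"
  have "finite ?S" using hier_finite_inputs[OF h] by simp
  moreover have "{i} \<in> ?S"
    using i hier_vertex(1,5)[OF h P] by (auto simp: inputs_def singles_def)
  ultimately obtain X where X: "X \<in> ?S" and mx: "\<And>Y. Y \<in> ?S \<Longrightarrow> \<not> X \<subset> Y"
    by (metis (no_types, lifting) empty_iff finite_has_maximal psubset_eq)
  have "par n F X = P"
  proof (rule par_eqI[OF P])
    show "X \<subset> P" using X by simp
    fix Y assume Y: "Y \<in> insert {1..n} F" "X \<subset> Y"
    have "P \<in> insert {1..n} (inputs n F)" "Y \<in> insert {1..n} (inputs n F)"
      using P Y(1) by (auto simp: inputs_def)
    then have "P \<subseteq> Y \<or> Y \<subset> P" using inputs_laminar[OF h, of P Y] X Y(2) by blast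
    moreover have False if YP: "Y \<subset> P"
    proof -
      have "Y \<noteq> {1..n}" using YP hier_vertex(1)[OF h P] by blast
      then have "Y \<in> ?S" using Y YP X by (auto simp: inputs_def)
      then show False using mx Y(2) by blast
    qed
    ultimately show "P \<subseteq> Y" by blast
  qed
  then show "i \<in> \<Union>(kids n F P)" using X by (auto simp: kids_def)
next
  fix i assume "i \<in> \<Union>(kids n F P)"
  then obtain X where "X \<in> kids n F P" "i \<in> X" by blast
  then show "i \<in> P" using kids_psubset[OF h, of X P] by blast
qed

text \<open>A single child would have to equal \<open>P\<close>. Together with the output flag this
  gives valence at least \<open>3\<close>.\<close>

lemma card_kids:
  assumes h: "hier n F" and P: "P \<in> insert {1..n} F"
  shows "2 \<le> card (kids n F P)"
proof (rule ccontr)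
  assume "\<not> 2 \<le> card (kids n F P)"
  then have c: "card (kids n F P) \<le> Suc 0" by simp
  have "kids n F P \<noteq> {}" using kids_cover[OF h P] hier_vertex(4)[OF h P] by auto
  then obtain X where X: "X \<in> kids n F P" by blast
  have "kids n F P = {X}"
    using X iffD1[OF card_le_Suc0_iff_eq[OF finite_kids[OF h]] c] by (intro equalityI subsetI) auto
  then have "X = P" using kids_cover[OF h P] by simp
  then show False using kids_psubset[OF h X] by blast
qed

section \<open>The complex of hierarchies with alternating inputs\<close>

text \<open>The distinguished vertex is not recorded: since \<open>A\<close> is nonempty for
  \<open>k \<ge> 2\<close>, it is recovered as the common parent \<open>P\<close>.\<close>

definition cells :: "nat \<Rightarrow> nat \<Rightarrow> (nat set set \<times> nat set set) set" where
  "cells n k = {(F, A). hier n F \<and> A \<subseteq> inputs n F \<and> card A = k \<and> (\<exists>P. \<forall>X\<in>A. par n F X = P)}"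

lemma finite_cells: "finite (cells n k)"
proof (rule finite_subset)
  show "cells n k \<subseteq> Pow (Pow {1..n}) \<times> Pow (Pow {1..n})"
  proof
    fix x assume "x \<in> cells n k"
    then obtain F A where x: "x = (F, A)" "hier n F" "A \<subseteq> inputs n F" by (auto simp: cells_def)
    have "F \<subseteq> Pow {1..n}" using x(2) by (auto simp: hier_def forest_def)
    moreover have "inputs n F \<subseteq> Pow {1..n}" using hier_input(1)[OF x(2)] by blast
    ultimately show "x \<in> Pow (Pow {1..n}) \<times> Pow (Pow {1..n})" using x by blast
  qed
qed simp

lemma cells_finite_alt: "(F, A) \<in> cells n k \<Longrightarrow> finite A"
  using finite_subset hier_finite_inputs by (auto simp: cells_def)

text \<open>If \<open>X\<close> is the common parent of \<open>A\<close>, the parent of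
  \<open>X\<close> takes over; otherwise the common parent is unchanged.\<close>

lemma cells_remove:
  assumes c: "(F, A) \<in> cells n k" and X: "X \<in> F" "X \<notin> A"
  shows "(F - {X}, A) \<in> cells n k"
proof -
  obtain P where h: "hier n F" and A: "A \<subseteq> inputs n F" "card A = k" and P: "\<And>Z. Z \<in> A \<Longrightarrow> par n F Z = P"
    using c by (auto simp: cells_def)
  have "par n (F - {X}) Z = (if P = X then par n F X else P)" if "Z \<in> A" for Z
  proof -
    have "Z \<in> inputs n F" "Z \<noteq> X" using that A X(2) by blast+
    then show ?thesis using par_remove[OF h X(1), of Z] P[OF that] by simp
  qed
  moreover have "A \<subseteq> inputs n (F - {X})" using A X(2) inputs_remove[OF h X(1)] by auto
  ultimately show ?thesis unfolding cells_def using hier_remove[OF h] A by blast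
qed

text \<open>The parent of \<open>b\<close> is \<open>X\<close>, while that of every member of
  \<open>A\<close> is some \<open>P \<noteq> X\<close>, so \<open>b\<close> is new and the number of
  alternating sets stays \<open>k\<close>. After the contraction \<open>b\<close> has moved up to
  \<open>P\<close>.\<close>

lemma cells_replace:
  assumes c: "(F, A) \<in> cells n k" and X: "X \<in> F" "X \<in> A" and b: "b \<in> kids n F X"
  shows "(F - {X}, insert b (A - {X})) \<in> cells n k" "b \<notin> A"
proof -
  obtain P where h: "hier n F" and A: "A \<subseteq> inputs n F" "card A = k" and P: "\<And>Z. Z \<in> A \<Longrightarrow> par n F Z = P"
    using c unfolding cells_def by blast
  have PX: "P \<noteq> X" "par n F X = P" using P[OF X(2)] par(2)[OF h, of X] A X by blast+
  have bp: "par n F b = X" "b \<in> inputs n F" using b by (auto simp: kids_def)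
  then show bA: "b \<notin> A" using P PX by metis
  have bX: "b \<noteq> X" using bA X by blast
  have "par n (F - {X}) Z = P" if "Z \<in> insert b (A - {X})" for Z
    using par_remove[OF h X(1), of Z] that A(1) P PX bX bp by (metis DiffE insertE insertI1 subsetD)
  moreover have "insert b (A - {X}) \<subseteq> inputs n (F - {X})"
    using A bp bX inputs_remove[OF h X(1)] by auto
  moreover have "card (insert b (A - {X})) = k"
    using A(2) bA X(2) cells_finite_alt[OF c] by (metis card_Suc_Diff1 card_insert_disjoint finite_Diff DiffD1)
  ultimately show "(F - {X}, insert b (A - {X})) \<in> cells n k" unfolding cells_def using hier_remove[OF h] by blast
qed

subsection \<open>Ordered hierarchies\<close>

definition repl :: "'a \<Rightarrow> 'a \<Rightarrow> 'a \<Rightarrow> 'a" where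
  "repl a b x = (if x = a then b else x)"

definition delnth :: "nat \<Rightarrow> 'a list \<Rightarrow> 'a list" where
  "delnth i xs = take i xs @ drop (Suc i) xs"

text \<open>The part of \<open>d_e\<close> on the factor \<open>det A\<close>. On lists the
  replacement of \<open>X\<close> by \<open>b\<close> happens at the position of \<open>X\<close>
  and costs no sign; signs appear only when a list is compared with the sorted one by
  \<open>lsgn\<close>.\<close>

definition alt_bdry :: "nat \<Rightarrow> nat set set \<Rightarrow> nat set \<Rightarrow> nat set list \<Rightarrow> (nat set list \<Rightarrow>\<^sub>0 rat)" where
  "alt_bdry n F X as = (if X \<in> set as
     then \<Sum>b\<in>kids n F X. Poly_Mapping.single (map (repl X b) as) 1
     else Poly_Mapping.single as 1)"

definition list_term :: "nat \<Rightarrow> nat set list \<times> nat set list \<Rightarrow> nat \<Rightarrow> (nat set list \<times> nat set list \<Rightarrow>\<^sub>0 rat)" where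
  "list_term n = (\<lambda>(es, as) i. lin (\<lambda>as'. Poly_Mapping.single (delnth i es, as') ((- 1) ^ (length es - Suc i)))
     (alt_bdry n (set es) (es ! i) as))"

definition list_bdry :: "nat \<Rightarrow> nat set list \<times> nat set list \<Rightarrow> (nat set list \<times> nat set list \<Rightarrow>\<^sub>0 rat)" where
  "list_bdry n g = (\<Sum>i<length (fst g). list_term n g i)"

definition list_cells :: "nat \<Rightarrow> nat \<Rightarrow> (nat set list \<times> nat set list) set" where
  "list_cells n k = {(es, as). distinct es \<and> distinct as \<and> (set es, set as) \<in> cells n k}"

lemma length_delnth: "i < length xs \<Longrightarrow> length (delnth i xs) = length xs - 1"
  by (auto simp: delnth_def)

lemma distinct_delnth: "distinct xs \<Longrightarrow> distinct (delnth i xs)"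
  by (simp add: delnth_def set_take_disj_set_drop_if_distinct)

lemma set_delnth: "distinct xs \<Longrightarrow> i < length xs \<Longrightarrow> set (delnth i xs) = set xs - {xs ! i}"
  using id_take_nth_drop[of i xs] unfolding delnth_def
  by (metis (no_types, lifting) Diff_insert_absorb Un_iff Un_insert_right distinct.simps(2) distinct_append disjoint_iff list.set_intros(1) list.simps(15) set_append)

lemma nth_delnth: "i < length xs \<Longrightarrow> j < length xs - 1 \<Longrightarrow> delnth i xs ! j = xs ! (if j < i then j else Suc j)"
  by (auto simp: delnth_def nth_append min_def)

text \<open>The simplicial identity: after deleting position \<open>i\<close>, a later position
  \<open>j\<close> has moved to \<open>j - 1\<close>.\<close>

lemma delnth_delnth:
  assumes "i < j" "j < length xs"
  shows "delnth (j - 1) (delnth i xs) = delnth i (delnth j xs)"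
proof (rule nth_equalityI)
  show "length (delnth (j - 1) (delnth i xs)) = length (delnth i (delnth j xs))"
    using assms by (simp add: length_delnth)
  fix m assume "m < length (delnth (j - 1) (delnth i xs))"
  then have "m < length xs - 2" using assms by (simp add: length_delnth)
  then show "delnth (j - 1) (delnth i xs) ! m = delnth i (delnth j xs) ! m"
    using assms nth_delnth[of "j - 1" "delnth i xs" m] nth_delnth[of i "delnth j xs" m]
      nth_delnth[of i xs "if m < j - 1 then m else Suc m"] nth_delnth[of j xs "if m < i then m else Suc m"]
    by (auto simp: length_delnth split: if_splits)
qed

text \<open>The case with content is \<open>X\<close> alternating and \<open>Y\<close> a child of
  \<open>X\<close> that is not. Contracting \<open>X\<close> first produces one term in which
  \<open>Y\<close> is alternating, and contracting \<open>Y\<close> then spreads it over the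
  children of \<open>Y\<close>; contracting \<open>Y\<close> first makes these children inputs of
  \<open>X\<close>, which gives the same terms.\<close>

lemma alt_bdry_comm:
  assumes c: "(F, set as) \<in> cells n k" and X: "X \<in> F" and Y: "Y \<in> F" and XY: "X \<noteq> Y"
  shows "lin (alt_bdry n (F - {X}) Y) (alt_bdry n F X as) = lin (alt_bdry n (F - {Y}) X) (alt_bdry n F Y as)"
proof -
  have h: "hier n F" using c by (auto simp: cells_def)
  have one: "lin (alt_bdry n (F - {X}) Y) (alt_bdry n F X as) = lin (alt_bdry n (F - {Y}) X) (alt_bdry n F Y as)"
    if X: "X \<in> F" "X \<in> set as" and Y: "Y \<in> F" "Y \<notin> set as" and XY: "X \<noteq> Y" for X Y
  proof -
    let ?m = "\<lambda>b. Poly_Mapping.single (map (repl X b) as) (1::rat)"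
    have L: "lin (alt_bdry n (F - {X}) Y) (alt_bdry n F X as) = (\<Sum>b\<in>kids n F X. alt_bdry n (F - {X}) Y (map (repl X b) as))"
      using X by (simp add: alt_bdry_def[of n F] lin_sum)
    have R: "lin (alt_bdry n (F - {Y}) X) (alt_bdry n F Y as) = (\<Sum>b\<in>kids n (F - {Y}) X. ?m b)"
      using X Y by (simp add: alt_bdry_def)
    have t: "alt_bdry n (F - {X}) Y (map (repl X b) as) = ?m b" if "b \<noteq> Y" for b
      using that Y by (auto simp: alt_bdry_def repl_def)
    show ?thesis
    proof (cases "Y \<in> kids n F X")
      case False
      then have "kids n (F - {Y}) X = kids n F X" using kids_remove[OF h Y(1) XY] by simp
      moreover have "(\<Sum>b\<in>kids n F X. alt_bdry n (F - {X}) Y (map (repl X b) as)) = (\<Sum>b\<in>kids n F X. ?m b)"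
        by (rule sum.cong[OF refl], rule t) (use False in blast)
      ultimately show ?thesis unfolding L R by simp
    next
      case True
      have "X \<notin> kids n F Y" using kids_psubset[OF h] True by blast
      then have kY: "kids n (F - {X}) Y = kids n F Y"
        using kids_remove[OF h X(1), of Y] XY by auto
      have kX: "kids n (F - {Y}) X = (kids n F X - {Y}) \<union> kids n F Y"
        using kids_remove[OF h Y(1) XY] True by simp
      have dis: "(kids n F X - {Y}) \<inter> kids n F Y = {}" using XY by (auto simp: kids_def)
      have "map (repl Y c) (map (repl X Y) as) = map (repl X c) as" for c
        using Y(2) by (auto simp: repl_def)
      moreover have "Y \<in> set (map (repl X Y) as)" using X(2) by (auto simp: repl_def intro!: image_eqI[of _ _ X])
      ultimately have tY: "alt_bdry n (F - {X}) Y (map (repl X Y) as) = (\<Sum>c\<in>kids n F Y. ?m c)"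
        by (simp only: alt_bdry_def if_True kY)
      have "(\<Sum>b\<in>kids n F X. alt_bdry n (F - {X}) Y (map (repl X b) as))
          = alt_bdry n (F - {X}) Y (map (repl X Y) as) + (\<Sum>b\<in>kids n F X - {Y}. alt_bdry n (F - {X}) Y (map (repl X b) as))"
        by (rule sum.remove[OF finite_kids[OF h] True])
      also have "(\<Sum>b\<in>kids n F X - {Y}. alt_bdry n (F - {X}) Y (map (repl X b) as)) = (\<Sum>b\<in>kids n F X - {Y}. ?m b)"
        by (rule sum.cong[OF refl], rule t) blast
      finally show ?thesis unfolding L R kX tY
        using sum.union_disjoint[OF _ _ dis, of ?m] finite_kids[OF h] by (simp add: add.commute)
    qed
  qed
  consider "X \<notin> set as" "Y \<notin> set as" | "X \<in> set as" "Y \<notin> set as" | "X \<notin> set as" "Y \<in> set as"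
    | "X \<in> set as" "Y \<in> set as" by blast
  then show ?thesis
  proof cases
    case 1 then show ?thesis by (simp add: alt_bdry_def)
  next
    case 2 then show ?thesis using one X Y XY by blast
  next
    case 3 then show ?thesis using one[of Y X] X Y XY by simp
  next
    case 4
    \<comment> \<open>Two alternating sets are siblings, so neither is a child of the other and each
      contraction leaves the children of the other set alone; the two sums can be exchanged.\<close>
    have "par n F X = par n F Y" using c 4 by (auto simp: cells_def)
    then have nk: "X \<notin> kids n F Y" "Y \<notin> kids n F X"
      using par(2)[OF h, of X] par(2)[OF h, of Y] X Y by (auto simp: kids_def inputs_def)
    have kk: "kids n (F - {X}) Y = kids n F Y" "kids n (F - {Y}) X = kids n F X"
      using kids_remove[OF h X, of Y] kids_remove[OF h Y, of X] nk XY by auto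
    have L: "lin (alt_bdry n (F - {X}) Y) (alt_bdry n F X as)
        = (\<Sum>b\<in>kids n F X. \<Sum>c\<in>kids n F Y. Poly_Mapping.single (map (repl Y c) (map (repl X b) as)) 1)"
    proof -
      have m: "Y \<in> set (map (repl X b) as)" for b using 4 XY by (auto simp: repl_def intro!: image_eqI[of _ _ Y])
      have "alt_bdry n (F - {X}) Y (map (repl X b) as)
          = (\<Sum>c\<in>kids n F Y. Poly_Mapping.single (map (repl Y c) (map (repl X b) as)) 1)" for b
        using m[of b] by (simp only: alt_bdry_def if_True kk)
      then show ?thesis using 4 by (simp add: alt_bdry_def[of n F] lin_sum)
    qed
    have R: "lin (alt_bdry n (F - {Y}) X) (alt_bdry n F Y as)
        = (\<Sum>c\<in>kids n F Y. \<Sum>b\<in>kids n F X. Poly_Mapping.single (map (repl X b) (map (repl Y c) as)) 1)"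
    proof -
      have m: "X \<in> set (map (repl Y c) as)" for c using 4 XY by (auto simp: repl_def intro!: image_eqI[of _ _ X])
      have "alt_bdry n (F - {Y}) X (map (repl Y c) as)
          = (\<Sum>b\<in>kids n F X. Poly_Mapping.single (map (repl X b) (map (repl Y c) as)) 1)" for c
        using m[of c] by (simp only: alt_bdry_def if_True kk)
      then show ?thesis using 4 by (simp add: alt_bdry_def[of n F] lin_sum)
    qed
    have eq: "map (repl Y c) (map (repl X b) as) = map (repl X b) (map (repl Y c) as)"
      if "b \<in> kids n F X" "c \<in> kids n F Y" for b c
    proof -
      have "b \<noteq> Y" "c \<noteq> X" using that nk by blast+
      then show ?thesis using XY by (auto simp: repl_def)
    qed
    have "(\<Sum>b\<in>kids n F X. \<Sum>c\<in>kids n F Y. Poly_Mapping.single (map (repl Y c) (map (repl X b) as)) (1::rat))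
       = (\<Sum>b\<in>kids n F X. \<Sum>c\<in>kids n F Y. Poly_Mapping.single (map (repl X b) (map (repl Y c) as)) 1)"
      by (intro sum.cong refl) (simp only: eq)
    also have "\<dots> = (\<Sum>c\<in>kids n F Y. \<Sum>b\<in>kids n F X. Poly_Mapping.single (map (repl X b) (map (repl Y c) as)) 1)"
      by (rule sum.swap)
    finally show ?thesis unfolding L R .
  qed
qed

lemma keys_alt_bdry:
  assumes c: "(F, set as) \<in> cells n k" "distinct as" and X: "X \<in> F" and k: "as' \<in> Poly_Mapping.keys (alt_bdry n F X as)"
  shows "(F - {X}, set as') \<in> cells n k \<and> distinct as'"
proof (cases "X \<in> set as")
  case False
  then have "as' = as" using k by (simp add: alt_bdry_def)
  then show ?thesis using cells_remove[OF c(1) X False] c(2) by simp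
next
  case True
  have "Poly_Mapping.keys (alt_bdry n F X as) \<subseteq> (\<lambda>b. map (repl X b) as) ` kids n F X"
    unfolding alt_bdry_def using True by (simp, intro keys_sum_subset) auto
  then obtain b where b: "b \<in> kids n F X" "as' = map (repl X b) as" using k by blast
  note r = cells_replace[OF c(1) X True b(1)]
  have "set as' = insert b (set as - {X})" using True b(2) by (auto simp: repl_def)
  moreover have "inj_on (repl X b) (set as)" using r(2) by (auto simp: inj_on_def repl_def)
  ultimately show ?thesis using r(1) c(2) b(2) by (simp add: distinct_map)
qed

lemma keys_list_term:
  assumes g: "(es, as) \<in> list_cells n k" and i: "i < length es"
  shows "Poly_Mapping.keys (list_term n (es, as) i) \<subseteq> {(es', as') \<in> list_cells n k. length es' = length es - 1}"
proof
  fix g' assume "g' \<in> Poly_Mapping.keys (list_term n (es, as) i)"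
  then obtain as' where as': "as' \<in> Poly_Mapping.keys (alt_bdry n (set es) (es ! i) as)" "g' = (delnth i es, as')"
    using keys_lin[of "\<lambda>as'. Poly_Mapping.single (delnth i es, as') ((- 1) ^ (length es - Suc i))" "alt_bdry n (set es) (es ! i) as"]
    by (auto simp: list_term_def split: if_splits)
  have d: "distinct es" "distinct as" "(set es, set as) \<in> cells n k" using g by (auto simp: list_cells_def)
  have "(set es - {es ! i}, set as') \<in> cells n k \<and> distinct as'"
    by (rule keys_alt_bdry[OF d(3,2) _ as'(1)]) (use i in simp)
  then show "g' \<in> {(es', as') \<in> list_cells n k. length es' = length es - 1}"
    using as' d i by (simp add: list_cells_def distinct_delnth set_delnth length_delnth)
qed

lemma keys_list_bdry:
  assumes "(es, as) \<in> list_cells n k"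
  shows "Poly_Mapping.keys (list_bdry n (es, as)) \<subseteq> {(es', as') \<in> list_cells n k. Suc (length es') = length es}"
proof (cases "es = []")
  case False
  then have "{(es', as') \<in> list_cells n k. length es' = length es - 1} = {(es', as') \<in> list_cells n k. Suc (length es') = length es}"
    by (cases es) auto
  then show ?thesis unfolding list_bdry_def using keys_list_term[OF assms]
    by (intro keys_sum_subset) auto
qed (simp add: list_bdry_def)

lemma sum_skip:
  fixes f :: "nat \<Rightarrow> 'a::comm_monoid_add"
  assumes "i < L"
  shows "(\<Sum>j<L - 1. f (if j < i then j else Suc j)) = (\<Sum>j\<in>{..<L} - {i}. f j)"
proof (rule sum.reindex_bij_betw)
  show "bij_betw (\<lambda>j. if j < i then j else Suc j) {..<L - 1} ({..<L} - {i})"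
    by (rule bij_betwI[where g = "\<lambda>j. if j < i then j else j - 1"]) (use assms in \<open>auto split: if_splits\<close>)
qed

lemma eq_uminus_zero:
  fixes c :: "'a \<Rightarrow>\<^sub>0 rat"
  assumes "c = - c"
  shows "c = 0"
proof (rule poly_mapping_eqI)
  fix x
  have "Poly_Mapping.lookup c x = Poly_Mapping.lookup (- c) x" using assms by simp
  then show "Poly_Mapping.lookup c x = Poly_Mapping.lookup 0 x" by simp
qed

text \<open>The composite is a sum over ordered pairs of positions. Exchanging the two keeps the
  underlying term, by \<open>alt_bdry_comm\<close>, and flips the sign, so the sum equals its own
  negative.\<close>

lemma list_bdry_square:
  assumes g: "(es, as) \<in> list_cells n k"
  shows "lin (list_bdry n) (list_bdry n (es, as)) = 0"
proof -
  let ?L = "length es" and ?F = "set es"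
  have d: "distinct es" "distinct as" "(?F, set as) \<in> cells n k" using g by (auto simp: list_cells_def)
  define s :: "nat \<Rightarrow> rat" where "s i = (- 1) ^ (?L - Suc i)" for i
  define V where "V i j = lin (alt_bdry n (?F - {es ! i}) (es ! j)) (alt_bdry n ?F (es ! i) as)" for i j
  define del2 where "del2 i j = (if i < j then delnth i (delnth j es) else delnth j (delnth i es))" for i j
  \<comment> \<open>The sign counts the positions after the deleted one. Deleting \<open>i\<close>
    first does not change this count for \<open>j > i\<close> and lowers it by one for
    \<open>j < i\<close>, which is the extra minus sign.\<close>
  define W where "W i j = chain_scale (if i < j then s i * s j else - (s i * s j))
      (lin (\<lambda>as'. Poly_Mapping.single (del2 i j, as') 1) (V i j))" for i j
  have inner: "lin (list_bdry n) (list_term n (es, as) i) = (\<Sum>j\<in>{..<?L} - {i}. W i j)" if i: "i < ?L" for i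
  proof -
    have ld: "length (delnth i es) = ?L - 1" using i by (simp add: length_delnth)
    have "lin (list_bdry n) (list_term n (es, as) i)
        = lin (\<lambda>as'. chain_scale (s i) (list_bdry n (delnth i es, as'))) (alt_bdry n ?F (es ! i) as)"
      by (simp add: list_term_def lin_lin s_def)
    also have "\<dots> = (\<Sum>j<?L - 1. lin (\<lambda>as'. chain_scale (s i) (list_term n (delnth i es, as') j)) (alt_bdry n ?F (es ! i) as))"
      by (simp add: list_bdry_def ld chain.scale_sum_right lin_def sum.swap[of _ "Poly_Mapping.keys _"])
    also have "\<dots> = (\<Sum>j<?L - 1. W i (if j < i then j else Suc j))"
    proof (rule sum.cong[OF refl])
      fix j assume j: "j \<in> {..<?L - 1}"
      let ?j = "if j < i then j else Suc j"
      have e: "delnth i es ! j = es ! ?j" using nth_delnth[OF i, of j] j by simp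
      have dd: "delnth j (delnth i es) = del2 i ?j"
        unfolding del2_def using delnth_delnth[of i "Suc j" es] j i by auto
      have sg: "s i * (- 1) ^ (?L - 1 - Suc j) = (if i < ?j then s i * s ?j else - (s i * s ?j))"
      proof (cases "j < i")
        case True
        then have "?L - Suc j = Suc (?L - 1 - Suc j)" using i by simp
        then have "s j = - ((- 1) ^ (?L - 1 - Suc j))" unfolding s_def by simp
        then show ?thesis using True by simp
      next
        case False
        then show ?thesis by (simp add: s_def)
      qed
      have "lin (\<lambda>as'. chain_scale (s i) (list_term n (delnth i es, as') j)) (alt_bdry n ?F (es ! i) as)
          = lin (\<lambda>as'. lin (\<lambda>as''. chain_scale (s i * (- 1) ^ (?L - 1 - Suc j)) (Poly_Mapping.single (del2 i ?j, as'') 1))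
              (alt_bdry n (?F - {es ! i}) (es ! ?j) as')) (alt_bdry n ?F (es ! i) as)"
        by (simp add: list_term_def lin_scale[symmetric] dd e ld set_delnth[OF d(1) i] lin_def chain.scale_sum_right mult.left_commute)
      also have "\<dots> = lin (\<lambda>as''. chain_scale (s i * (- 1) ^ (?L - 1 - Suc j)) (Poly_Mapping.single (del2 i ?j, as'') 1)) (V i ?j)"
        unfolding V_def lin_lin ..
      also have "\<dots> = W i ?j"
        unfolding W_def sg by (simp add: lin_def chain.scale_sum_right mult.commute)
      finally show "lin (\<lambda>as'. chain_scale (s i) (list_term n (delnth i es, as') j)) (alt_bdry n ?F (es ! i) as) = W i ?j" .
    qed
    also have "\<dots> = (\<Sum>j\<in>{..<?L} - {i}. W i j)" by (rule sum_skip[OF i])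
    finally show ?thesis .
  qed
  have anti: "W i j = - W j i" if "i < ?L" "j < ?L" "i \<noteq> j" for i j
  proof -
    have "es ! i \<noteq> es ! j" using that d(1) by (simp add: nth_eq_iff_index_eq)
    then have "V i j = V j i" unfolding V_def by (intro alt_bdry_comm[OF d(3)]) (use that in auto)
    moreover have "del2 i j = del2 j i" using that by (auto simp: del2_def)
    ultimately show ?thesis using that(3) unfolding W_def
      by (cases "i < j") (auto simp: mult.commute chain.scale_minus_left)
  qed
  define T where "T i j = (if i = j then 0 else W i j)" for i j
  let ?S = "\<Sum>i<?L. \<Sum>j<?L. T i j"
  have "lin (list_bdry n) (list_bdry n (es, as)) = (\<Sum>i<?L. \<Sum>j\<in>{..<?L} - {i}. W i j)"
    by (simp add: list_bdry_def[of n "(es, as)"] lin_sum inner)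
  also have "\<dots> = ?S"
  proof (rule sum.cong[OF refl])
    fix i
    show "(\<Sum>j\<in>{..<?L} - {i}. W i j) = (\<Sum>j<?L. T i j)"
      by (rule sum.mono_neutral_cong_left) (auto simp: T_def)
  qed
  finally have S: "lin (list_bdry n) (list_bdry n (es, as)) = ?S" .
  have "?S = (\<Sum>i<?L. \<Sum>j<?L. - T j i)"
  proof (intro sum.cong refl)
    fix i j assume "i \<in> {..<?L}" "j \<in> {..<?L}"
    then show "T i j = - T j i" using anti[of i j] by (simp add: T_def)
  qed
  also have "\<dots> = - (\<Sum>i<?L. \<Sum>j<?L. T j i)" by (simp add: sum_negf)
  also have "(\<Sum>i<?L. \<Sum>j<?L. T j i) = ?S" by (rule sum.swap)
  finally have "?S = - ?S" .
  then have "?S = 0" by (rule eq_uminus_zero)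
  then show ?thesis using S by simp
qed

subsection \<open>Signs of orderings\<close>

text \<open>\<open>(-1)\<close> to the number of inversions, with respect to the linear order that \<open>set_encode\<close>
  induces on the finite sets of natural numbers.\<close>

fun lsgn :: "nat set list \<Rightarrow> rat" where
  "lsgn [] = 1"
| "lsgn (x # xs) = (- 1) ^ card {y \<in> set xs. set_encode y < set_encode x} * lsgn xs"

lemma lsgn_square [simp]: "lsgn xs * lsgn xs = 1"
proof (induction xs)
  case (Cons x xs)
  have "lsgn (x # xs) * lsgn (x # xs) = ((- 1) ^ card {y \<in> set xs. set_encode y < set_encode x} * (- 1) ^ card {y \<in> set xs. set_encode y < set_encode x}) * (lsgn xs * lsgn xs)"
    by (simp only: lsgn.simps mult_ac)
  then show ?case using Cons by (simp flip: power_mult_distrib)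
qed simp

definition above :: "nat set \<Rightarrow> nat set set \<Rightarrow> nat" where
  "above e S = card {y \<in> S. set_encode e < set_encode y}"

lemma above_insert:
  "finite S \<Longrightarrow> x \<notin> S \<Longrightarrow> above e (insert x S) = (if set_encode e < set_encode x then 1 else 0) + above e S"
proof -
  assume S: "finite S" "x \<notin> S"
  have "{y \<in> insert x S. set_encode e < set_encode y}
      = (if set_encode e < set_encode x then insert x {y \<in> S. set_encode e < set_encode y} else {y \<in> S. set_encode e < set_encode y})"
    by auto
  then show ?thesis using S by (simp add: above_def)
qed

lemma below_insert:
  assumes "finite S" "x \<notin> S"
  shows "card {y \<in> insert x S. set_encode y < set_encode e} = (if set_encode x < set_encode e then 1 else 0) + card {y \<in> S. set_encode y < set_encode e}"
proof -
  have "{y \<in> insert x S. set_encode y < set_encode e}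
      = (if set_encode x < set_encode e then insert x {y \<in> S. set_encode y < set_encode e} else {y \<in> S. set_encode y < set_encode e})"
    by auto
  then show ?thesis using assms by simp
qed

text \<open>The inversions involving \<open>e\<close> are the larger entries of \<open>xs\<close>
  and the smaller entries of \<open>ys\<close>; modulo two the latter number is
  \<open>length ys\<close> plus the number of larger entries of \<open>ys\<close>. Finiteness of the
  entries enters because \<open>set_encode\<close> separates only finite sets.\<close>

lemma lsgn_insert:
  assumes "distinct (xs @ e # ys)" "\<forall>x\<in>set (xs @ e # ys). finite x"
  shows "lsgn (xs @ e # ys) = lsgn (xs @ ys) * (- 1) ^ (length ys + above e (set (xs @ ys)))"
  using assms
proof (induction xs)
  case Nil
  have "card (set ys) = card {y \<in> set ys. set_encode y < set_encode e} + above e (set ys)"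
    unfolding above_def
  proof (subst card_Un_disjoint[symmetric])
    have "set_encode y \<noteq> set_encode e" if "y \<in> set ys" for y
      using set_encode_eq[of y e] that Nil by auto
    then show "card (set ys) = card ({y \<in> set ys. set_encode y < set_encode e} \<union> {y \<in> set ys. set_encode e < set_encode y})"
      by (intro arg_cong[of _ _ card]) (auto simp: neq_iff)
  qed auto
  then have "length ys = card {y \<in> set ys. set_encode y < set_encode e} + above e (set ys)"
    using Nil by (simp add: distinct_card)
  then show ?case by (simp add: power_add mult.commute flip: power_mult_distrib)
next
  case (Cons x xs)
  let ?S = "set (xs @ ys)"
  have S: "finite ?S" "x \<notin> ?S" "e \<notin> ?S" using Cons.prems by auto
  have IH: "lsgn (xs @ e # ys) = lsgn (xs @ ys) * (- 1) ^ (length ys + above e ?S)"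
    using Cons by simp
  have "set (xs @ e # ys) = insert e ?S" by auto
  moreover have "set ((x # xs) @ ys) = insert x ?S" by auto
  ultimately show ?case
    using above_insert[OF S(1,2), of e] below_insert[OF S(1,3), of x] IH
    by (simp add: power_add mult_ac del: set_append)
qed

text \<open>Extracting \<open>a\<close> and then \<open>b\<close> reduces both lists to
  \<open>us @ vs @ ws\<close>; the exponents agree except for the comparison of \<open>a\<close>
  with \<open>b\<close>, which contributes to exactly one of them.\<close>

lemma lsgn_swap:
  assumes "distinct (us @ a # vs @ b # ws)" "\<forall>x\<in>set (us @ a # vs @ b # ws). finite x"
  shows "lsgn (us @ b # vs @ a # ws) = - lsgn (us @ a # vs @ b # ws)"
proof -
  let ?R = "set (us @ vs @ ws)"
  have *: "lsgn (us @ a # vs @ b # ws) = lsgn (us @ vs @ ws) * (- 1) ^ (length ws + above b ?R)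
      * (- 1) ^ (Suc (length vs + length ws) + (if set_encode a < set_encode b then 1 else 0) + above a ?R)"
    if d: "distinct (us @ a # vs @ b # ws)" "\<forall>x\<in>set (us @ a # vs @ b # ws). finite x" for a b
  proof -
    have 1: "lsgn (us @ a # vs @ b # ws) = lsgn (us @ vs @ b # ws) * (- 1) ^ (length (vs @ b # ws) + above a (set (us @ vs @ b # ws)))"
      by (rule lsgn_insert) (use d in auto)
    have 2: "lsgn ((us @ vs) @ b # ws) = lsgn ((us @ vs) @ ws) * (- 1) ^ (length ws + above b (set ((us @ vs) @ ws)))"
      by (rule lsgn_insert) (use d in auto)
    have "set (us @ vs @ b # ws) = insert b ?R" by auto
    moreover have "above a (insert b ?R) = (if set_encode a < set_encode b then 1 else 0) + above a ?R"
      by (rule above_insert) (use d in auto)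
    ultimately show ?thesis using 1 2 by (simp add: add_ac del: set_append)
  qed
  have "set_encode a \<noteq> set_encode b" using set_encode_eq[of a b] assms by auto
  moreover have "distinct (us @ b # vs @ a # ws)" "\<forall>x\<in>set (us @ b # vs @ a # ws). finite x" using assms by auto
  ultimately show ?thesis using *[of a b] *[of b a] assms
    by (cases "set_encode a < set_encode b") (simp_all add: power_add mult_ac)
qed

lemma permute_list_transpose:
  "permute_list (transpose (length us) (Suc (length us + length vs))) (us @ a # vs @ b # ws) = us @ b # vs @ a # ws"
  (is "permute_list ?p ?xs = ?ys")
proof (rule nth_equalityI)
  have p: "?p permutes {..<length ?xs}" by (rule permutes_swap_id) auto
  fix i assume "i < length (permute_list ?p ?xs)"
  then have i: "i < length ?xs" by simp
  consider "i < length us" | "i = length us" | "length us < i" "i < Suc (length us + length vs)"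
    | "i = Suc (length us + length vs)" | "Suc (length us + length vs) < i" by linarith
  then have "?xs ! ?p i = ?ys ! i"
  proof cases
    case 3
    then have "?p i = i" by (simp add: transpose_def)
    moreover obtain j where "i = Suc (length us + j)" "j < length vs" using 3 less_iff_Suc_add by auto
    ultimately show ?thesis by (simp add: nth_append)
  next
    case 5
    then have "?p i = i" by (simp add: transpose_def)
    moreover obtain j where "i = Suc (Suc (length us + length vs + j))" using 5 less_iff_Suc_add by auto
    ultimately show ?thesis by (simp add: nth_append)
  qed (simp_all add: nth_append transpose_def)
  then show "permute_list ?p ?xs ! i = ?ys ! i" unfolding permute_list_nth[OF p i] .
qed simp

lemma lsgn_transpose:
  assumes "distinct xs" "\<forall>x\<in>set xs. finite x" "i < length xs" "j < length xs" "i \<noteq> j"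
  shows "lsgn (permute_list (transpose i j) xs) = - lsgn xs"
proof -
  have *: "lsgn (permute_list (transpose i j) xs) = - lsgn xs" if ij: "i < j" "j < length xs" for i j
  proof -
    define vs where "vs = take (j - Suc i) (drop (Suc i) xs)"
    have "drop (Suc i) xs = vs @ drop (j - Suc i) (drop (Suc i) xs)" by (simp only: vs_def append_take_drop_id)
    also have "drop (j - Suc i) (drop (Suc i) xs) = drop j xs" using ij by simp
    also have "drop j xs = xs ! j # drop (Suc j) xs" using ij by (simp add: Cons_nth_drop_Suc)
    finally have xs: "xs = take i xs @ xs ! i # vs @ xs ! j # drop (Suc j) xs"
      using id_take_nth_drop[of i xs] ij by simp
    have l: "length (take i xs) = i" "Suc (length (take i xs) + length vs) = j" using ij by (auto simp: vs_def)
    show ?thesis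
      using permute_list_transpose[of "take i xs" vs "xs ! i" "xs ! j" "drop (Suc j) xs"]
        lsgn_swap[of "take i xs" "xs ! i" vs "xs ! j" "drop (Suc j) xs"] assms(1,2) l
      unfolding xs[symmetric] by simp
  qed
  show ?thesis
    using *[of i j] *[of j i] assms by (cases "i < j") (auto simp: transpose_commute)
qed

text \<open>Makes \<open>orient\<close> compatible with the antisymmetry relations. Writing the
  permutation as a product of transpositions reduces it to \<open>lsgn_transpose\<close>.\<close>

lemma lsgn_permute:
  assumes "p permutes {..<length xs}" "distinct xs" "\<forall>x\<in>set xs. finite x"
  shows "lsgn (permute_list p xs) = of_int (sign p) * lsgn xs"
proof -
  have "\<forall>xs. length xs = m \<longrightarrow> distinct xs \<longrightarrow> (\<forall>x\<in>set xs. finite x) \<longrightarrow>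
      lsgn (permute_list p xs) = of_int (sign p) * lsgn xs"
    if "p permutes {..<m}" "finite {..<m}" for m :: nat and p
    using that
  proof (induction rule: permutes_induct)
    case id
    then show ?case by simp
  next
    case (swap a b p)
    show ?case
    proof (intro allI impI)
      fix xs :: "nat set list" assume xs: "length xs = m" "distinct xs" "\<forall>x\<in>set xs. finite x"
      have t: "transpose a b permutes {..<length xs}" using swap xs by (intro permutes_swap_id) auto
      have p: "p permutes {..<length xs}" using swap xs by simp
      have "permutation p" using swap permutation_permutes by blast
      then have "sign (transpose a b \<circ> p) = - sign p"
        using swap by (simp add: sign_compose permutation_swap_id sign_swap_id)
      moreover have "lsgn (permute_list (transpose a b \<circ> p) xs) = lsgn (permute_list p (permute_list (transpose a b) xs))"
        by (subst permute_list_compose) (use t p in auto)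
      moreover have "lsgn (permute_list p (permute_list (transpose a b) xs)) = of_int (sign p) * lsgn (permute_list (transpose a b) xs)"
        using swap.IH xs t by simp
      ultimately show "lsgn (permute_list (transpose a b \<circ> p) xs) = of_int (sign (transpose a b \<circ> p)) * lsgn xs"
        using lsgn_transpose[OF xs(2,3), of a b] swap xs by simp
    qed
  qed
  then show ?thesis using assms by blast
qed

subsection \<open>The complex of cells\<close>

text \<open>Any ordering serves: the product of the signs of a list and of the list with
  \<open>X\<close> replaced by \<open>b\<close> is invariant under permuting both in the same way,
  so \<open>cell_term\<close> does not depend on this choice.\<close>

definition ref_list :: "'a set \<Rightarrow> 'a list" where
  "ref_list A = (SOME as. distinct as \<and> set as = A)"

lemma ref_list: "finite A \<Longrightarrow> distinct (ref_list A) \<and> set (ref_list A) = A"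
  unfolding ref_list_def by (rule someI_ex) (metis finite_distinct_list)

text \<open>The basis vector of a cell stands for the wedge products taken in increasing
  \<open>set_encode\<close> order; any other ordering is this vector up to sign.\<close>

definition orient :: "nat set list \<times> nat set list \<Rightarrow> (nat set set \<times> nat set set \<Rightarrow>\<^sub>0 rat)" where
  "orient = (\<lambda>(es, as). Poly_Mapping.single (set es, set as) (lsgn es * lsgn as))"

definition cell_term :: "nat \<Rightarrow> nat set set \<Rightarrow> nat set set \<Rightarrow> nat set \<Rightarrow> (nat set set \<times> nat set set \<Rightarrow>\<^sub>0 rat)" where
  "cell_term n F A X = chain_scale ((- 1) ^ above X (F - {X}))
     (if X \<in> A
      then \<Sum>b\<in>kids n F X. Poly_Mapping.single (F - {X}, insert b (A - {X}))
        (lsgn (ref_list A) * lsgn (map (repl X b) (ref_list A)))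
      else Poly_Mapping.single (F - {X}, A) 1)"

definition cell_bdry :: "nat \<Rightarrow> nat set set \<times> nat set set \<Rightarrow> (nat set set \<times> nat set set \<Rightarrow>\<^sub>0 rat)" where
  "cell_bdry n = (\<lambda>(F, A). \<Sum>X\<in>F. cell_term n F A X)"

lemma cells_finite_sets:
  assumes "(F, A) \<in> cells n k"
  shows "finite F" "finite A" "\<forall>X\<in>F. finite X" "\<forall>X\<in>A. finite X" "hier n F" "A \<subseteq> inputs n F"
  using assms hier_finite hier_vertex(3) hier_input(2) cells_finite_alt[OF assms]
  by (auto simp: cells_def)

text \<open>By \<open>lsgn_insert\<close> the sign of deleting position \<open>i\<close> times the
  sign of the shorter list is the sign of \<open>es\<close> times a sign depending only on the
  deleted set and the family, so the position drops out.\<close>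

lemma list_term_orient:
  assumes g: "(es, as) \<in> list_cells n k" and i: "i < length es"
  shows "lin orient (list_term n (es, as) i) = chain_scale (lsgn es * lsgn as) (cell_term n (set es) (set as) (es ! i))"
proof -
  let ?F = "set es" and ?A = "set as" and ?X = "es ! i"
  have d: "distinct es" "distinct as" and c: "(?F, ?A) \<in> cells n k" using g by (auto simp: list_cells_def)
  note f = cells_finite_sets[OF c]
  have es: "es = take i es @ ?X # drop (Suc i) es" using id_take_nth_drop[OF i] .
  have XF: "?X \<in> ?F" using i by simp
  have "lsgn (take i es @ ?X # drop (Suc i) es) = lsgn (take i es @ drop (Suc i) es)
      * (- 1) ^ (length (drop (Suc i) es) + above ?X (set (take i es @ drop (Suc i) es)))"
    by (rule lsgn_insert) (use d f es in metis)+
  then have s: "lsgn es = lsgn (delnth i es) * (- 1) ^ (length es - Suc i + above ?X (?F - {?X}))"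
    unfolding es[symmetric] set_delnth[OF d(1) i, unfolded delnth_def] by (simp add: delnth_def)
  have sg: "(- 1) ^ (length es - Suc i) * lsgn (delnth i es) = lsgn es * (- 1) ^ above ?X (?F - {?X})"
    unfolding s by (simp add: power_add mult_ac flip: power_mult_distrib)
  have o: "chain_scale ((- 1) ^ (length es - Suc i)) (orient (delnth i es, as'))
      = Poly_Mapping.single (?F - {?X}, set as') (lsgn es * (- 1) ^ above ?X (?F - {?X}) * lsgn as')" for as'
    by (simp add: orient_def set_delnth[OF d(1) i] mult.assoc[symmetric] sg)
  show ?thesis
  proof (cases "?X \<in> ?A")
    case False
    then show ?thesis
      by (simp add: list_term_def alt_bdry_def cell_term_def o mult_ac)
  next
    case True
    have r: "set (map (repl ?X b) as) = insert b (?A - {?X})" for b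
      using True by (auto simp: repl_def)
    \<comment> \<open>The permutation taking the reference ordering to \<open>as\<close> acts in the
      same way after the replacement, so its sign cancels from the product.\<close>
    have sq: "lsgn (map (repl ?X b) as) = lsgn as * (lsgn (ref_list ?A) * lsgn (map (repl ?X b) (ref_list ?A)))"
      if b: "b \<in> kids n ?F ?X" for b
    proof -
      note R = ref_list[OF f(2)]
      have "mset as = mset (ref_list ?A)" using R d set_eq_iff_mset_eq_distinct by metis
      then obtain p where p: "p permutes {..<length (ref_list ?A)}" "permute_list p (ref_list ?A) = as"
        by (rule mset_eq_permutation)
      have bi: "b \<in> inputs n ?F" using b by (simp add: kids_def)
      have bn: "b \<notin> ?A" using cells_replace(2)[OF c XF True b] .
      have dr: "distinct (map (repl ?X b) (ref_list ?A))"
        using R bn by (auto simp: distinct_map inj_on_def repl_def)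
      have fr: "\<forall>x\<in>set (map (repl ?X b) (ref_list ?A)). finite x"
        using R f(4) hier_input(2)[OF f(5) bi] by (auto simp: repl_def)
      have 1: "lsgn as = of_int (sign p) * lsgn (ref_list ?A)"
        using lsgn_permute[OF p(1)] R f(4) p(2) by simp
      have "lsgn (permute_list p (map (repl ?X b) (ref_list ?A))) = of_int (sign p) * lsgn (map (repl ?X b) (ref_list ?A))"
        by (rule lsgn_permute) (use p dr fr in auto)
      then have 2: "lsgn (map (repl ?X b) as) = of_int (sign p) * lsgn (map (repl ?X b) (ref_list ?A))"
        using p by (simp add: permute_list_map)
      have "lsgn (map (repl ?X b) as) = (of_int (sign p) * lsgn (map (repl ?X b) (ref_list ?A))) * (lsgn (ref_list ?A) * lsgn (ref_list ?A))"
        using 2 by simp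
      then show ?thesis using 1 by (simp only: mult_ac)
    qed
    have "lin orient (list_term n (es, as) i) = (\<Sum>b\<in>kids n ?F ?X. Poly_Mapping.single (?F - {?X}, insert b (?A - {?X}))
        (lsgn es * (- 1) ^ above ?X (?F - {?X}) * lsgn (map (repl ?X b) as)))"
      using True by (simp add: list_term_def alt_bdry_def lin_sum o r del: set_map)
    also have "\<dots> = chain_scale (lsgn es * lsgn as) (cell_term n ?F ?A ?X)"
      using True sq by (simp add: cell_term_def chain.scale_sum_right mult_ac cong: sum.cong)
    finally show ?thesis .
  qed
qed

lemma list_bdry_orient:
  assumes g: "(es, as) \<in> list_cells n k"
  shows "lin orient (list_bdry n (es, as)) = lin (cell_bdry n) (orient (es, as))"
proof -
  have "distinct es" using g by (auto simp: list_cells_def)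
  then have b: "bij_betw ((!) es) {..<length es} (set es)" by (rule bij_betw_nth) auto
  have "lin orient (list_bdry n (es, as)) = (\<Sum>i<length es. chain_scale (lsgn es * lsgn as) (cell_term n (set es) (set as) (es ! i)))"
    using list_term_orient[OF g] by (simp add: list_bdry_def lin_sum)
  also have "\<dots> = chain_scale (lsgn es * lsgn as) (\<Sum>i<length es. cell_term n (set es) (set as) (es ! i))"
    by (simp add: chain.scale_sum_right)
  also have "(\<Sum>i<length es. cell_term n (set es) (set as) (es ! i)) = cell_bdry n (set es, set as)"
    unfolding cell_bdry_def using sum.reindex_bij_betw[OF b, of "cell_term n (set es) (set as)"] by simp
  finally show ?thesis by (simp add: orient_def)
qed

lemma lsgn_nonzero [simp]: "lsgn xs \<noteq> 0"
  using lsgn_square[of xs] by (metis mult_zero_left zero_neq_one)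

text \<open>Any ordering of the cell lifts it to lists along \<open>orient\<close>, where the square
  vanishes; the factor \<open>lsgn es * lsgn as\<close> is nonzero and can be divided out.\<close>

lemma cell_bdry_square:
  assumes c: "(F, A) \<in> cells n k"
  shows "lin (cell_bdry n) (cell_bdry n (F, A)) = 0"
proof -
  note f = cells_finite_sets[OF c]
  obtain es as where l: "distinct es" "set es = F" "distinct as" "set as = A"
    using finite_distinct_list f(1,2) by metis
  then have g: "(es, as) \<in> list_cells n k" using c by (simp add: list_cells_def)
  have "lin (cell_bdry n) (lin (cell_bdry n) (orient (es, as))) = lin (cell_bdry n) (lin orient (list_bdry n (es, as)))"
    by (simp only: list_bdry_orient[OF g])
  also have "\<dots> = lin (\<lambda>g'. lin (cell_bdry n) (orient g')) (list_bdry n (es, as))"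
    by (simp only: lin_lin)
  also have "\<dots> = lin (\<lambda>g'. lin orient (list_bdry n g')) (list_bdry n (es, as))"
  proof (rule lin_cong)
    fix g' assume "g' \<in> Poly_Mapping.keys (list_bdry n (es, as))"
    then have "g' \<in> list_cells n k" using keys_list_bdry[OF g] by auto
    then show "lin (cell_bdry n) (orient g') = lin orient (list_bdry n g')"
      using list_bdry_orient[of "fst g'" "snd g'" n k] by simp
  qed
  also have "\<dots> = lin orient (lin (list_bdry n) (list_bdry n (es, as)))" by (simp only: lin_lin)
  also have "\<dots> = 0" by (simp add: list_bdry_square[OF g])
  finally have "chain_scale (lsgn es * lsgn as) (lin (cell_bdry n) (cell_bdry n (F, A))) = 0"
    using l by (simp add: orient_def lin_scale)
  then show ?thesis by simp
qed

text \<open>A sign-free bound on the support of the boundary. That a coefficient is nonzero is shown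
  only for \<open>X \<notin> A\<close>, which covers all matched pairs.\<close>

definition cell_step :: "nat \<Rightarrow> nat set set \<times> nat set set \<Rightarrow> nat set set \<times> nat set set \<Rightarrow> bool" where
  "cell_step n = (\<lambda>(F, A) (F', A'). \<exists>X\<in>F. F' = F - {X} \<and>
     (if X \<in> A then \<exists>b\<in>kids n F X. A' = insert b (A - {X}) else A' = A))"

lemma keys_cell_term:
  "y \<in> Poly_Mapping.keys (cell_term n F A X) \<Longrightarrow> fst y = F - {X} \<and>
     (if X \<in> A then \<exists>b\<in>kids n F X. snd y = insert b (A - {X}) else snd y = A)"
proof -
  assume y: "y \<in> Poly_Mapping.keys (cell_term n F A X)"
  show ?thesis
  proof (cases "X \<in> A")
    case True
    have "Poly_Mapping.keys (cell_term n F A X) \<subseteq> (\<lambda>b. (F - {X}, insert b (A - {X}))) ` kids n F X"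
      unfolding cell_term_def using True
      by (simp, intro order_trans[OF keys_chain_scale] keys_sum_subset) auto
    then obtain b where "b \<in> kids n F X" "y = (F - {X}, insert b (A - {X}))" using y by blast
    then show ?thesis using True by auto
  next
    case False
    then show ?thesis using y by (auto simp: cell_term_def split: if_splits)
  qed
qed

lemma cell_step_if_lookup:
  assumes "Poly_Mapping.lookup (cell_bdry n x) y \<noteq> 0"
  shows "cell_step n x y"
proof -
  obtain F A F' A' where xy: "x = (F, A)" "y = (F', A')" by (cases x, cases y)
  have "(\<Sum>X\<in>F. Poly_Mapping.lookup (cell_term n F A X) y) \<noteq> 0"
    using assms xy by (simp add: cell_bdry_def lookup_sum)
  then obtain X where X: "X \<in> F" "Poly_Mapping.lookup (cell_term n F A X) y \<noteq> 0"
    by (meson sum.not_neutral_contains_not_neutral)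
  then have "y \<in> Poly_Mapping.keys (cell_term n F A X)" by (simp add: in_keys_iff)
  from keys_cell_term[OF this] show ?thesis
    unfolding cell_step_def xy prod.case by (intro bexI[OF _ X(1)]) (auto simp: xy split: if_splits)
qed

text \<open>The set \<open>F - {X}\<close> determines \<open>X\<close>, so no other edge contributes
  and nothing can cancel.\<close>

lemma lookup_cell_bdry_remove:
  assumes "finite F" "X \<in> F" "X \<notin> A"
  shows "Poly_Mapping.lookup (cell_bdry n (F, A)) (F - {X}, A) \<noteq> 0"
proof -
  have z: "Poly_Mapping.lookup (cell_term n F A X') (F - {X}, A) = 0" if "X' \<in> F - {X}" for X'
  proof (rule ccontr)
    assume "Poly_Mapping.lookup (cell_term n F A X') (F - {X}, A) \<noteq> 0"
    then have "(F - {X}, A) \<in> Poly_Mapping.keys (cell_term n F A X')" by (simp add: in_keys_iff)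
    from keys_cell_term[OF this] have "F - {X} = F - {X'}" by simp
    then show False using that assms(2) by blast
  qed
  have "Poly_Mapping.lookup (cell_bdry n (F, A)) (F - {X}, A)
      = Poly_Mapping.lookup (cell_term n F A X) (F - {X}, A) + (\<Sum>X'\<in>F - {X}. Poly_Mapping.lookup (cell_term n F A X') (F - {X}, A))"
    by (simp add: cell_bdry_def lookup_sum lookup_add sum.remove[OF assms(1,2)])
  also have "(\<Sum>X'\<in>F - {X}. Poly_Mapping.lookup (cell_term n F A X') (F - {X}, A)) = 0"
    using z by (intro sum.neutral) blast
  finally show ?thesis using assms by (simp add: cell_term_def)
qed

lemma cells_cell_step:
  assumes "(F, A) \<in> cells n k" "cell_step n (F, A) (F', A')"
  shows "(F', A') \<in> cells n k" "Suc (card F') = card F"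
proof -
  obtain X where X: "X \<in> F" "F' = F - {X}" "if X \<in> A then \<exists>b\<in>kids n F X. A' = insert b (A - {X}) else A' = A"
    using assms(2) by (auto simp: cell_step_def)
  then show "(F', A') \<in> cells n k"
    using cells_remove[OF assms(1) X(1)] cells_replace(1)[OF assms(1) X(1)] by (auto split: if_splits)
  show "Suc (card F') = card F"
    using X card_Suc_Diff1[OF cells_finite_sets(1)[OF assms(1)] X(1)] by simp
qed

section \<open>The matching of the cells\<close>

text \<open>For \<open>k \<ge> 2\<close> the set \<open>\<Union>A\<close> strictly contains each
  member of \<open>A\<close>, and inserting it groups the inputs \<open>A\<close> under a new
  vertex. Acyclicity: from \<open>(insert (\<Union>A) F, A)\<close> a step either keeps
  \<open>A\<close> and then reaches \<open>L\<close> only by deleting \<open>\<Union>A\<close>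
  again, or replaces a member of \<open>A\<close> by one of its children and so shrinks
  \<open>\<Union>A\<close>.\<close>

lemma matching_not_covering:
  assumes k: "2 \<le> k"
  shows "acyclic_matching {(F, A) \<in> cells n k. \<Union>A \<noteq> {1..n}} (\<lambda>x y. Poly_Mapping.lookup (cell_bdry n x) y \<noteq> 0) {}"
proof -
  define X1 where "X1 = {(F, A) \<in> cells n k. \<Union>A \<noteq> {1..n}}"
  define L where "L = {(F, A) \<in> X1. \<Union>A \<notin> F}"
  define \<mu> :: "nat set set \<times> nat set set \<Rightarrow> nat set set \<times> nat set set" where "\<mu> = (\<lambda>(F, A). (insert (\<Union>A) F, A))"
  define \<rho> :: "nat set set \<times> nat set set \<Rightarrow> nat" where "\<rho> = (\<lambda>(F, A). card (\<Union>A))"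
  have facts: "\<exists>P. P \<in> insert {1..n} F \<and> \<Union>A \<subseteq> P \<and> (\<forall>X\<in>A. par n F X = P) \<and> 2 \<le> card (\<Union>A) \<and> finite (\<Union>A) \<and> (\<forall>X\<in>A. X \<subset> \<Union>A)"
    if c: "(F, A) \<in> cells n k" for F A
  proof -
    note f = cells_finite_sets[OF c]
    have "card A = k" using c by (simp add: cells_def)
    then obtain X Y where XY: "X \<in> A" "Y \<in> A" "X \<noteq> Y"
      using k f(2) card_le_Suc0_iff_eq[of A] by fastforce
    obtain P where P: "\<And>X. X \<in> A \<Longrightarrow> par n F X = P" using c unfolding cells_def by blast
    have dis: "X \<inter> Y = {}" if "X \<in> A" "Y \<in> A" "X \<noteq> Y" for X Y
      using siblings_disjoint[OF f(5), of X Y] P that f(6) by auto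
    have ne: "X \<noteq> {}" if "X \<in> A" for X using hier_input(3)[OF f(5)] f(6) that by blast
    have fu: "finite (\<Union>A)" using f(2,4) by blast
    obtain x y where xy: "x \<in> X" "y \<in> Y" using ne XY by blast
    then have "x \<noteq> y" using dis[OF XY] by blast
    have "card {x, y} \<le> card (\<Union>A)" using fu xy XY by (intro card_mono) auto
    moreover have "Z \<subset> \<Union>A" if Z: "Z \<in> A" for Z
    proof -
      obtain W where W: "W \<in> A" "W \<noteq> Z" using XY by metis
      then obtain w where "w \<in> W" using ne by blast
      then have "w \<notin> Z" "w \<in> \<Union>A" using dis[OF W(1) Z W(2)] W by blast+
      then show ?thesis using Z by blast
    qed
    moreover have "P \<in> insert {1..n} F" using par(1)[OF f(5), of X] P[OF XY(1)] f(6) XY(1) by auto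
    moreover have "\<Union>A \<subseteq> P" using par(2)[OF f(5)] P f(6) by blast
    ultimately show ?thesis using P fu \<open>x \<noteq> y\<close> by (intro exI[of _ P]) auto
  qed
  have up: "(insert (\<Union>A) F, A) \<in> X1" if x: "(F, A) \<in> L" for F A
  proof -
    let ?U = "\<Union>A"
    have c: "(F, A) \<in> cells n k" and U: "?U \<noteq> {1..n}" "?U \<notin> F" using x by (auto simp: L_def X1_def)
    note f = cells_finite_sets[OF c]
    obtain P where "P \<in> insert {1..n} F \<and> ?U \<subseteq> P \<and> (\<forall>X\<in>A. par n F X = P) \<and>
        2 \<le> card ?U \<and> finite ?U \<and> (\<forall>X\<in>A. X \<subset> ?U)" using facts[OF c] by (rule exE)
    then have P: "P \<in> insert {1..n} F" "?U \<subseteq> P" "\<And>X. X \<in> A \<Longrightarrow> par n F X = P"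
      "2 \<le> card ?U" "finite ?U" "\<And>X. X \<in> A \<Longrightarrow> X \<subset> ?U" by simp_all
    have Psub: "P \<subseteq> {1..n}" using hier_vertex(1)[OF f(5) P(1)] .
    \<comment> \<open>Below the common parent \<open>P\<close> no vertex \<open>Y\<close> can
      properly contain a member \<open>X\<close> of \<open>A\<close>, because the parent of
      \<open>X\<close> would lie inside \<open>Y\<close>. So \<open>Y\<close> lies in a member of
      \<open>A\<close> or is disjoint from all of them.\<close>
    have lam: "?U \<subseteq> Y \<or> Y \<subseteq> ?U \<or> ?U \<inter> Y = {}" if Y: "Y \<in> F" for Y
    proof -
      have Yi: "Y \<in> insert {1..n} (inputs n F)" "P \<in> insert {1..n} (inputs n F)" using Y P(1) by (auto simp: inputs_def)
      consider "Y \<subset> P" | "P \<subseteq> Y" | "Y \<inter> P = {}" using inputs_laminar[OF f(5) Yi] by blast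
      then show ?thesis
      proof cases
        case 1
        have "Y \<subseteq> X \<or> X \<inter> Y = {}" if X: "X \<in> A" for X
        proof -
          have Xi: "X \<in> inputs n F" using X f(6) by blast
          have "\<not> X \<subset> Y" using par(3)[OF f(5) Xi, of Y] P(3)[OF X] Y 1 by blast
          then show ?thesis using inputs_laminar[OF f(5), of X Y] Xi Yi by blast
        qed
        then show ?thesis by blast
      qed (use P(2) in blast)+
    qed
    have h: "hier n (insert ?U F)"
      using f(5) U P(2,4) Psub laminar_insert[of F ?U] lam by (auto simp: hier_def forest_def)
    have "par n (insert ?U F) X = ?U" if X: "X \<in> A" for X
    proof (rule par_eqI)
      show "X \<subset> ?U" using P(6)[OF X] .
      fix Y assume Y: "Y \<in> insert {1..n} (insert ?U F)" "X \<subset> Y"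
      show "?U \<subseteq> Y"
      proof (cases "Y = ?U")
        case False
        then have "Y \<in> insert {1..n} F" using Y by blast
        then have "P \<subseteq> Y" using par(3)[OF f(5), of X Y] P(3)[OF X] Y(2) f(6) X by blast
        then show ?thesis using P(2) by blast
      qed simp
    qed simp
    then have "(insert ?U F, A) \<in> cells n k"
      using c h unfolding cells_def by (auto simp: inputs_def)
    then show ?thesis using U by (simp add: X1_def)
  qed
  have down: "(F - {\<Union>A}, A) \<in> L" if x: "(F, A) \<in> X1" "\<Union>A \<in> F" for F A
  proof -
    have c: "(F, A) \<in> cells n k" using x by (simp add: X1_def)
    obtain P where "\<And>X. X \<in> A \<Longrightarrow> X \<subset> \<Union>A" using facts[OF c] by blast
    then have "\<Union>A \<notin> A" by blast
    then show ?thesis using cells_remove[OF c x(2)] x by (simp add: L_def X1_def)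
  qed
  have LX: "(F, A) \<in> X1" "(F, A) \<in> cells n k" "\<Union>A \<notin> F" "\<Union>A \<notin> A" "finite (\<Union>A)" if "(F, A) \<in> L" for F A
  proof -
    show "(F, A) \<in> X1" "\<Union>A \<notin> F" using that by (auto simp: L_def)
    then show c: "(F, A) \<in> cells n k" by (simp add: X1_def)
    obtain P where P: "\<And>X. X \<in> A \<Longrightarrow> X \<subset> \<Union>A" "finite (\<Union>A)" using facts[OF c] by blast
    then show "\<Union>A \<notin> A" by blast
    show "finite (\<Union>A)" by (rule P(2))
  qed
  have "acyclic_matching X1 (\<lambda>x y. Poly_Mapping.lookup (cell_bdry n x) y \<noteq> 0) {}"
    unfolding acyclic_matching_def
  proof (intro exI[of _ L] exI[of _ \<mu>] exI[of _ \<rho>] conjI ballI impI)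
    show "L \<union> \<mu> ` L \<union> {} = X1"
    proof (intro equalityI subsetI)
      fix x assume "x \<in> L \<union> \<mu> ` L \<union> {}"
      then obtain y where "y \<in> L" "x = y \<or> x = \<mu> y" by blast
      then obtain F A where FA: "(F, A) \<in> L" "x = (F, A) \<or> x = \<mu> (F, A)" by (metis surj_pair)
      then show "x \<in> X1" using up[OF FA(1)] LX(1)[OF FA(1)] by (auto simp: \<mu>_def)
    next
      fix x assume x: "x \<in> X1"
      obtain F A where FA: "x = (F, A)" by (cases x)
      show "x \<in> L \<union> \<mu> ` L \<union> {}"
      proof (cases "\<Union>A \<in> F")
        case True
        then have "x = \<mu> (F - {\<Union>A}, A)" by (auto simp: FA \<mu>_def)
        moreover have "(F - {\<Union>A}, A) \<in> L" using down x FA True by blast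
        ultimately show ?thesis by blast
      next
        case False then show ?thesis using x FA by (simp add: L_def)
      qed
    qed
    have "\<mu> x \<notin> L" for x by (cases x) (auto simp: \<mu>_def L_def)
    then show "L \<inter> \<mu> ` L = {}" by blast
    show "inj_on \<mu> L"
    proof (rule inj_onI)
      fix x y assume xy: "x \<in> L" "y \<in> L" "\<mu> x = \<mu> y"
      obtain F A F' A' where FA: "x = (F, A)" "y = (F', A')" by (cases x, cases y)
      then have "A = A'" "insert (\<Union>A) F = insert (\<Union>A) F'" "\<Union>A \<notin> F" "\<Union>A \<notin> F'"
        using xy LX(3) by (auto simp: \<mu>_def)
      then show "x = y" using FA insert_ident by metis
    qed
    fix x assume x: "x \<in> L"
    obtain F A where FA: "x = (F, A)" by (cases x)
    note l = LX[OF x[unfolded FA]]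
    have Fr: "insert (\<Union>A) F - {\<Union>A} = F" using l(3) by blast
    show "Poly_Mapping.lookup (cell_bdry n (\<mu> x)) x \<noteq> 0"
      using lookup_cell_bdry_remove[of "insert (\<Union>A) F" "\<Union>A" A n] l(4) cells_finite_sets(1)[OF l(2)]
      by (simp add: FA \<mu>_def Fr)
    fix y assume y: "y \<in> L" and "Poly_Mapping.lookup (cell_bdry n (\<mu> x)) y \<noteq> 0" and yx: "y \<noteq> x"
    then have st: "cell_step n (\<mu> x) y" using cell_step_if_lookup by blast
    obtain F' A' where FA': "y = (F', A')" by (cases y)
    note l' = LX[OF y[unfolded FA']]
    obtain X where X: "X \<in> insert (\<Union>A) F" "F' = insert (\<Union>A) F - {X}"
      "if X \<in> A then \<exists>b\<in>kids n (insert (\<Union>A) F) X. A' = insert b (A - {X}) else A' = A"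
      using st by (auto simp: cell_step_def FA FA' \<mu>_def)
    have hU: "hier n (insert (\<Union>A) F)" and cU: "(insert (\<Union>A) F, A) \<in> cells n k"
      using up[OF x[unfolded FA]] by (auto simp: X1_def cells_def)
    show "\<rho> y < \<rho> x"
    proof (cases "X \<in> A")
      case True
      then obtain b where b: "b \<in> kids n (insert (\<Union>A) F) X" "A' = insert b (A - {X})" using X by auto
      have bX: "b \<subset> X" using kids_psubset[OF hU b(1)] .
      \<comment> \<open>A label lost in passing from \<open>X\<close> to \<open>b\<close> is lost
        from the union, since the other members of \<open>A\<close> are disjoint from
        \<open>X\<close>.\<close>
      then obtain z where z: "z \<in> X" "z \<notin> b" by blast
      obtain Q where Q: "\<And>Z. Z \<in> A \<Longrightarrow> par n (insert (\<Union>A) F) Z = Q" using cU unfolding cells_def by blast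
      have "z \<notin> Z" if Z: "Z \<in> A - {X}" for Z
      proof -
        have "Z \<inter> X = {}"
        proof (rule siblings_disjoint[OF hU])
          show "Z \<in> inputs n (insert (\<Union>A) F)" "X \<in> inputs n (insert (\<Union>A) F)"
            using cells_finite_sets(6)[OF cU] Z True by blast+
          show "par n (insert (\<Union>A) F) Z = par n (insert (\<Union>A) F) X" using Q Z True by simp
        qed (use Z in blast)
        then show ?thesis using z by blast
      qed
      then have "z \<notin> \<Union>A'" using z b(2) by blast
      moreover have "\<Union>A' \<subseteq> \<Union>A" using b(2) bX True by blast
      moreover have "z \<in> \<Union>A" using z True by blast
      ultimately have "\<Union>A' \<subset> \<Union>A" by blast
      then show ?thesis using psubset_card_mono[OF l(5)] by (simp add: \<rho>_def FA FA')
    next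
      case False
      then have "A' = A" using X by simp
      moreover have "X \<noteq> \<Union>A" using X(2) Fr yx calculation FA FA' by auto
      ultimately have "\<Union>A' \<in> F'" using X by auto
      then show ?thesis using l'(3) by blast
    qed
  qed auto
  then show ?thesis by (simp add: X1_def)
qed

text \<open>If \<open>{1..n}\<close> were a member it would be the only root, and for
  \<open>n \<le> 1\<close> there is at most one root as well.\<close>

lemma hier_if_roots:
  assumes F: "forest n F" and r: "2 \<le> card (roots n F)"
  shows "hier n F"
proof -
  have "\<not> (\<forall>X\<in>roots n F. \<forall>Y\<in>roots n F. X = Y)"
    using r card_le_Suc0_iff_eq[OF finite_roots[OF F]] by auto
  then obtain X Y where XY: "X \<in> roots n F" "Y \<in> roots n F" "X \<noteq> Y" by blast
  have sub: "Z \<subseteq> {1..n} \<and> Z \<noteq> {}" if "Z \<in> roots n F" for Z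
    using that F by (auto simp: roots_def forest_def singles_def)
  have top: "Z = {1..n}" if "{1..n} \<in> F" "Z \<in> roots n F" for Z
    using that sub[OF that(2)] by (auto simp: roots_def)
  have "{1..n} \<notin> F" using top XY by metis
  moreover have "2 \<le> n"
  proof (rule ccontr)
    assume "\<not> 2 \<le> n"
    then have "{1..n} \<subseteq> {1}" by auto
    then have "X = {1}" "Y = {1}" using sub[OF XY(1)] sub[OF XY(2)] by blast+
    then show False using XY(3) by simp
  qed
  ultimately show ?thesis using F by (simp add: hier_def)
qed

lemma roots_eq_kids:
  assumes h: "hier n F"
  shows "roots n F = kids n F {1..n}"
proof -
  have "par n F X = {1..n} \<longleftrightarrow> \<not> (\<exists>Y\<in>F. X \<subset> Y)" if X: "X \<in> inputs n F" for X
  proof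
    assume p: "par n F X = {1..n}"
    show "\<not> (\<exists>Y\<in>F. X \<subset> Y)"
    proof
      assume "\<exists>Y\<in>F. X \<subset> Y"
      then obtain Y where Y: "Y \<in> F" "X \<subset> Y" by blast
      have "{1..n} \<subseteq> Y" using par(3)[OF h X, of Y] Y p by auto
      moreover have "Y \<subseteq> {1..n}" "Y \<noteq> {1..n}" using Y(1) h by (auto simp: hier_def forest_def)
      ultimately show False by blast
    qed
  next
    assume "\<not> (\<exists>Y\<in>F. X \<subset> Y)"
    then show "par n F X = {1..n}" using par(1,2)[OF h X] by blast
  qed
  then show ?thesis unfolding roots_def kids_def inputs_def by blast
qed

text \<open>All of \<open>A\<close> lies inside its common parent, so covering forces that parent to
  be \<open>{1..n}\<close>. Siblings are disjoint, so an input of \<open>{1..n}\<close> outside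
  \<open>A\<close> would have no label left.\<close>

lemma covering_cells:
  assumes k: "2 \<le> k"
  shows "{(F, A) \<in> cells n k. \<Union>A = {1..n}} = (\<lambda>F. (F, roots n F)) ` forests n k"
proof (intro equalityI subsetI)
  fix x assume "x \<in> {(F, A) \<in> cells n k. \<Union>A = {1..n}}"
  then obtain F A where x: "x = (F, A)" "(F, A) \<in> cells n k" "\<Union>A = {1..n}" by auto
  note f = cells_finite_sets[OF x(2)]
  obtain P where P: "\<And>X. X \<in> A \<Longrightarrow> par n F X = P" using x(2) unfolding cells_def by blast
  have P1: "P = {1..n}"
  proof -
    have "card A = k" using x by (simp add: cells_def)
    then have "A \<noteq> {}" using k by auto
    then obtain X where X: "X \<in> A" by blast
    have "P \<in> insert {1..n} F" using par(1)[OF f(5), of X] P[OF X] X f(6) by auto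
    then have "P \<subseteq> {1..n}" using hier_vertex(1)[OF f(5)] by blast
    moreover have "Y \<subseteq> P" if "Y \<in> A" for Y using par(2)[OF f(5), of Y] P[OF that] that f(6) by blast
    ultimately show ?thesis using x(3) by blast
  qed
  have "A = roots n F"
    unfolding roots_eq_kids[OF f(5)]
  proof (intro equalityI subsetI)
    fix X assume "X \<in> A" then show "X \<in> kids n F {1..n}" using P P1 f(6) by (auto simp: kids_def)
  next
    fix X assume X: "X \<in> kids n F {1..n}"
    then have Xi: "X \<in> inputs n F" "par n F X = {1..n}" by (auto simp: kids_def)
    obtain i where i: "i \<in> X" using hier_input(3)[OF f(5) Xi(1)] by blast
    then obtain Y where Y: "Y \<in> A" "i \<in> Y" using hier_input(1)[OF f(5) Xi(1)] x(3) by blast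
    have "X = Y"
      using siblings_disjoint[OF f(5) Xi(1), of Y] Xi(2) P[OF Y(1)] P1 Y f(6) i by blast
    then show "X \<in> A" using Y by simp
  qed
  moreover have "F \<in> forests n k" using calculation x(2) f(5) by (auto simp: forests_def cells_def hier_def)
  ultimately show "x \<in> (\<lambda>F. (F, roots n F)) ` forests n k" using x by blast
next
  fix x assume "x \<in> (\<lambda>F. (F, roots n F)) ` forests n k"
  then obtain F where F: "x = (F, roots n F)" "forest n F" "card (roots n F) = k" by (auto simp: forests_def)
  have h: "hier n F" using hier_if_roots F k by simp
  have "(F, roots n F) \<in> cells n k"
    unfolding cells_def using h F(3) by (auto simp: roots_eq_kids[OF h] kids_def)
  moreover have "\<Union>(roots n F) = {1..n}" using kids_cover[OF h, of "{1..n}"] roots_eq_kids[OF h] by simp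
  ultimately show "x \<in> {(F, A) \<in> cells n k. \<Union>A = {1..n}}" using F by simp
qed

text \<open>Deleting a root replaces it by one of its children, which uncovers a label, while the
  roots of a forest in \<open>forests n k\<close> always cover \<open>{1..n}\<close>. So only
  prunings remain.\<close>

lemma prunes_iff_lookup:
  assumes k: "2 \<le> k" and F: "F \<in> forests n k" and G: "G \<in> forests n k"
  shows "Poly_Mapping.lookup (cell_bdry n (F, roots n F)) (G, roots n G) \<noteq> 0 \<longleftrightarrow> prunes F G"
proof
  have f: "forest n F" "card (roots n F) = k" using F by (auto simp: forests_def)
  have h: "hier n F" using hier_if_roots f k by simp
  have cov: "\<Union>(roots n F) = {1..n}" "\<Union>(roots n G) = {1..n}"
  proof -
    have "\<Union>(roots n H) = {1..n}" if "H \<in> forests n k" for H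
    proof -
      have "(H, roots n H) \<in> {(F, A) \<in> cells n k. \<Union>A = {1..n}}"
        unfolding covering_cells[OF k] using that by (rule imageI)
      then show ?thesis by simp
    qed
    then show "\<Union>(roots n F) = {1..n}" "\<Union>(roots n G) = {1..n}" using F G by simp_all
  qed
  show "prunes F G" if nz: "Poly_Mapping.lookup (cell_bdry n (F, roots n F)) (G, roots n G) \<noteq> 0"
  proof -
    obtain X where X: "X \<in> F" "G = F - {X}" "if X \<in> roots n F
        then \<exists>b\<in>kids n F X. roots n G = insert b (roots n F - {X}) else roots n G = roots n F"
      using cell_step_if_lookup[OF nz] by (auto simp: cell_step_def)
    have "X \<notin> roots n F"
    proof
      assume r: "X \<in> roots n F"
      then obtain b where b: "b \<in> kids n F X" "roots n G = insert b (roots n F - {X})" using X(3) by auto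
      obtain z where z: "z \<in> X" "z \<notin> b" using kids_psubset[OF h b(1)] by blast
      have "z \<notin> Z" if Z: "Z \<in> roots n F - {X}" for Z
        using siblings_disjoint[OF h, of Z X] Z r z unfolding roots_eq_kids[OF h] kids_def by blast
      then have "z \<notin> \<Union>(roots n G)" using z b(2) by blast
      moreover have "z \<in> \<Union>(roots n F)" using z r by blast
      ultimately show False using cov by blast
    qed
    then have "\<exists>Y\<in>F. X \<subset> Y" using X(1) by (auto simp: roots_def)
    then show ?thesis using X by (auto simp: prunes_def)
  qed
  show "Poly_Mapping.lookup (cell_bdry n (F, roots n F)) (G, roots n G) \<noteq> 0" if "prunes F G"
  proof -
    obtain X Y where X: "X \<in> F" "Y \<in> F" "X \<subset> Y" "G = F - {X}" using \<open>prunes F G\<close> by (auto simp: prunes_def)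
    have "roots n G = roots n F" using roots_remove[OF f(1) X(1-3)] X by simp
    moreover have "X \<notin> roots n F" using X by (auto simp: roots_def)
    ultimately show ?thesis using lookup_cell_bdry_remove[OF finite_forest[OF f(1)] X(1)] X(4) by simp
  qed
qed

text \<open>Steps never enlarge \<open>\<Union>A\<close>, so no boundary leads from a cell that does
  not cover \<open>{1..n}\<close> to one that does, and the two matchings can be united.\<close>

theorem cells_matching:
  assumes k: "2 \<le> k"
  shows "\<exists>C. acyclic_matching (cells n k) (\<lambda>x y. Poly_Mapping.lookup (cell_bdry n x) y \<noteq> 0) C
     \<and> card C = stirling n k \<and> (\<forall>x\<in>C. card (fst x) + k = n)"
proof -
  let ?E = "\<lambda>x y. Poly_Mapping.lookup (cell_bdry n x) y \<noteq> 0"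
  let ?X1 = "{(F, A) \<in> cells n k. \<Union>A \<noteq> {1..n}}" and ?X2 = "{(F, A) \<in> cells n k. \<Union>A = {1..n}}"
  let ?h = "\<lambda>F. (F, roots n F)"
  obtain C where C: "acyclic_matching (forests n k) prunes C" "card C = stirling n k" "\<forall>F\<in>C. card F + k = n"
    using forests_matching by blast
  have inj: "inj_on ?h S" for S by (auto simp: inj_on_def)
  have M2: "acyclic_matching ?X2 ?E (?h ` C)"
    unfolding covering_cells[OF k] by (rule acyclic_matching_image[OF inj _ C(1)]) (rule prunes_iff_lookup[OF k])
  have "acyclic_matching (?X1 \<union> ?X2) ?E ({} \<union> ?h ` C)"
  proof (rule acyclic_matching_union[OF _ _ _ matching_not_covering[OF k] M2])
    show "finite ?X1" by (rule finite_subset[OF _ finite_cells[of n k]]) auto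
    show "?X1 \<inter> ?X2 = {}" by auto
    fix x y assume x: "x \<in> ?X1" and y: "y \<in> ?X2"
    show "\<not> ?E x y"
    proof
      assume "?E x y"
      then have st: "cell_step n x y" by (rule cell_step_if_lookup)
      obtain F A F' A' where FA: "x = (F, A)" "y = (F', A')" by (cases x, cases y)
      have c: "(F, A) \<in> cells n k" "\<Union>A \<noteq> {1..n}" "\<Union>A' = {1..n}" using x y FA by auto
      note f = cells_finite_sets[OF c(1)]
      have "\<Union>A' \<subseteq> \<Union>A"
      proof -
        obtain X where X: "X \<in> F" "if X \<in> A then \<exists>b\<in>kids n F X. A' = insert b (A - {X}) else A' = A"
          using st by (auto simp: cell_step_def FA)
        show ?thesis
        proof (cases "X \<in> A")
          case True
          then obtain b where b: "b \<in> kids n F X" "A' = insert b (A - {X})" using X by auto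
          then show ?thesis using kids_psubset[OF f(5) b(1)] True by blast
        qed (use X in simp)
      qed
      moreover have "Z \<subseteq> {1..n}" if "Z \<in> A" for Z using hier_input(1)[OF f(5)] f(6) that by blast
      ultimately show False using c(2,3) by blast
    qed
  qed
  moreover have "?X1 \<union> ?X2 = cells n k" by auto
  moreover have "card (?h ` C) = stirling n k" using card_image[OF inj] C(2) by simp
  ultimately show ?thesis using C(3) by (intro exI[of _ "?h ` C"]) auto
qed

section \<open>Isomorphisms of graphs with labelled legs\<close>

text \<open>The part of \<open>stirling_iso\<close> that concerns the tree alone. Outputs, inputs
  and label sets are shown to be invariant under it, so that statements about arbitrary stable trees
  can be checked on \<open>canon\<close>.\<close>

definition graph_iso :: "('v \<Rightarrow> 'w) \<Rightarrow> ('f \<Rightarrow> 'g) \<Rightarrow> ('v, 'f) flag_graph \<Rightarrow> ('w, 'g) flag_graph \<Rightarrow> bool" where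
  "graph_iso \<phi> \<psi> G G' \<longleftrightarrow>
     bij_betw \<phi> (verts G) (verts G') \<and> bij_betw \<psi> (flags G) (flags G') \<and>
     (\<forall>f\<in>flags G. adj G' (\<psi> f) = \<phi> (adj G f) \<and> invol G' (\<psi> f) = \<psi> (invol G f)) \<and>
     (\<forall>f\<in>legs G. lab G' (\<psi> f) = lab G f)"

lemma stirling_iso_graph_iso:
  "stirling_iso \<phi> \<psi> S S' \<longleftrightarrow> graph_iso \<phi> \<psi> (st_tree S) (st_tree S') \<and>
     st_vert S' = \<phi> (st_vert S) \<and> st_alt S' = \<psi> ` st_alt S"
  by (simp add: stirling_iso_def graph_iso_def Let_def)

lemma graph_isoD:
  assumes "graph_iso \<phi> \<psi> G G'"
  shows "bij_betw \<phi> (verts G) (verts G')" "bij_betw \<psi> (flags G) (flags G')"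
    "\<And>f. f \<in> flags G \<Longrightarrow> adj G' (\<psi> f) = \<phi> (adj G f)"
    "\<And>f. f \<in> flags G \<Longrightarrow> invol G' (\<psi> f) = \<psi> (invol G f)"
    "\<And>f. f \<in> legs G \<Longrightarrow> lab G' (\<psi> f) = lab G f"
    "inj_on \<phi> (verts G)" "inj_on \<psi> (flags G)" "\<psi> ` flags G = flags G'" "\<phi> ` verts G = verts G'"
    "\<And>f. f \<in> flags G \<Longrightarrow> \<psi> f \<in> flags G'" "\<And>v. v \<in> verts G \<Longrightarrow> \<phi> v \<in> verts G'"
    "\<And>x. x \<in> flags G' \<Longrightarrow> \<exists>f\<in>flags G. x = \<psi> f"
  using assms by (auto simp: graph_iso_def bij_betw_def)

lemma flag_graphD:
  assumes "is_flag_graph G"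
  shows "finite (verts G)" "finite (flags G)" "verts G \<noteq> {}" "\<And>f. f \<in> flags G \<Longrightarrow> adj G f \<in> verts G"
    "\<And>f. f \<in> flags G \<Longrightarrow> invol G f \<in> flags G" "\<And>f. f \<in> flags G \<Longrightarrow> invol G (invol G f) = f"
  using assms by (auto simp: is_flag_graph_def)

lemma linksI: "f \<in> H \<Longrightarrow> u = adj G f \<Longrightarrow> v = adj G (invol G f) \<Longrightarrow> (u, v) \<in> links G H"
  unfolding links_def by blast

lemma linksE:
  assumes "(u, v) \<in> links G H"
  obtains f where "f \<in> H" "u = adj G f" "v = adj G (invol G f)"
  using assms unfolding links_def by blast

lemma iso_legs:
  assumes "graph_iso \<phi> \<psi> G G'" "is_flag_graph G"
  shows "f \<in> flags G \<Longrightarrow> \<psi> f \<in> legs G' \<longleftrightarrow> f \<in> legs G" "legs G' = \<psi> ` legs G"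
proof -
  note i = graph_isoD[OF assms(1)] and g = flag_graphD[OF assms(2)]
  show *: "\<psi> f \<in> legs G' \<longleftrightarrow> f \<in> legs G" if "f \<in> flags G" for f
    using i(4,10)[OF that] g(5)[OF that] that inj_onD[OF i(7), of "invol G f" f] by (auto simp: legs_def)
  show "legs G' = \<psi> ` legs G"
  proof (intro equalityI subsetI)
    fix x assume x: "x \<in> legs G'"
    then obtain f where "f \<in> flags G" "x = \<psi> f" using i(8) by (auto simp: legs_def)
    then show "x \<in> \<psi> ` legs G" using * x by blast
  next
    fix x assume "x \<in> \<psi> ` legs G"
    then obtain f where "f \<in> legs G" "x = \<psi> f" by blast
    then show "x \<in> legs G'" using * by (auto simp: legs_def)
  qed
qed

lemma graph_iso_inv:
  assumes iso: "graph_iso \<phi> \<psi> G G'" and G: "is_flag_graph G"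
  shows "graph_iso (inv_into (verts G) \<phi>) (inv_into (flags G) \<psi>) G' G"
proof -
  note i = graph_isoD[OF iso] and g = flag_graphD[OF G]
  let ?a = "inv_into (verts G) \<phi>" and ?b = "inv_into (flags G) \<psi>"
  have b: "?b (\<psi> f) = f" if "f \<in> flags G" for f using i(7) that by simp
  have a: "?a (\<phi> f) = f" if "f \<in> verts G" for f using i(6) that by simp
  have "adj G (?b x) = ?a (adj G' x) \<and> invol G (?b x) = ?b (invol G' x)" if "x \<in> flags G'" for x
  proof -
    have "\<exists>f\<in>flags G. x = \<psi> f" using i(12)[OF that] .
    then obtain f where "f \<in> flags G" "x = \<psi> f" by blast
    then show ?thesis using a b g i(3,4) by simp
  qed
  moreover have "lab G (?b x) = lab G' x" if "x \<in> legs G'" for x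
  proof -
    have "x \<in> \<psi> ` legs G" using that iso_legs(2)[OF iso G] by simp
    then obtain f where f: "f \<in> legs G" "x = \<psi> f" by blast
    then have "f \<in> flags G" by (simp add: legs_def)
    then show ?thesis using b f i(5) by simp
  qed
  ultimately show ?thesis
    using bij_betw_inv_into[OF i(1)] bij_betw_inv_into[OF i(2)] by (simp add: graph_iso_def)
qed

lemma graph_iso_trans:
  assumes iso: "graph_iso \<phi> \<psi> G G'" "graph_iso \<phi>' \<psi>' G' G''" and G: "is_flag_graph G"
  shows "graph_iso (\<phi>' \<circ> \<phi>) (\<psi>' \<circ> \<psi>) G G''"
proof -
  note i = graph_isoD[OF iso(1)] and i' = graph_isoD[OF iso(2)]
  have "lab G'' (\<psi>' (\<psi> f)) = lab G f" if f: "f \<in> legs G" for f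
  proof -
    have "\<psi> f \<in> legs G'" using iso_legs[OF iso(1) G] f by (auto simp: legs_def)
    then show ?thesis using i(5)[OF f] i'(5) by simp
  qed
  then show ?thesis using i i' bij_betw_trans[OF i(1) i'(1)] bij_betw_trans[OF i(2) i'(2)]
    by (simp add: graph_iso_def)
qed

lemma iso_flag_graph:
  assumes iso: "graph_iso \<phi> \<psi> G G'" and G: "is_flag_graph G"
  shows "is_flag_graph G'"
proof -
  note i = graph_isoD[OF iso] and g = flag_graphD[OF G]
  have "adj G' x \<in> verts G' \<and> invol G' x \<in> flags G' \<and> invol G' (invol G' x) = x" if "x \<in> flags G'" for x
  proof -
    have "\<exists>f\<in>flags G. x = \<psi> f" using i(12)[OF that] .
    then obtain f where "f \<in> flags G" "x = \<psi> f" by blast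
    then show ?thesis using g i by simp
  qed
  moreover have "finite (verts G')" "finite (flags G')" "verts G' \<noteq> {}"
    using bij_betw_finite[OF i(1)] bij_betw_finite[OF i(2)] g i(9) by auto
  ultimately show ?thesis by (simp add: is_flag_graph_def)
qed

lemma iso_edges:
  assumes iso: "graph_iso \<phi> \<psi> G G'" and G: "is_flag_graph G"
  shows "edges G' = image \<psi> ` edges G" "card (edges G') = card (edges G)"
proof -
  note i = graph_isoD[OF iso] and g = flag_graphD[OF G]
  show eq: "edges G' = image \<psi> ` edges G"
  proof (intro equalityI subsetI)
    fix e assume "e \<in> edges G'"
    then obtain x where x: "x \<in> flags G'" "invol G' x \<noteq> x" "e = {x, invol G' x}" by (auto simp: edges_def)
    then obtain f where f: "f \<in> flags G" "x = \<psi> f" using i(8) by auto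
    then have "{f, invol G f} \<in> edges G" "e = \<psi> ` {f, invol G f}" using x i(4)[OF f(1)] by (auto simp: edges_def)
    then show "e \<in> image \<psi> ` edges G" by blast
  next
    fix e assume "e \<in> image \<psi> ` edges G"
    then obtain f where f: "f \<in> flags G" "invol G f \<noteq> f" "e = \<psi> ` {f, invol G f}" by (auto simp: edges_def)
    then have "\<psi> (invol G f) \<noteq> \<psi> f" using inj_onD[OF i(7)] g(5) by blast
    then show "e \<in> edges G'" unfolding edges_def using f i(4)[OF f(1)] i(10)[OF f(1)]
      by (auto intro!: exI[of _ "\<psi> f"])
  qed
  have "inj_on (image \<psi>) (edges G)"
    by (rule inj_on_image_Pow[OF i(7), THEN inj_on_subset]) (use g(5) in \<open>auto simp: edges_def\<close>)
  then show "card (edges G') = card (edges G)" unfolding eq by (rule card_image)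
qed

lemma iso_valence:
  assumes iso: "graph_iso \<phi> \<psi> G G'" and G: "is_flag_graph G" and v: "v \<in> verts G"
  shows "valence G' (\<phi> v) = valence G v"
proof -
  note i = graph_isoD[OF iso] and g = flag_graphD[OF G]
  have "{x \<in> flags G'. adj G' x = \<phi> v} = \<psi> ` {f \<in> flags G. adj G f = v}"
    unfolding i(8)[symmetric] using i(3) inj_onD[OF i(6)] g(4) v by auto
  moreover have "inj_on \<psi> {f \<in> flags G. adj G f = v}" by (rule inj_on_subset[OF i(7)]) auto
  ultimately show ?thesis by (simp add: valence_def card_image)
qed

lemma iso_links:
  assumes iso: "graph_iso \<phi> \<psi> G G'" and G: "is_flag_graph G" and H: "H \<subseteq> flags G"
    and uv: "(u, v) \<in> (links G H)\<^sup>*"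
  shows "(\<phi> u, \<phi> v) \<in> (links G' (\<psi> ` H))\<^sup>*"
  using uv
proof induction
  case (step v w)
  note i = graph_isoD[OF iso] and g = flag_graphD[OF G]
  obtain f where f: "f \<in> H" "v = adj G f" "w = adj G (invol G f)" using step.hyps(2) by (auto simp: links_def)
  then have "f \<in> flags G" using H by blast
  then have "\<phi> v = adj G' (\<psi> f)" "\<phi> w = adj G' (invol G' (\<psi> f))" using i(3,4) g(5) f by simp_all
  then have "(\<phi> v, \<phi> w) \<in> links G' (\<psi> ` H)" unfolding links_def using f(1) by blast
  then show ?case using step.IH by (rule rtrancl_into_rtrancl[rotated])
qed simp

lemma iso_links_iff:
  assumes iso: "graph_iso \<phi> \<psi> G G'" and G: "is_flag_graph G" and H: "H \<subseteq> flags G"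
    and uv: "u \<in> verts G" "v \<in> verts G"
  shows "(\<phi> u, \<phi> v) \<in> (links G' (\<psi> ` H))\<^sup>* \<longleftrightarrow> (u, v) \<in> (links G H)\<^sup>*"
proof
  note i = graph_isoD[OF iso]
  assume "(\<phi> u, \<phi> v) \<in> (links G' (\<psi> ` H))\<^sup>*"
  then have "(inv_into (verts G) \<phi> (\<phi> u), inv_into (verts G) \<phi> (\<phi> v)) \<in> (links G (inv_into (flags G) \<psi> ` \<psi> ` H))\<^sup>*"
    by (rule iso_links[OF graph_iso_inv[OF iso G] iso_flag_graph[OF iso G], rotated]) (use H i(8) in blast)
  then show "(u, v) \<in> (links G H)\<^sup>*"
    using i(6) uv inv_into_image_cancel[OF i(7) H] by simp
qed (rule iso_links[OF iso G H])

lemma iso_stable_tree: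
  assumes iso: "graph_iso \<phi> \<psi> G G'" and st: "stable_tree n G"
  shows "stable_tree n G'"
proof -
  have G: "is_flag_graph G" using st by (simp add: stable_tree_def is_flag_tree_def)
  note i = graph_isoD[OF iso] and g = flag_graphD[OF G]
  have "(x, y) \<in> (links G' (flags G'))\<^sup>*" if xy: "x \<in> verts G'" "y \<in> verts G'" for x y
  proof -
    have "x \<in> \<phi> ` verts G" "y \<in> \<phi> ` verts G" using xy i(9) by simp_all
    then obtain u v where uv: "u \<in> verts G" "v \<in> verts G" "x = \<phi> u" "y = \<phi> v" by blast
    then have "(u, v) \<in> (links G (flags G))\<^sup>*" using st by (simp add: stable_tree_def is_flag_tree_def)
    then show ?thesis using iso_links[OF iso G order_refl] uv i(8) by simp
  qed
  moreover have "card (edges G') + 1 = card (verts G')"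
    using iso_edges(2)[OF iso G] bij_betw_same_card[OF i(1)] st by (simp add: stable_tree_def is_flag_tree_def)
  moreover have "3 \<le> valence G' x" if x: "x \<in> verts G'" for x
  proof -
    have "x \<in> \<phi> ` verts G" using x i(9) by simp
    then obtain v where "v \<in> verts G" "x = \<phi> v" by blast
    then show ?thesis using iso_valence[OF iso G] st by (simp add: stable_tree_def)
  qed
  moreover have "bij_betw (lab G') (legs G') {0..n}"
  proof -
    have b: "bij_betw (lab G) (legs G) {0..n}" using st by (simp add: stable_tree_def)
    have "bij_betw \<psi> (legs G) (legs G')"
      unfolding bij_betw_def using iso_legs(2)[OF iso G] inj_on_subset[OF i(7)] by (auto simp: legs_def)
    then have "bij_betw (inv_into (legs G) \<psi>) (legs G') (legs G)" by (rule bij_betw_inv_into)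
    from bij_betw_trans[OF this b] have "bij_betw (lab G \<circ> inv_into (legs G) \<psi>) (legs G') {0..n}" .
    moreover have "(lab G \<circ> inv_into (legs G) \<psi>) x = lab G' x" if "x \<in> legs G'" for x
      using i(5) \<open>bij_betw \<psi> (legs G) (legs G')\<close> that
      by (metis bij_betw_inv_into_right bij_betw_def comp_apply inv_into_into)
    ultimately show ?thesis using bij_betw_cong by blast
  qed
  ultimately show ?thesis using iso_flag_graph[OF iso G] by (simp add: stable_tree_def is_flag_tree_def)
qed

lemma stable_root:
  assumes "stable_tree n G"
  shows "root_flag G \<in> legs G" "lab G (root_flag G) = 0" "\<And>f. f \<in> legs G \<Longrightarrow> lab G f = 0 \<Longrightarrow> f = root_flag G"
    "root_flag G \<in> flags G"
proof -
  have b: "bij_betw (lab G) (legs G) {0..n}" using assms by (simp add: stable_tree_def)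
  then have "0 \<in> lab G ` legs G" by (simp add: bij_betw_def)
  then obtain f where f: "f \<in> legs G" "lab G f = 0" by (metis imageE)
  have u: "f' = f" if "f' \<in> legs G" "lab G f' = 0" for f'
    using inj_onD[OF bij_betw_imp_inj_on[OF b], of f' f] f that by simp
  have r: "root_flag G = f" unfolding root_flag_def
  proof (rule the_equality)
    show "f \<in> legs G \<and> lab G f = 0" using f by blast
    show "f' = f" if "f' \<in> legs G \<and> lab G f' = 0" for f' using u that by blast
  qed
  show "root_flag G \<in> legs G" "lab G (root_flag G) = 0" unfolding r by (fact f)+
  then show "root_flag G \<in> flags G" by (simp add: legs_def)
  show "f' = root_flag G" if "f' \<in> legs G" "lab G f' = 0" for f' unfolding r by (rule u[OF that])
qed

lemma stable_flag_graph: "stable_tree n G \<Longrightarrow> is_flag_graph G"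
  by (simp add: stable_tree_def is_flag_tree_def)

lemma iso_root:
  assumes iso: "graph_iso \<phi> \<psi> G G'" and st: "stable_tree n G"
  shows "root_flag G' = \<psi> (root_flag G)"
proof -
  note r = stable_root[OF st] and r' = stable_root[OF iso_stable_tree[OF iso st]]
  have "\<psi> (root_flag G) \<in> legs G'" using iso_legs(2)[OF iso stable_flag_graph[OF st]] r(1) by blast
  moreover have "lab G' (\<psi> (root_flag G)) = 0" using graph_isoD(5)[OF iso r(1)] r(2) by simp
  ultimately show ?thesis using r'(3) by simp
qed

text \<open>\<open>is_output\<close> asks for connectedness after the removal of an edge, so its
  invariance comes down to that of reachability over a set of flags.\<close>

lemma iso_is_output:
  assumes iso: "graph_iso \<phi> \<psi> G G'" and st: "stable_tree n G" and f: "f \<in> flags G"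
  shows "is_output G' (\<psi> f) \<longleftrightarrow> is_output G f"
proof -
  have G: "is_flag_graph G" using stable_flag_graph[OF st] .
  note i = graph_isoD[OF iso] and g = flag_graphD[OF G] and r = stable_root[OF st]
  have 1: "\<psi> f = root_flag G' \<longleftrightarrow> f = root_flag G"
    unfolding iso_root[OF iso st] using inj_onD[OF i(7) _ f r(4)] by blast
  have 2: "invol G' (\<psi> f) \<noteq> \<psi> f \<longleftrightarrow> invol G f \<noteq> f"
    using i(4)[OF f] inj_onD[OF i(7) _ g(5)[OF f] f] by auto
  have "flags G' - {\<psi> f, invol G' (\<psi> f)} = \<psi> ` (flags G - {f, invol G f})"
    using inj_on_image_set_diff[OF i(7), of "flags G" "{f, invol G f}"] f g(5)[OF f] i(4)[OF f] i(8) by auto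
  then have 3: "(adj G' (invol G' (\<psi> f)), adj G' (root_flag G')) \<in> (links G' (flags G' - {\<psi> f, invol G' (\<psi> f)}))\<^sup>*
     \<longleftrightarrow> (adj G (invol G f), adj G (root_flag G)) \<in> (links G (flags G - {f, invol G f}))\<^sup>*"
    unfolding iso_root[OF iso st] i(4)[OF f] i(3)[OF g(5)[OF f]] i(3)[OF r(4)]
    by (simp only:) (rule iso_links_iff[OF iso G], use g(4,5) f r(4) in auto)
  show ?thesis unfolding is_output_def using 1 2 3 i(10)[OF f] f by blast
qed

lemma iso_is_input:
  assumes "graph_iso \<phi> \<psi> G G'" "stable_tree n G" "f \<in> flags G"
  shows "is_input G' (\<psi> f) \<longleftrightarrow> is_input G f"
  using iso_is_output[OF assms] graph_isoD(10)[OF assms(1,3)] assms(3) by (simp add: is_input_def)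

text \<open>The set of labels above a vertex or a flag, i.e. on the side away from the root.\<close>

definition vclus :: "('v, 'f) flag_graph \<Rightarrow> 'v \<Rightarrow> nat set" where
  "vclus G v = lab G ` {l \<in> legs G. lab G l \<noteq> 0 \<and> (adj G l, v) \<in> (links G {f. is_output G f})\<^sup>*}"

definition clus :: "('v, 'f) flag_graph \<Rightarrow> 'f \<Rightarrow> nat set" where
  "clus G f = (if f \<in> legs G then {lab G f} else vclus G (adj G (if is_output G f then f else invol G f)))"

definition eclus :: "('v, 'f) flag_graph \<Rightarrow> 'f set \<Rightarrow> nat set" where
  "eclus G e = clus G (in_end G e)"

lemma is_output_flags: "is_output G f \<Longrightarrow> f \<in> flags G"
  by (simp add: is_output_def)

lemma is_input_flags: "is_input G f \<Longrightarrow> f \<in> flags G"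
  by (simp add: is_input_def)

lemma iso_vclus:
  assumes iso: "graph_iso \<phi> \<psi> G G'" and st: "stable_tree n G" and v: "v \<in> verts G"
  shows "vclus G' (\<phi> v) = vclus G v"
proof -
  have G: "is_flag_graph G" using stable_flag_graph[OF st] .
  note i = graph_isoD[OF iso] and g = flag_graphD[OF G]
  have O: "{f. is_output G' f} = \<psi> ` {f. is_output G f}"
  proof (intro equalityI subsetI)
    fix x assume x: "x \<in> {f. is_output G' f}"
    then obtain f where "f \<in> flags G" "x = \<psi> f" using is_output_flags[of G' x] i(8) by blast
    then show "x \<in> \<psi> ` {f. is_output G f}" using x iso_is_output[OF iso st] by auto
  next
    fix x assume "x \<in> \<psi> ` {f. is_output G f}"
    then obtain f where "is_output G f" "x = \<psi> f" by blast
    then show "x \<in> {f. is_output G' f}" using iso_is_output[OF iso st is_output_flags] by simp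
  qed
  have Os: "{f. is_output G f} \<subseteq> flags G" by (auto dest: is_output_flags)
  have e: "lab G' (\<psi> l) = lab G l"
    "(adj G' (\<psi> l), \<phi> v) \<in> (links G' {f. is_output G' f})\<^sup>* \<longleftrightarrow> (adj G l, v) \<in> (links G {f. is_output G f})\<^sup>*"
    if l: "l \<in> legs G" for l
  proof -
    have lf: "l \<in> flags G" using l by (simp add: legs_def)
    show "lab G' (\<psi> l) = lab G l" using i(5)[OF l] .
    show "(adj G' (\<psi> l), \<phi> v) \<in> (links G' {f. is_output G' f})\<^sup>* \<longleftrightarrow> (adj G l, v) \<in> (links G {f. is_output G f})\<^sup>*"
      unfolding O i(3)[OF lf] by (rule iso_links_iff[OF iso G Os g(4)[OF lf] v])
  qed
  let ?P = "\<lambda>l. lab G l \<noteq> 0 \<and> (adj G l, v) \<in> (links G {f. is_output G f})\<^sup>*"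
  have "{x \<in> legs G'. lab G' x \<noteq> 0 \<and> (adj G' x, \<phi> v) \<in> (links G' {f. is_output G' f})\<^sup>*} = \<psi> ` {l \<in> legs G. ?P l}"
    unfolding iso_legs(2)[OF iso G] using e by auto
  moreover have "lab G' ` \<psi> ` {l \<in> legs G. ?P l} = lab G ` {l \<in> legs G. ?P l}"
    unfolding image_image by (rule image_cong) (use e(1) in auto)
  ultimately show ?thesis by (simp add: vclus_def)
qed

lemma iso_clus:
  assumes iso: "graph_iso \<phi> \<psi> G G'" and st: "stable_tree n G" and f: "f \<in> flags G"
  shows "clus G' (\<psi> f) = clus G f"
proof -
  have G: "is_flag_graph G" using stable_flag_graph[OF st] .
  note i = graph_isoD[OF iso] and g = flag_graphD[OF G]
  show ?thesis
    unfolding clus_def iso_legs(1)[OF iso G f] iso_is_output[OF iso st f]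
    using i(3,4,5) f g(4,5) iso_vclus[OF iso st] by simp
qed

section \<open>The tree of a hierarchy\<close>

text \<open>\<open>(X, True)\<close> is the output flag of the vertex \<open>X\<close> and \<open>(X, False)\<close> the input flag with
  label set \<open>X\<close>.\<close>

definition canon :: "nat \<Rightarrow> nat set set \<Rightarrow> (nat set, nat set \<times> bool) flag_graph" where
  "canon n F =
    \<lparr>verts = insert {1..n} F,
     flags = insert {1..n} F \<times> {True} \<union> inputs n F \<times> {False},
     adj = (\<lambda>(X, b). if b then X else par n F X),
     invol = (\<lambda>(X, b). if X \<in> F then (X, \<not> b) else (X, b)),
     lab = (\<lambda>(X, b). if b then 0 else Min X)\<rparr>"

lemma canon_simps [simp]:
  "verts (canon n F) = insert {1..n} F"
  "(X, True) \<in> flags (canon n F) \<longleftrightarrow> X \<in> insert {1..n} F"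
  "(X, False) \<in> flags (canon n F) \<longleftrightarrow> X \<in> inputs n F"
  "adj (canon n F) (X, True) = X" "adj (canon n F) (X, False) = par n F X"
  "invol (canon n F) (X, b) = (if X \<in> F then (X, \<not> b) else (X, b))"
  "lab (canon n F) (X, True) = 0" "lab (canon n F) (X, False) = Min X"
  by (auto simp: canon_def)

lemma canon_flags: "flags (canon n F) = insert {1..n} F \<times> {True} \<union> inputs n F \<times> {False}"
  by (simp add: canon_def)

context
  fixes n :: nat and F :: "nat set set"
  assumes h: "hier n F"
begin

lemma top_notin: "{1..n} \<notin> F"
  using h by (simp add: hier_def)

lemma canon_flag_graph: "is_flag_graph (canon n F)"
proof -
  have "adj (canon n F) f \<in> verts (canon n F) \<and> invol (canon n F) f \<in> flags (canon n F)
      \<and> invol (canon n F) (invol (canon n F) f) = f" if f: "f \<in> flags (canon n F)" for f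
  proof (cases f)
    case (Pair X b)
    then show ?thesis using f par(1)[OF h, of X] by (cases b) (auto simp: inputs_def)
  qed
  moreover have "finite (flags (canon n F))"
    using hier_finite[OF h] hier_finite_inputs[OF h] by (simp add: canon_flags)
  ultimately show ?thesis unfolding is_flag_graph_def using hier_finite[OF h] by auto
qed

lemma canon_legs: "legs (canon n F) = insert ({1..n}, True) (singles n \<times> {False})"
proof (intro set_eqI)
  fix f :: "nat set \<times> bool"
  obtain X b where f: "f = (X, b)" by (cases f)
  have "X \<notin> F" if "X \<in> singles n" using not_singles[OF h, of X] that by auto
  then show "f \<in> legs (canon n F) \<longleftrightarrow> f \<in> insert ({1..n}, True) (singles n \<times> {False})"
    using top_notin unfolding f by (cases b) (auto simp: legs_def inputs_def)
qed

lemma canon_edges: "edges (canon n F) = (\<lambda>X. {(X, True), (X, False)}) ` F"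
proof (intro equalityI subsetI)
  fix e assume "e \<in> edges (canon n F)"
  then obtain f where f: "f \<in> flags (canon n F)" "invol (canon n F) f \<noteq> f" "e = {f, invol (canon n F) f}"
    by (auto simp: edges_def)
  obtain X b where X: "f = (X, b)" by (cases f)
  then have "X \<in> F" using f(2) by (auto split: if_splits)
  then show "e \<in> (\<lambda>X. {(X, True), (X, False)}) ` F" using f(3) X by (cases b) auto
next
  fix e assume "e \<in> (\<lambda>X. {(X, True), (X, False)}) ` F"
  then obtain X where "X \<in> F" "e = {(X, True), (X, False)}" by blast
  then show "e \<in> edges (canon n F)" unfolding edges_def by (intro CollectI exI[of _ "(X, True)"]) simp
qed

text \<open>Climbing along parents uses only the output flags of members above \<open>Y\<close>. The
  flag set \<open>H\<close> is kept general so that this serves for connectedness, for the output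
  test with one edge removed, and for paths along output flags.\<close>

lemma canon_up:
  assumes "Y \<in> insert {1..n} F" "W \<in> insert {1..n} F" "Y \<subseteq> W"
    and "\<And>Z. Z \<in> F \<Longrightarrow> Y \<subseteq> Z \<Longrightarrow> (Z, True) \<in> H"
  shows "(Y, W) \<in> (links (canon n F) H)\<^sup>*"
  using assms
proof (induction "n - card Y" arbitrary: Y rule: less_induct)
  case less
  show ?case
  proof (cases "Y = W")
    case False
    then have YW: "Y \<subset> W" using less.prems by blast
    then have "Y \<noteq> {1..n}" using hier_vertex(1)[OF h less.prems(2)] by blast
    then have Y: "Y \<in> F" using less.prems(1) by blast
    then have Yi: "Y \<in> inputs n F" by (simp add: inputs_def)
    note p = par[OF h Yi]
    have "par n F Y \<subseteq> {1..n}" using hier_vertex(1)[OF h p(1)] .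
    then have "card (par n F Y) \<le> n" using card_mono[of "{1..n}"] by simp
    moreover have "card Y < card (par n F Y)" using psubset_card_mono[OF hier_vertex(3)[OF h p(1)] p(2)] .
    ultimately have "n - card (par n F Y) < n - card Y" by simp
    then have "(par n F Y, W) \<in> (links (canon n F) H)\<^sup>*"
    proof (rule less.hyps)
      show "par n F Y \<subseteq> W" using p(3) less.prems(2) YW by blast
      show "(Z, True) \<in> H" if "Z \<in> F" "par n F Y \<subseteq> Z" for Z using less.prems(4)[of Z] that p(2) by blast
    qed (use p(1) less.prems(2) in auto)
    moreover have "(Y, par n F Y) \<in> links (canon n F) H"
      by (rule linksI[of "(Y, True)"]) (use less.prems(4)[OF Y] Y in simp_all)
    ultimately show ?thesis by (rule converse_rtrancl_into_rtrancl[rotated])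
  qed simp
qed

lemma canon_valence:
  assumes P: "P \<in> insert {1..n} F"
  shows "3 \<le> valence (canon n F) P"
proof -
  have "{f \<in> flags (canon n F). adj (canon n F) f = P} = insert (P, True) (kids n F P \<times> {False})"
  proof (intro set_eqI)
    fix f :: "nat set \<times> bool"
    obtain Y b where f: "f = (Y, b)" by (cases f)
    show "f \<in> {f \<in> flags (canon n F). adj (canon n F) f = P} \<longleftrightarrow> f \<in> insert (P, True) (kids n F P \<times> {False})"
      using P unfolding f by (cases b) (auto simp: kids_def)
  qed
  moreover have "card (insert (P, True) (kids n F P \<times> {False})) = Suc (card (kids n F P))"
    using finite_kids[OF h] by (simp add: card_cartesian_product)
  ultimately show ?thesis using card_kids[OF h P] by (simp add: valence_def)
qed

lemma canon_stable: "stable_tree n (canon n F)"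
proof -
  let ?G = "canon n F"
  have sym: "sym (links ?G (flags ?G))"
  proof (rule symI)
    fix u v assume "(u, v) \<in> links ?G (flags ?G)"
    then obtain f where f: "f \<in> flags ?G" "u = adj ?G f" "v = adj ?G (invol ?G f)" by (rule linksE)
    then show "(v, u) \<in> links ?G (flags ?G)"
      by (intro linksI[of "invol ?G f"]) (simp_all add: flag_graphD(5,6)[OF canon_flag_graph f(1)])
  qed
  have up: "(u, {1..n}) \<in> (links ?G (flags ?G))\<^sup>*" if "u \<in> insert {1..n} F" for u
    by (rule canon_up[OF that]) (use hier_vertex(1)[OF h that] in auto)
  have "(u, v) \<in> (links ?G (flags ?G))\<^sup>*" if "u \<in> insert {1..n} F" "v \<in> insert {1..n} F" for u v
    using up[OF that(1)] up[OF that(2)] sym_rtrancl[OF sym] by (meson rtrancl_trans symD)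
  moreover have "card (edges ?G) + 1 = card (verts ?G)"
  proof -
    have "inj_on (\<lambda>X. {(X, True), (X, False)}) F" by (rule inj_onI) (auto simp: doubleton_eq_iff)
    then show ?thesis using canon_edges card_image hier_finite[OF h] top_notin by auto
  qed
  moreover have "bij_betw (lab ?G) (legs ?G) {0..n}"
  proof (rule bij_betwI[where g = "\<lambda>i. if i = 0 then ({1..n}, True) else ({i}, False)"])
    show "lab ?G \<in> legs ?G \<rightarrow> {0..n}" by (auto simp: canon_legs singles_def)
    show "(\<lambda>i. if i = 0 then ({1..n}, True) else ({i}, False)) \<in> {0..n} \<rightarrow> legs ?G"
      by (auto simp: canon_legs singles_def)
    fix f assume "f \<in> legs ?G"
    then show "(if lab ?G f = 0 then ({1..n}, True) else ({lab ?G f}, False)) = f"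
      by (auto simp: canon_legs singles_def)
  qed auto
  ultimately show ?thesis
    using canon_flag_graph canon_valence by (simp add: stable_tree_def is_flag_tree_def)
qed

lemma canon_root: "root_flag (canon n F) = ({1..n}, True)"
  by (rule stable_root(3)[OF canon_stable, symmetric]) (auto simp: canon_legs)

lemma canon_is_output: "is_output (canon n F) (X, b) \<longleftrightarrow> b \<and> X \<in> insert {1..n} F"
proof (cases b)
  case True
  have "(par n F X, {1..n}) \<in> (links (canon n F) (flags (canon n F) - {(X, True), (X, False)}))\<^sup>*" if X: "X \<in> F"
  proof (rule canon_up)
    have Xi: "X \<in> inputs n F" using X by (simp add: inputs_def)
    note p = par[OF h Xi]
    show "par n F X \<in> insert {1..n} F" using p(1) .
    show "par n F X \<subseteq> {1..n}" using hier_vertex(1)[OF h p(1)] .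
    show "(Z, True) \<in> flags (canon n F) - {(X, True), (X, False)}" if "Z \<in> F" "par n F X \<subseteq> Z" for Z
      using that p(2) by auto
  qed simp
  then show ?thesis using True canon_root by (auto simp: is_output_def)
next
  case False
  have "\<not> is_output (canon n F) (X, False)"
  proof (cases "X \<in> F")
    case True
    let ?H = "flags (canon n F) - {(X, False), (X, True)}"
    \<comment> \<open>With the edge \<open>X\<close> removed, links starting at subsets of
      \<open>X\<close> lead to subsets of \<open>X\<close>, so the root vertex is out of
      reach.\<close>
    have cl: "v \<subseteq> X" if uv: "(u, v) \<in> links (canon n F) ?H" "u \<subseteq> X" for u v
    proof -
      obtain f where f: "f \<in> ?H" "u = adj (canon n F) f" "v = adj (canon n F) (invol (canon n F) f)"
        using uv(1) by (rule linksE)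
      obtain Y c where Y: "f = (Y, c)" by (cases f)
      have YX: "Y \<noteq> X" using f(1) Y by (cases c) auto
      show ?thesis
      proof (cases "c \<and> Y \<in> F")
        case True
        then have "Y \<in> inputs n F" "Y \<subset> X" using f Y YX uv(2) by (auto simp: inputs_def)
        then have "par n F Y \<subseteq> X" using par(3)[OF h, of Y X] \<open>X \<in> F\<close> by blast
        then show ?thesis using f Y True by simp
      next
        case False
        show ?thesis
        proof (cases "Y \<in> F")
          case True
          then have "\<not> c" using False by simp
          then have "Y \<subset> u" "v = Y" using f Y True par(2)[OF h, of Y] by (auto simp: inputs_def)
          then show ?thesis using uv(2) by blast
        next
          case False
          then show ?thesis using f Y uv(2) by simp
        qed
      qed
    qed
    have "v \<subseteq> X" if "(X, v) \<in> (links (canon n F) ?H)\<^sup>*" for v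
      using that by induction (use cl in auto)
    moreover have "\<not> {1..n} \<subseteq> X" using hier_vertex(1)[OF h insertI2[OF True]] True top_notin by (metis subset_antisym)
    ultimately show ?thesis using True canon_root by (auto simp: is_output_def)
  next
    case False
    then show ?thesis using canon_root by (simp add: is_output_def)
  qed
  then show ?thesis using False by simp
qed

lemma canon_vclus:
  assumes X: "X \<in> insert {1..n} F"
  shows "vclus (canon n F) X = X"
proof -
  let ?O = "{f. is_output (canon n F) f}"
  \<comment> \<open>Along output flags the vertex only grows, so the leg \<open>i\<close> can reach
    \<open>X\<close> only if \<open>i \<in> X\<close>; conversely, climbing from its parent gets
    there.\<close>
  have mono: "u \<subseteq> v" if "(u, v) \<in> (links (canon n F) ?O)\<^sup>*" for u v
    using that
  proof induction
    case (step v w)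
    then obtain Y b where "is_output (canon n F) (Y, b)" "v = adj (canon n F) (Y, b)"
      "w = adj (canon n F) (invol (canon n F) (Y, b))" by (auto elim!: linksE simp del: canon_simps)
    then have "v \<subseteq> w" using canon_is_output[of Y b] par(2)[OF h, of Y] by (auto simp: inputs_def split: if_splits)
    then show ?case using step.IH by blast
  qed simp
  have si: "{i} \<in> inputs n F" if "i \<in> {1..n}" for i using that by (auto simp: inputs_def singles_def)
  have iff: "(par n F {i}, X) \<in> (links (canon n F) ?O)\<^sup>* \<longleftrightarrow> i \<in> X" if i: "i \<in> {1..n}" for i
  proof
    note p = par[OF h si[OF i]]
    show "i \<in> X" if "(par n F {i}, X) \<in> (links (canon n F) ?O)\<^sup>*"
      using mono[OF that] p(2) by blast
    assume "i \<in> X"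
    then have "{i} \<subset> X" using hier_vertex(5)[OF h X] by blast
    then show "(par n F {i}, X) \<in> (links (canon n F) ?O)\<^sup>*"
      by (intro canon_up[OF p(1) X p(3)[OF X]]) (use canon_is_output in auto)
  qed
  have "{l \<in> legs (canon n F). lab (canon n F) l \<noteq> 0 \<and> (adj (canon n F) l, X) \<in> (links (canon n F) ?O)\<^sup>*}
      = (\<lambda>i. ({i}, False)) ` X"
  proof -
    have "{l \<in> legs (canon n F). lab (canon n F) l \<noteq> 0 \<and> (adj (canon n F) l, X) \<in> (links (canon n F) ?O)\<^sup>*}
       = (\<lambda>i. ({i}, False)) ` {i \<in> {1..n}. (par n F {i}, X) \<in> (links (canon n F) ?O)\<^sup>*}"
      by (auto simp: canon_legs singles_def)
    also have "{i \<in> {1..n}. (par n F {i}, X) \<in> (links (canon n F) ?O)\<^sup>*} = X"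
      using iff hier_vertex(1)[OF h X] by blast
    finally show ?thesis .
  qed
  then show ?thesis by (simp add: vclus_def image_image)
qed

lemma canon_clus: "X \<in> inputs n F \<Longrightarrow> clus (canon n F) (X, False) = X"
  using canon_vclus[of X] canon_is_output[of X False] not_singles[OF h, of X] top_notin
  by (auto simp: clus_def canon_legs inputs_def singles_def)

end

section \<open>Every stable tree comes from a hierarchy\<close>

context
  fixes G :: "('v, 'f) flag_graph" and n :: nat
  assumes st: "stable_tree n G"
begin

definition base :: 'v where
  "base = adj G (root_flag G)"

text \<open>Directions are first read off from the distance to the root vertex. Agreement with
  \<open>is_output\<close> comes afterwards, through the isomorphism with
  \<open>canon\<close>.\<close>

definition depth :: "'v \<Rightarrow> nat" where
  "depth v = (LEAST m. (v, base) \<in> links G (flags G) ^^ m)"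

definition nodes :: "'v set" where
  "nodes = verts G - {base}"

text \<open>Some flag leading closer to the root vertex is chosen; that there is only one follows
  from the count in \<open>edges_eq\<close>.\<close>

definition upflag :: "'v \<Rightarrow> 'f" where
  "upflag v = (SOME f. f \<in> flags G \<and> adj G f = v \<and> depth (adj G (invol G f)) < depth v)"

definition parent :: "'v \<Rightarrow> 'v" where
  "parent v = adj G (invol G (upflag v))"

definition parents :: "('v \<times> 'v) set" where
  "parents = {(v, parent v) | v. v \<in> nodes}"

definition outflag :: "'v \<Rightarrow> 'f" where
  "outflag v = (if v = base then root_flag G else upflag v)"

definition above_labels :: "'v \<Rightarrow> nat set" where
  "above_labels v = lab G ` {l \<in> legs G. l \<noteq> root_flag G \<and> (adj G l, v) \<in> parents\<^sup>*}"

lemma tree_flag_graph: "is_flag_graph G"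
  using stable_flag_graph[OF st] .

lemmas graph_facts = flag_graphD[OF tree_flag_graph]
lemmas root_facts = stable_root[OF st]

lemma base_vert: "base \<in> verts G"
  using graph_facts(4)[OF root_facts(4)] by (simp add: base_def)

lemma upflag:
  assumes v: "v \<in> nodes"
  shows "upflag v \<in> flags G" "adj G (upflag v) = v" "depth (parent v) < depth v"
    "parent v \<in> verts G" "invol G (upflag v) \<in> flags G" "invol G (upflag v) \<noteq> upflag v"
proof -
  have v': "v \<in> verts G" "v \<noteq> base" using v by (auto simp: nodes_def)
  have "(v, base) \<in> (links G (flags G))\<^sup>*"
    using st v' base_vert by (simp add: stable_tree_def is_flag_tree_def)
  then obtain m where m: "(v, base) \<in> links G (flags G) ^^ m" using rtrancl_power by blast
  then have d: "(v, base) \<in> links G (flags G) ^^ depth v" unfolding depth_def by (rule LeastI)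
  then obtain m' where m': "depth v = Suc m'" using v'(2) by (cases "depth v") auto
  then obtain w where w: "(v, w) \<in> links G (flags G)" "(w, base) \<in> links G (flags G) ^^ m'"
    using d relpow_Suc_D2 by metis
  have "depth w \<le> m'" unfolding depth_def by (rule Least_le) (rule w(2))
  moreover obtain f where "f \<in> flags G" "v = adj G f" "w = adj G (invol G f)" using w(1) by (rule linksE)
  ultimately have "\<exists>f. f \<in> flags G \<and> adj G f = v \<and> depth (adj G (invol G f)) < depth v" using m' by auto
  then have "upflag v \<in> flags G \<and> adj G (upflag v) = v \<and> depth (adj G (invol G (upflag v))) < depth v"
    unfolding upflag_def by (rule someI_ex)
  then show u: "upflag v \<in> flags G" "adj G (upflag v) = v" "depth (parent v) < depth v"
    by (auto simp: parent_def)
  then show "parent v \<in> verts G" "invol G (upflag v) \<in> flags G" using graph_facts by (auto simp: parent_def)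
  show "invol G (upflag v) \<noteq> upflag v" using u by (auto simp: parent_def)
qed

text \<open>The edges through the flags \<open>upflag v\<close> are pairwise distinct, so by counting there
  are no other edges.\<close>

lemma edges_eq: "edges G = (\<lambda>v. {upflag v, invol G (upflag v)}) ` nodes"
proof (rule card_subset_eq[symmetric])
  let ?e = "\<lambda>v. {upflag v, invol G (upflag v)}"
  show "finite (edges G)"
  proof (rule finite_subset)
    show "edges G \<subseteq> Pow (flags G)" using graph_facts(5) by (auto simp: edges_def)
  qed (simp add: graph_facts(2))
  show "?e ` nodes \<subseteq> edges G"
  proof
    fix e assume "e \<in> ?e ` nodes"
    then obtain v where "v \<in> nodes" "e = ?e v" by blast
    then show "e \<in> edges G" unfolding edges_def using upflag(1,6) by blast
  qed
  have "inj_on ?e nodes"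
  proof (rule inj_onI, rule ccontr)
    fix u v assume uv: "u \<in> nodes" "v \<in> nodes" "?e u = ?e v" "u \<noteq> v"
    have "upflag u \<noteq> upflag v" using upflag(2)[OF uv(1)] upflag(2)[OF uv(2)] uv(4) by auto
    then have "upflag u = invol G (upflag v)" "upflag v = invol G (upflag u)" using uv(3) by (auto simp: doubleton_eq_iff)
    then have "parent v = u" "parent u = v"
      using upflag(2)[OF uv(1)] upflag(2)[OF uv(2)] by (auto simp: parent_def)
    then show False using upflag(3)[OF uv(1)] upflag(3)[OF uv(2)] by simp
  qed
  then have "card (?e ` nodes) = card nodes" by (rule card_image)
  also have "\<dots> = card (edges G)"
  proof -
    have "card (edges G) + 1 = card (verts G)" using st by (simp add: stable_tree_def is_flag_tree_def)
    then show ?thesis using base_vert graph_facts(1) by (simp add: nodes_def)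
  qed
  finally show "card (?e ` nodes) = card (edges G)" .
qed

lemma flag_cases:
  assumes "f \<in> flags G"
  obtains (root) "f = root_flag G" | (leg) "f \<in> legs G" "f \<noteq> root_flag G"
    | (up) v where "v \<in> nodes" "f = upflag v" | (down) v where "v \<in> nodes" "f = invol G (upflag v)"
proof (cases "f \<in> legs G")
  case True then show ?thesis using root leg by blast
next
  case False
  then have "{f, invol G f} \<in> edges G" using assms by (auto simp: edges_def legs_def)
  then obtain v where "v \<in> nodes" "{f, invol G f} = {upflag v, invol G (upflag v)}" unfolding edges_eq by blast
  then show ?thesis using up down by blast
qed

lemma not_leg: "v \<in> nodes \<Longrightarrow> upflag v \<notin> legs G" "v \<in> nodes \<Longrightarrow> invol G (upflag v) \<notin> legs G"
proof -
  show "upflag v \<notin> legs G" if "v \<in> nodes" using upflag(6)[OF that] by (simp add: legs_def)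
  show "invol G (upflag v) \<notin> legs G" if "v \<in> nodes"
    using upflag(6)[OF that] graph_facts(6)[OF upflag(1)[OF that]] by (auto simp: legs_def)
qed

lemma parents_iff: "(u, v) \<in> parents \<longleftrightarrow> u \<in> nodes \<and> v = parent u"
  by (auto simp: parents_def)

lemma parents_depth: "(u, v) \<in> parents\<^sup>* \<Longrightarrow> u = v \<or> depth v < depth u"
proof (induction rule: rtrancl_induct)
  case (step v w)
  then show ?case using upflag(3)[of v] by (auto simp: parents_iff)
qed simp

lemma parents_antisym: "(u, v) \<in> parents\<^sup>* \<Longrightarrow> (v, u) \<in> parents\<^sup>* \<Longrightarrow> u = v"
  using parents_depth[of u v] parents_depth[of v u] by auto

lemma parents_linear: "(x, u) \<in> parents\<^sup>* \<Longrightarrow> (x, v) \<in> parents\<^sup>* \<Longrightarrow> (u, v) \<in> parents\<^sup>* \<or> (v, u) \<in> parents\<^sup>*"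
  by (rule single_valued_confluent) (auto simp: single_valued_def parents_iff)

lemma parents_step: "(u, v) \<in> parents\<^sup>* \<Longrightarrow> u \<noteq> v \<Longrightarrow> u \<in> nodes \<and> (parent u, v) \<in> parents\<^sup>*"
  by (erule converse_rtranclE) (auto simp: parents_iff)

lemma parents_base: "v \<in> verts G \<Longrightarrow> (v, base) \<in> parents\<^sup>*"
proof (induction "depth v" arbitrary: v rule: less_induct)
  case less
  show ?case
  proof (cases "v = base")
    case False
    then have v: "v \<in> nodes" using less.prems by (simp add: nodes_def)
    have "(parent v, base) \<in> parents\<^sup>*" using less.hyps[OF upflag(3,4)[OF v]] .
    moreover have "(v, parent v) \<in> parents" using v by (simp add: parents_iff)
    ultimately show ?thesis by (rule converse_rtrancl_into_rtrancl[rotated])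
  qed simp
qed

lemma outflag: "v \<in> verts G \<Longrightarrow> outflag v \<in> flags G" "v \<in> verts G \<Longrightarrow> adj G (outflag v) = v"
  using upflag(1,2)[of v] root_facts(4) by (auto simp: outflag_def nodes_def base_def)

section \<open>Label sets above the inputs of a vertex\<close>

definition ins :: "'v \<Rightarrow> 'f set" where
  "ins v = {f \<in> flags G. adj G f = v \<and> f \<noteq> outflag v}"

definition in_labels :: "'f \<Rightarrow> nat set" where
  "in_labels f = (if f \<in> legs G then {lab G f} else above_labels (adj G (invol G f)))"

lemma ins_cases:
  assumes f: "f \<in> ins v"
  obtains (leg) "f \<in> legs G" "f \<noteq> root_flag G" "adj G f = v" "in_labels f = {lab G f}"
    | (down) u where "u \<in> nodes" "f = invol G (upflag u)" "parent u = v" "in_labels f = above_labels u"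
proof -
  have f': "f \<in> flags G" "adj G f = v" "f \<noteq> outflag v" using f by (auto simp: ins_def)
  show ?thesis using f'(1)
  proof (cases rule: flag_cases)
    case root then show ?thesis using f' by (simp add: outflag_def base_def)
  next
    case leg': leg then show ?thesis using leg f' by (simp add: in_labels_def)
  next
    case (up u)
    then have "u = v" using upflag(2) f' by simp
    then show ?thesis using up f' by (simp add: outflag_def nodes_def)
  next
    case down': (down u)
    then have "in_labels f = above_labels u"
      using not_leg(2)[OF down'(1)] upflag(1,2)[OF down'(1)] graph_facts(6) by (simp add: in_labels_def)
    then show ?thesis using down down' f' by (simp add: parent_def)
  qed
qed

lemma card_ins: "v \<in> verts G \<Longrightarrow> 2 \<le> card (ins v)"
proof -
  assume v: "v \<in> verts G"
  have "{f \<in> flags G. adj G f = v} = insert (outflag v) (ins v)" "outflag v \<notin> ins v"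
    using outflag[OF v] by (auto simp: ins_def)
  moreover have "finite (ins v)" using graph_facts(2) by (simp add: ins_def)
  moreover have "3 \<le> valence G v" using st v by (simp add: stable_tree_def)
  ultimately show ?thesis by (simp add: valence_def)
qed

lemma above_labelsE:
  assumes "i \<in> above_labels v"
  obtains l where "l \<in> legs G" "l \<noteq> root_flag G" "(adj G l, v) \<in> parents\<^sup>*" "i = lab G l"
  using assms unfolding above_labels_def by blast

lemma above_labelsI: "l \<in> legs G \<Longrightarrow> l \<noteq> root_flag G \<Longrightarrow> (adj G l, v) \<in> parents\<^sup>* \<Longrightarrow> lab G l \<in> above_labels v"
  unfolding above_labels_def by blast

lemma lab_inj: "l \<in> legs G \<Longrightarrow> l' \<in> legs G \<Longrightarrow> lab G l = lab G l' \<Longrightarrow> l = l'"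
  using st unfolding stable_tree_def bij_betw_def inj_on_def by blast

lemma above_mono: "(u, v) \<in> parents\<^sup>* \<Longrightarrow> above_labels u \<subseteq> above_labels v"
  unfolding above_labels_def by (intro image_mono) (auto intro: rtrancl_trans)

lemma above_nonempty:
  assumes v: "v \<in> verts G"
  shows "above_labels v \<noteq> {}"
proof -
  \<comment> \<open>At a deepest descendant \<open>w\<close> of \<open>v\<close> some input exists,
    and it must be a leg, for otherwise it would lead to a deeper descendant.\<close>
  let ?D = "{w \<in> verts G. (w, v) \<in> parents\<^sup>*}"
  have D: "finite (depth ` ?D)" "depth ` ?D \<noteq> {}" using graph_facts(1) v by auto
  then have "Max (depth ` ?D) \<in> depth ` ?D" by (rule Max_in)
  then obtain w where w: "Max (depth ` ?D) = depth w" "w \<in> ?D" by (rule imageE)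
  note w = w(2) w(1)[symmetric]
  have mx: "depth u \<le> depth w" if "u \<in> ?D" for u using D(1) that w(2) by simp
  have "ins w \<noteq> {}" using card_ins[of w] w(1) by auto
  then obtain f where "f \<in> ins w" by blast
  then show ?thesis
  proof (cases rule: ins_cases)
    case leg
    then show ?thesis using above_labelsI[of f v] w(1) by blast
  next
    case (down u)
    have "(u, w) \<in> parents" using down by (simp add: parents_iff)
    then have "(u, v) \<in> parents\<^sup>*" using w(1) by (auto intro: converse_rtrancl_into_rtrancl)
    then have "depth u \<le> depth w" using mx down(1) by (simp add: nodes_def)
    then show ?thesis using upflag(3)[OF down(1)] down(3) by simp
  qed
qed

lemma in_labels:
  assumes f: "f \<in> ins v"
  shows "in_labels f \<noteq> {}" "in_labels f \<subseteq> above_labels v"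
  using f
proof (atomize (full), cases rule: ins_cases)
  case leg then show "in_labels f \<noteq> {} \<and> in_labels f \<subseteq> above_labels v" using above_labelsI[of f v] by simp
next
  case (down u)
  have "(u, v) \<in> parents\<^sup>*" using down by (auto simp: parents_iff)
  then show "in_labels f \<noteq> {} \<and> in_labels f \<subseteq> above_labels v"
    using down above_mono above_nonempty[of u] by (simp add: nodes_def)
qed

text \<open>A label determines its leg, and the ancestors of a leg form a chain. A label shared by
  two inputs of \<open>v\<close> would make the vertices behind them comparable, or make a child of
  \<open>v\<close> an ancestor of \<open>v\<close>, against \<open>depth\<close>.\<close>

lemma in_labels_disjoint:
  assumes f: "f \<in> ins v" "f' \<in> ins v" "f \<noteq> f'"
  shows "in_labels f \<inter> in_labels f' = {}"
proof -
  have 1: False if l: "l \<in> legs G" "adj G l = v" and u: "u \<in> nodes" "parent u = v" and i: "lab G l \<in> above_labels u" for l u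
  proof -
    obtain l' where l': "l' \<in> legs G" "(adj G l', u) \<in> parents\<^sup>*" "lab G l = lab G l'" using i by (rule above_labelsE)
    then have "(v, u) \<in> parents\<^sup>*" using lab_inj[OF l(1) l'(1)] l by simp
    then show False using parents_depth upflag(3)[OF u(1)] u(2) by force
  qed
  have 2: "\<not> (u, u') \<in> parents\<^sup>*" if u: "u \<in> nodes" "parent u = v" "u' \<in> nodes" "parent u' = v" "u \<noteq> u'" for u u'
  proof
    assume "(u, u') \<in> parents\<^sup>*"
    then have "(v, u') \<in> parents\<^sup>*" using parents_step u by blast
    then show False using parents_depth upflag(3)[OF u(3)] u(4) by force
  qed
  show ?thesis using f(1)
  proof (cases rule: ins_cases)
    case leg1: leg
    show ?thesis using f(2)
    proof (cases rule: ins_cases)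
      case leg then show ?thesis using leg1 lab_inj f(3) by auto
    next
      case (down u) then show ?thesis using leg1 1[of f u] by auto
    qed
  next
    case down1: (down u)
    show ?thesis using f(2)
    proof (cases rule: ins_cases)
      case leg then show ?thesis using down1 1[of f' u] by auto
    next
      case (down u')
      show ?thesis
      proof (rule ccontr)
        assume "in_labels f \<inter> in_labels f' \<noteq> {}"
        then obtain i where i: "i \<in> above_labels u" "i \<in> above_labels u'" using down1 down by auto
        obtain l where l: "l \<in> legs G" "(adj G l, u) \<in> parents\<^sup>*" "i = lab G l" using i(1) by (rule above_labelsE)
        obtain l' where l': "l' \<in> legs G" "(adj G l', u') \<in> parents\<^sup>*" "i = lab G l'" using i(2) by (rule above_labelsE)
        have "l' = l" using lab_inj[OF l'(1) l(1)] l l' by simp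
        then have "(u, u') \<in> parents\<^sup>* \<or> (u', u) \<in> parents\<^sup>*" using parents_linear[OF l(2)] l'(2) by simp
        moreover have "u \<noteq> u'" using f(3) down1(2) down(2) by auto
        ultimately show False using 2 down1 down by metis
      qed
    qed
  qed
qed

lemma finite_above: "finite (above_labels v)"
proof -
  have "legs G \<subseteq> flags G" by (auto simp: legs_def)
  then have "finite (legs G)" using graph_facts(2) finite_subset by blast
  then show ?thesis by (simp add: above_labels_def)
qed

lemma card_above:
  assumes v: "v \<in> verts G"
  shows "2 \<le> card (above_labels v)"
proof -
  have "finite (ins v)" using graph_facts(2) by (simp add: ins_def)
  then have "\<not> (\<forall>a\<in>ins v. \<forall>b\<in>ins v. a = b)" using card_ins[OF v] card_le_Suc0_iff_eq[of "ins v"] by auto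
  then obtain f f' where f: "f \<in> ins v" "f' \<in> ins v" "f \<noteq> f'" by blast
  obtain i j where "i \<in> in_labels f" "j \<in> in_labels f'" using in_labels(1) f by blast
  then have ij: "i \<in> above_labels v" "j \<in> above_labels v" "i \<noteq> j"
    using in_labels(2)[OF f(1)] in_labels(2)[OF f(2)] in_labels_disjoint[OF f] by blast+
  have "card {i, j} \<le> card (above_labels v)" using ij by (intro card_mono finite_above) auto
  then show ?thesis using ij(3) by simp
qed

lemma invol_upflag_ins:
  assumes u: "u \<in> nodes"
  shows "invol G (upflag u) \<in> ins (parent u)"
proof -
  let ?v = "parent u" and ?f = "invol G (upflag u)"
  have "?f \<noteq> outflag ?v"
  proof
    assume e: "?f = outflag ?v"
    show False
    proof (cases "?v = base")
      case True then show False using e root_facts(1) not_leg(2)[OF u] by (simp add: outflag_def)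
    next
      case False
      then have v: "?v \<in> nodes" "?f = upflag ?v"
        using e upflag(4)[OF u] by (simp_all add: outflag_def nodes_def)
      have "parent ?v = adj G (invol G ?f)" by (simp only: parent_def[of "parent u"] v(2)[symmetric])
      also have "\<dots> = u" using upflag(1,2)[OF u] graph_facts(6) by simp
      finally have "parent ?v = u" .
      then show False using upflag(3)[OF v(1)] upflag(3)[OF u] by simp
    qed
  qed
  then show ?thesis using upflag(5)[OF u] by (simp add: ins_def parent_def)
qed

lemma above_strict:
  assumes u: "u \<in> nodes"
  shows "above_labels u \<subset> above_labels (parent u)"
proof -
  let ?v = "parent u" and ?f = "invol G (upflag u)"
  have f: "?f \<in> ins ?v" by (rule invol_upflag_ins[OF u])
  have fu: "in_labels ?f = above_labels u"
    using not_leg(2)[OF u] upflag(1,2)[OF u] graph_facts(6) by (simp add: in_labels_def)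
  have "finite (ins ?v)" using graph_facts(2) by (simp add: ins_def)
  then have "\<not> (\<forall>a\<in>ins ?v. \<forall>b\<in>ins ?v. a = b)"
    using card_ins[OF upflag(4)[OF u]] card_le_Suc0_iff_eq[of "ins ?v"] by auto
  then obtain f' where f': "f' \<in> ins ?v" "f' \<noteq> ?f" using f by metis
  have "in_labels ?f \<inter> in_labels f' = {}" using in_labels_disjoint[OF f f'(1)] f'(2) by simp
  then show ?thesis using in_labels(2)[OF f] in_labels[OF f'(1)] fu by blast
qed

text \<open>A common label makes the two vertices comparable, and \<open>above_strict\<close>
  decides the direction. Ancestry thus becomes inclusion of label sets, which also makes
  \<open>above_labels\<close> injective.\<close>

lemma above_subset_iff:
  assumes u: "u \<in> verts G" and v: "v \<in> verts G"
  shows "above_labels u \<subseteq> above_labels v \<longleftrightarrow> (u, v) \<in> parents\<^sup>*"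
proof
  assume s: "above_labels u \<subseteq> above_labels v"
  obtain i where i: "i \<in> above_labels u" "i \<in> above_labels v" using above_nonempty[OF u] s by blast
  obtain l where l: "l \<in> legs G" "(adj G l, u) \<in> parents\<^sup>*" "i = lab G l" using i(1) by (rule above_labelsE)
  obtain l' where l': "l' \<in> legs G" "(adj G l', v) \<in> parents\<^sup>*" "i = lab G l'" using i(2) by (rule above_labelsE)
  have "l' = l" using lab_inj[OF l'(1) l(1)] l l' by simp
  then have "(u, v) \<in> parents\<^sup>* \<or> (v, u) \<in> parents\<^sup>*" using parents_linear[OF l(2)] l'(2) by simp
  moreover have "(v, u) \<in> parents\<^sup>* \<Longrightarrow> v = u"
  proof (rule ccontr)
    assume vu: "(v, u) \<in> parents\<^sup>*" "v \<noteq> u"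
    then have "v \<in> nodes" "(parent v, u) \<in> parents\<^sup>*" using parents_step by blast+
    then have "above_labels v \<subset> above_labels u" using above_strict above_mono by blast
    then show False using s by blast
  qed
  ultimately show "(u, v) \<in> parents\<^sup>*" by blast
qed (rule above_mono)

lemma above_inj: "u \<in> verts G \<Longrightarrow> v \<in> verts G \<Longrightarrow> above_labels u = above_labels v \<Longrightarrow> u = v"
  using above_subset_iff[of u v] above_subset_iff[of v u] parents_antisym by simp

lemma above_laminar:
  assumes u: "u \<in> verts G" and v: "v \<in> verts G"
  shows "above_labels u \<subseteq> above_labels v \<or> above_labels v \<subseteq> above_labels u \<or> above_labels u \<inter> above_labels v = {}"
proof (rule ccontr)
  assume n: "\<not> ?thesis"
  then obtain i where i: "i \<in> above_labels u" "i \<in> above_labels v" by blast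
  obtain l where l: "l \<in> legs G" "(adj G l, u) \<in> parents\<^sup>*" "i = lab G l" using i(1) by (rule above_labelsE)
  obtain l' where l': "l' \<in> legs G" "(adj G l', v) \<in> parents\<^sup>*" "i = lab G l'" using i(2) by (rule above_labelsE)
  have "l' = l" using lab_inj[OF l'(1) l(1)] l l' by simp
  then have "(u, v) \<in> parents\<^sup>* \<or> (v, u) \<in> parents\<^sup>*" using parents_linear[OF l(2)] l'(2) by simp
  then show False using above_mono n by blast
qed

lemma leg_labels: "lab G ` (legs G - {root_flag G}) = {1..n}"
proof -
  have b: "inj_on (lab G) (legs G)" "lab G ` legs G = {0..n}" using st by (auto simp: stable_tree_def bij_betw_def)
  have "lab G ` (legs G - {root_flag G}) = lab G ` legs G - lab G ` {root_flag G}"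
    by (rule inj_on_image_set_diff[OF b(1)]) (use root_facts(1) in auto)
  then show ?thesis using b(2) root_facts(2) by auto
qed

lemma above_base: "above_labels base = {1..n}"
proof -
  have "{l \<in> legs G. l \<noteq> root_flag G \<and> (adj G l, base) \<in> parents\<^sup>*} = legs G - {root_flag G}"
    using parents_base graph_facts(4) by (auto simp: legs_def)
  then show ?thesis using leg_labels by (simp add: above_labels_def)
qed

section \<open>The hierarchy of a stable tree\<close>

definition tree_hier :: "nat set set" where
  "tree_hier = above_labels ` nodes"

lemma insert_tree_hier: "insert {1..n} tree_hier = above_labels ` verts G"
proof -
  have "verts G = insert base nodes" using base_vert by (auto simp: nodes_def)
  then show ?thesis using above_base by (simp add: tree_hier_def)
qed

lemma nodes_verts: "v \<in> nodes \<Longrightarrow> v \<in> verts G"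
  by (simp add: nodes_def)

lemma hier_tree_hier: "hier n tree_hier"
proof -
  have top: "X \<subseteq> {1..n}" "2 \<le> card X" if X: "X \<in> tree_hier" for X
  proof -
    obtain v where v: "v \<in> nodes" "X = above_labels v" using X by (auto simp: tree_hier_def)
    show "X \<subseteq> {1..n}" using above_mono[OF parents_base[OF nodes_verts[OF v(1)]]] above_base v by simp
    show "2 \<le> card X" using card_above[OF nodes_verts[OF v(1)]] v by simp
  qed
  have "{1..n} \<notin> tree_hier"
  proof
    assume "{1..n} \<in> tree_hier"
    then obtain v where "v \<in> nodes" "above_labels v = above_labels base" using above_base by (auto simp: tree_hier_def)
    then show False using above_inj[of v base] base_vert by (simp add: nodes_def)
  qed
  moreover have "laminar tree_hier"
    unfolding laminar_def tree_hier_def using above_laminar nodes_verts by blast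
  moreover have "2 \<le> n" using card_above[OF base_vert] above_base by simp
  ultimately show ?thesis using top by (auto simp: hier_def forest_def)
qed

lemma par_node:
  assumes u: "u \<in> nodes"
  shows "par n tree_hier (above_labels u) = above_labels (parent u)"
proof (rule par_eqI)
  show "above_labels (parent u) \<in> insert {1..n} tree_hier"
    unfolding insert_tree_hier using upflag(4)[OF u] by (rule imageI)
  show "above_labels u \<subset> above_labels (parent u)" by (rule above_strict[OF u])
  fix Y assume Y: "Y \<in> insert {1..n} tree_hier" "above_labels u \<subset> Y"
  then obtain w where w: "w \<in> verts G" "Y = above_labels w" unfolding insert_tree_hier by blast
  then have "(u, w) \<in> parents\<^sup>*" "u \<noteq> w" using Y(2) above_subset_iff[OF nodes_verts[OF u] w(1)] by auto
  then show "above_labels (parent u) \<subseteq> Y" using parents_step above_mono w(2) by blast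
qed

lemma par_leg:
  assumes l: "l \<in> legs G" "l \<noteq> root_flag G"
  shows "par n tree_hier {lab G l} = above_labels (adj G l)"
proof (rule par_eqI)
  have v: "adj G l \<in> verts G" using graph_facts(4) l by (simp add: legs_def)
  show "above_labels (adj G l) \<in> insert {1..n} tree_hier"
    unfolding insert_tree_hier using v by (rule imageI)
  have "lab G l \<in> above_labels (adj G l)" using above_labelsI[OF l] by simp
  then show "{lab G l} \<subset> above_labels (adj G l)" using card_above[OF v] by (cases "above_labels (adj G l) = {lab G l}") auto
  fix Y assume Y: "Y \<in> insert {1..n} tree_hier" "{lab G l} \<subset> Y"
  then obtain w where w: "w \<in> verts G" "Y = above_labels w" unfolding insert_tree_hier by blast
  then have "lab G l \<in> above_labels w" using Y(2) by blast
  then obtain l' where "l' \<in> legs G" "(adj G l', w) \<in> parents\<^sup>*" "lab G l = lab G l'" by (rule above_labelsE)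
  then have "(adj G l, w) \<in> parents\<^sup>*" using lab_inj[OF l(1)] by simp
  then show "above_labels (adj G l) \<subseteq> Y" using above_mono w(2) by blast
qed

definition flag_code :: "'f \<Rightarrow> nat set \<times> bool" where
  "flag_code f = (if f = outflag (adj G f) then (above_labels (adj G f), True) else (in_labels f, False))"

lemma flag_code_simps:
  "flag_code (root_flag G) = ({1..n}, True)"
  "v \<in> nodes \<Longrightarrow> flag_code (upflag v) = (above_labels v, True)"
  "l \<in> legs G \<Longrightarrow> l \<noteq> root_flag G \<Longrightarrow> flag_code l = ({lab G l}, False)"
  "v \<in> nodes \<Longrightarrow> flag_code (invol G (upflag v)) = (above_labels v, False)"
proof -
  show "flag_code (root_flag G) = ({1..n}, True)"
    using above_base by (simp add: flag_code_def outflag_def base_def)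
  show "flag_code (upflag v) = (above_labels v, True)" if v: "v \<in> nodes"
    using upflag(2)[OF v] v by (simp add: flag_code_def outflag_def nodes_def)
  show "flag_code l = ({lab G l}, False)" if l: "l \<in> legs G" "l \<noteq> root_flag G"
  proof -
    have "adj G l \<in> verts G" using graph_facts(4) l by (simp add: legs_def)
    then have "l \<noteq> outflag (adj G l)" using l not_leg(1)[of "adj G l"] by (auto simp: outflag_def nodes_def)
    then show ?thesis using l by (simp add: flag_code_def in_labels_def)
  qed
  show "flag_code (invol G (upflag v)) = (above_labels v, False)" if v: "v \<in> nodes"
  proof -
    let ?f = "invol G (upflag v)"
    have a: "adj G ?f = parent v" by (simp add: parent_def)
    have "?f \<noteq> outflag (parent v)" using invol_upflag_ins[OF v] by (simp add: ins_def)
    then show ?thesis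
      using not_leg(2)[OF v] upflag(1,2)[OF v] graph_facts(6) a by (simp add: flag_code_def in_labels_def)
  qed
qed

text \<open>Both sides are matched flag by flag according to \<open>flag_cases\<close>: the root,
  the other legs, and the output and input half of each edge. The resulting code reduces questions
  about stable trees to \<open>canon\<close>.\<close>

lemma stable_tree_iso_canon: "graph_iso above_labels flag_code G (canon n tree_hier)"
proof -
  note h = hier_tree_hier
  have mem: "above_labels v \<in> tree_hier" if "v \<in> nodes" for v using that by (simp add: tree_hier_def)
  have lab_range: "lab G l \<in> {1..n}" if "l \<in> legs G" "l \<noteq> root_flag G" for l using leg_labels that by blast
  have sg: "{lab G l} \<in> singles n" "{lab G l} \<notin> tree_hier" if "l \<in> legs G" "l \<noteq> root_flag G" for l
  proof -
    show "{lab G l} \<in> singles n" using lab_range[OF that] by (simp add: singles_def)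
    then show "{lab G l} \<notin> tree_hier" using not_singles[OF h] by blast
  qed
  have nb: "above_labels v \<noteq> {1..n}" if "v \<in> nodes" for v using mem[OF that] h by (auto simp: hier_def)
  have ns: "above_labels v \<noteq> {i}" if "v \<in> nodes" for v i using hier_vertex(5)[OF h insertI2[OF mem[OF that]]] .
  have ai: "above_labels v = above_labels w \<longleftrightarrow> v = w" if "v \<in> nodes" "w \<in> nodes" for v w
    using above_inj[OF that[THEN nodes_verts]] by blast
  have "inj_on flag_code (flags G)"
  proof (rule inj_onI)
    fix f f' assume f: "f \<in> flags G" "f' \<in> flags G" "flag_code f = flag_code f'"
    show "f = f'" using f(1)
    proof (cases rule: flag_cases)
      case root': root
      show ?thesis using f(2) by (cases rule: flag_cases) (use root' f(3) flag_code_simps nb in fastforce)+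
    next
      case leg': leg
      show ?thesis using f(2) by (cases rule: flag_cases) (use leg' f(3) flag_code_simps lab_inj ns ns[THEN not_sym] in auto)
    next
      case up': (up v)
      show ?thesis using f(2) by (cases rule: flag_cases) (use up' f(3) flag_code_simps ai nb nb[THEN not_sym] in auto)
    next
      case down': (down v)
      show ?thesis using f(2) by (cases rule: flag_cases) (use down' f(3) flag_code_simps ai ns ns[THEN not_sym] in auto)
    qed
  qed
  moreover have "flag_code ` flags G = flags (canon n tree_hier)"
  proof (intro equalityI subsetI)
    fix x assume "x \<in> flag_code ` flags G"
    then obtain f where f: "f \<in> flags G" "x = flag_code f" by blast
    show "x \<in> flags (canon n tree_hier)" using f(1)
      by (cases rule: flag_cases) (use f(2) flag_code_simps mem sg in \<open>auto simp: inputs_def\<close>)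
  next
    fix x assume x: "x \<in> flags (canon n tree_hier)"
    obtain X b where X: "x = (X, b)" by (cases x)
    consider "b" "X = {1..n}" | v where "b" "v \<in> nodes" "X = above_labels v"
      | v where "\<not> b" "v \<in> nodes" "X = above_labels v" | i where "\<not> b" "i \<in> {1..n}" "X = {i}"
      using x X by (cases b) (auto simp: inputs_def tree_hier_def singles_def)
    then show "x \<in> flag_code ` flags G"
    proof cases
      case 1
      then have "x = flag_code (root_flag G)" using X flag_code_simps(1) by simp
      then show ?thesis using root_facts(4) by (rule image_eqI)
    next
      case (2 v)
      then have "x = flag_code (upflag v)" using X flag_code_simps(2) by simp
      then show ?thesis using upflag(1)[OF 2(2)] by (rule image_eqI)
    next
      case (3 v)
      then have "x = flag_code (invol G (upflag v))" using X flag_code_simps(4) by simp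
      then show ?thesis using upflag(5)[OF 3(2)] by (rule image_eqI)
    next
      case (4 i)
      then have "i \<in> lab G ` (legs G - {root_flag G})" using leg_labels by simp
      then obtain l where l: "l \<in> legs G" "l \<noteq> root_flag G" "lab G l = i" by blast
      have "x = flag_code l" using X flag_code_simps(3)[OF l(1,2)] l(3) 4 by simp
      moreover have "l \<in> flags G" using l(1) by (simp add: legs_def)
      ultimately show ?thesis by (rule image_eqI)
    qed
  qed
  ultimately have "bij_betw flag_code (flags G) (flags (canon n tree_hier))" by (simp add: bij_betw_def)
  moreover have "bij_betw above_labels (verts G) (verts (canon n tree_hier))"
    unfolding bij_betw_def using above_inj insert_tree_hier by (auto simp: inj_on_def)
  moreover have "adj (canon n tree_hier) (flag_code f) = above_labels (adj G f) \<and>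
      invol (canon n tree_hier) (flag_code f) = flag_code (invol G f)" if f: "f \<in> flags G" for f
    using f
  proof (cases rule: flag_cases)
    case root
    have "invol G f = f" using root stable_root(1)[OF st] by (simp add: legs_def)
    moreover have "{1..n} \<notin> tree_hier" using h by (simp add: hier_def)
    ultimately show ?thesis using root flag_code_simps(1) above_base by (simp add: base_def)
  next
    case leg
    have "invol G f = f" using leg by (simp add: legs_def)
    then show ?thesis using leg flag_code_simps(3) par_leg sg by simp
  next
    case (up v)
    then show ?thesis using flag_code_simps(2,4) upflag(2) mem by simp
  next
    case (down v)
    then show ?thesis using flag_code_simps(2,4)[OF down(1)] upflag(1)[OF down(1)] mem[OF down(1)] par_node[OF down(1)] graph_facts(6)
      by (simp add: parent_def)
  qed
  moreover have "lab (canon n tree_hier) (flag_code l) = lab G l" if l: "l \<in> legs G" for l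
    using l flag_code_simps(1,3) root_facts(2) by (cases "l = root_flag G") simp_all
  ultimately show ?thesis unfolding graph_iso_def by blast
qed

end

section \<open>Trees coded by hierarchies\<close>

text \<open>The code is carried as a pair of maps instead of replacing the tree by
  \<open>canon\<close>, because the same \<open>\<phi>\<close> and \<open>\<psi>\<close> then also
  code every contraction, see \<open>contract_coded\<close>.\<close>

locale coded =
  fixes n :: nat and G :: "('v, 'f) flag_graph" and F :: "nat set set"
    and \<phi> :: "'v \<Rightarrow> nat set" and \<psi> :: "'f \<Rightarrow> nat set \<times> bool"
  assumes h: "hier n F" and iso: "graph_iso \<phi> \<psi> G (canon n F)" and G: "is_flag_graph G"
begin

lemmas iso_facts = graph_isoD[OF iso]
lemmas graph_facts = flag_graphD[OF G]

lemma stable: "stable_tree n G"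
  using iso_stable_tree[OF graph_iso_inv[OF iso G] canon_stable[OF h]] .

lemma output_iff: "f \<in> flags G \<Longrightarrow> is_output G f \<longleftrightarrow> snd (\<psi> f)"
  using iso_is_output[OF iso stable, of f] iso_facts(10)[of f] canon_is_output[OF h, of "fst (\<psi> f)" "snd (\<psi> f)"]
  by (cases "\<psi> f"; cases "snd (\<psi> f)") auto

lemma input_iff: "is_input G f \<longleftrightarrow> f \<in> flags G \<and> \<not> snd (\<psi> f)"
  using output_iff[of f] by (auto simp: is_input_def)

lemma input_code:
  assumes "is_input G f"
  shows "\<psi> f = (clus G f, False)" "clus G f \<in> inputs n F"
proof -
  have f: "f \<in> flags G" "\<not> snd (\<psi> f)" using assms input_iff by auto
  then obtain X where X: "\<psi> f = (X, False)" by (cases "\<psi> f") auto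
  have "X \<in> inputs n F" using iso_facts(10)[OF f(1)] X by simp
  moreover from this have "clus G f = X"
    using iso_clus[OF iso stable f(1)] X canon_clus[OF h] by simp
  ultimately show "\<psi> f = (clus G f, False)" "clus G f \<in> inputs n F" using X by auto
qed

lemma clus_inj: "is_input G f \<Longrightarrow> is_input G f' \<Longrightarrow> clus G f = clus G f' \<Longrightarrow> f = f'"
  using input_code(1)[of f] input_code(1)[of f'] inj_onD[OF iso_facts(7), of f f'] is_input_flags by metis

lemma input_ex: "X \<in> inputs n F \<Longrightarrow> \<exists>f. is_input G f \<and> clus G f = X"
proof -
  assume X: "X \<in> inputs n F"
  then have "(X, False) \<in> flags (canon n F)" by simp
  then obtain f where f: "f \<in> flags G" "(X, False) = \<psi> f" using iso_facts(12) by blast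
  then have "is_input G f" using input_iff by (metis snd_conv)
  then show ?thesis using input_code(1) f(2) by (metis fst_conv)
qed

lemma adj_input: "is_input G f \<Longrightarrow> \<phi> (adj G f) = par n F (clus G f)"
  using iso_facts(3)[OF is_input_flags] input_code(1) by (metis canon_simps(5))

text \<open>For \<open>v\<close> the end vertex at which an edge is an output, the flags on the left
  form the index set \<open>B\<close> of \<open>edge_bdry\<close>, turned here into the children of
  a vertex of the hierarchy.\<close>

lemma kids_clus:
  assumes v: "v \<in> verts G"
  shows "clus G ` {b. is_input G b \<and> adj G b = v} = kids n F (\<phi> v)"
proof (intro equalityI subsetI)
  fix X assume "X \<in> clus G ` {b. is_input G b \<and> adj G b = v}"
  then show "X \<in> kids n F (\<phi> v)" using adj_input input_code(2) by (auto simp: kids_def)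
next
  fix X assume X: "X \<in> kids n F (\<phi> v)"
  then have "X \<in> inputs n F" by (simp add: kids_def)
  then obtain f where f: "is_input G f" "clus G f = X" using input_ex by blast
  then have "\<phi> (adj G f) = \<phi> v" using adj_input X by (simp add: kids_def)
  then have "adj G f = v" using inj_onD[OF iso_facts(6)] v graph_facts(4)[OF is_input_flags[OF f(1)]] by blast
  then show "X \<in> clus G ` {b. is_input G b \<and> adj G b = v}" using f by blast
qed

section \<open>Edges and contraction in coded trees\<close>

lemma edge_ends:
  assumes e: "e \<in> edges G"
  shows "eclus G e \<in> F" "in_end G e \<in> flags G" "out_end G e \<in> flags G" "e = {out_end G e, in_end G e}"
    "\<psi> (out_end G e) = (eclus G e, True)" "\<psi> (in_end G e) = (eclus G e, False)" "is_input G (in_end G e)"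
    "e \<subseteq> flags G"
proof -
  have "\<psi> ` e \<in> edges (canon n F)" using iso_edges(1)[OF iso G] e by simp
  then obtain X where X: "X \<in> F" "\<psi> ` e = {(X, True), (X, False)}" unfolding canon_edges[OF h] by blast
  have ef: "e \<subseteq> flags G" using e graph_facts(5) by (auto simp: edges_def)
  obtain o' i' where oi: "o' \<in> e" "i' \<in> e" "\<psi> o' = (X, True)" "\<psi> i' = (X, False)"
    using X(2) by (metis image_iff insertI1 insertI2)
  have e2: "e = {o', i'}"
  proof
    show "e \<subseteq> {o', i'}"
    proof
      fix f assume f: "f \<in> e"
      then have "\<psi> f = \<psi> o' \<or> \<psi> f = \<psi> i'" using X(2) oi by auto
      then show "f \<in> {o', i'}" using inj_onD[OF iso_facts(7)] ef f oi by blast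
    qed
  qed (use oi in auto)
  have fl: "o' \<in> flags G" "i' \<in> flags G" using ef oi by auto
  have io: "is_input G i'" "\<not> is_input G o'" "is_output G o'" "\<not> is_output G i'"
    using input_iff output_iff fl oi by auto
  have ie: "in_end G e = i'" unfolding in_end_def by (rule the_equality) (use io e2 in auto)
  have oe: "out_end G e = o'" unfolding out_end_def by (rule the_equality) (use io e2 in auto)
  have ec: "eclus G e = X" using input_code(1)[OF io(1)] oi by (simp add: eclus_def ie)
  show "eclus G e \<in> F" "in_end G e \<in> flags G" "out_end G e \<in> flags G" "e = {out_end G e, in_end G e}"
    "\<psi> (out_end G e) = (eclus G e, True)" "\<psi> (in_end G e) = (eclus G e, False)" "is_input G (in_end G e)"
    "e \<subseteq> flags G"
    using X oi fl e2 ef io unfolding ie oe ec by auto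
qed

lemma eclus_bij: "bij_betw (eclus G) (edges G) F"
proof -
  have "inj_on (eclus G) (edges G)"
  proof (rule inj_onI)
    fix e e' assume e: "e \<in> edges G" "e' \<in> edges G" "eclus G e = eclus G e'"
    note a = edge_ends[OF e(1)] and b = edge_ends[OF e(2)]
    have "out_end G e = out_end G e'" "in_end G e = in_end G e'"
      using inj_onD[OF iso_facts(7)] a(2,3,5,6) b(2,3,5,6) e(3) by metis+
    then show "e = e'" using a(4) b(4) by metis
  qed
  moreover have "eclus G ` edges G = F"
  proof (intro equalityI subsetI)
    fix X assume X: "X \<in> F"
    then have "{(X, True), (X, False)} \<in> edges (canon n F)" unfolding canon_edges[OF h] by blast
    then obtain e where e: "e \<in> edges G" "\<psi> ` e = {(X, True), (X, False)}" unfolding iso_edges(1)[OF iso G] by auto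
    have "in_end G e \<in> e" using edge_ends(4)[OF e(1)] by blast
    then have "\<psi> (in_end G e) \<in> {(X, True), (X, False)}" using e(2) by blast
    then have "eclus G e = X" using edge_ends(6)[OF e(1)] by auto
    then show "X \<in> eclus G ` edges G" using e(1) by blast
  qed (use edge_ends(1) in blast)
  ultimately show ?thesis by (simp add: bij_betw_def)
qed

lemma adj_ends:
  assumes e: "e \<in> edges G"
  shows "\<phi> (adj G (out_end G e)) = eclus G e" "\<phi> (adj G (in_end G e)) = par n F (eclus G e)"
    "adj G (out_end G e) \<in> verts G" "adj G (in_end G e) \<in> verts G"
    "adj G (in_end G e) \<noteq> adj G (out_end G e)"
proof -
  note a = edge_ends[OF e]
  show *: "\<phi> (adj G (out_end G e)) = eclus G e" "\<phi> (adj G (in_end G e)) = par n F (eclus G e)"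
    using iso_facts(3)[OF a(3)] iso_facts(3)[OF a(2)] a(5,6) by simp_all
  show "adj G (out_end G e) \<in> verts G" "adj G (in_end G e) \<in> verts G" using graph_facts(4) a(2,3) by auto
  have "eclus G e \<in> inputs n F" using a(1) by (simp add: inputs_def)
  then show "adj G (in_end G e) \<noteq> adj G (out_end G e)" using * par(2)[OF h] by force
qed

lemma merge_code:
  assumes e: "e \<in> edges G" and v: "v \<in> verts G"
  shows "\<phi> (merge_vert G e v) = (if \<phi> v = eclus G e then par n F (eclus G e) else \<phi> v)"
proof (cases "v = adj G (out_end G e)")
  case True
  then show ?thesis using adj_ends(1,2)[OF e] by (simp add: merge_vert_def)
next
  case False
  then have "\<phi> v \<noteq> eclus G e"
    using inj_onD[OF iso_facts(6) _ v adj_ends(3)[OF e]] adj_ends(1)[OF e] by metis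
  then show ?thesis using False by (simp add: merge_vert_def)
qed

lemma contract_flag_graph:
  assumes e: "e \<in> edges G"
  shows "is_flag_graph (contract G e)"
proof -
  note a = edge_ends[OF e]
  have "invol G f \<notin> e" if f: "f \<in> flags G - e" for f
  proof
    assume "invol G f \<in> e"
    moreover obtain f' where f': "f' \<in> flags G" "e = {f', invol G f'}" using e by (auto simp: edges_def)
    ultimately have "invol G (invol G f) \<in> e" using graph_facts(6)[OF f'(1)] by auto
    then show False using f graph_facts(6) by auto
  qed
  then show ?thesis using graph_facts by (auto simp: is_flag_graph_def contract_def)
qed

text \<open>The merged vertex keeps the name of the vertex at which the edge is an input, whose code
  is the parent of the contracted set. By \<open>par_remove\<close> this is what removing the set
  from the hierarchy does, so the code maps can stay the same.\<close>

lemma contract_iso: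
  assumes e: "e \<in> edges G"
  shows "graph_iso \<phi> \<psi> (contract G e) (canon n (F - {eclus G e}))"
proof -
  note a = edge_ends[OF e] and ad = adj_ends[OF e]
  let ?X = "eclus G e" and ?F = "F - {eclus G e}"
  have top: "?X \<noteq> {1..n}" using a(1) h by (auto simp: hier_def)
  have "merge_vert G e ` verts G = verts G - {adj G (out_end G e)}"
    using ad(3,4,5) by (auto simp: merge_vert_def)
  then have V: "verts (contract G e) = verts G - {adj G (out_end G e)}" by (simp add: contract_def)
  have Fl: "flags (contract G e) = flags G - e" by (simp add: contract_def)
  have "\<phi> ` verts (contract G e) = \<phi> ` verts G - \<phi> ` {adj G (out_end G e)}"
    unfolding V by (rule inj_on_image_set_diff[OF iso_facts(6)]) (use ad(3) in auto)
  then have "\<phi> ` verts (contract G e) = verts (canon n ?F)" using iso_facts(9) ad(1) top by auto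
  moreover have "inj_on \<phi> (verts (contract G e))" unfolding V by (rule inj_on_subset[OF iso_facts(6)]) auto
  ultimately have 1: "bij_betw \<phi> (verts (contract G e)) (verts (canon n ?F))" by (simp add: bij_betw_def)
  have pe: "\<psi> ` e = {(?X, True), (?X, False)}" using a(4,5,6) by (metis image_empty image_insert)
  have "\<psi> ` flags (contract G e) = \<psi> ` flags G - \<psi> ` e"
    unfolding Fl by (rule inj_on_image_set_diff[OF iso_facts(7)]) (use a(8) in auto)
  also have "\<dots> = flags (canon n ?F)"
    unfolding iso_facts(8) pe canon_flags inputs_remove[OF h a(1)] using top by auto
  finally have 2: "bij_betw \<psi> (flags (contract G e)) (flags (canon n ?F))"
    unfolding bij_betw_def using inj_on_subset[OF iso_facts(7)] Fl by auto
  have 3: "adj (canon n ?F) (\<psi> f) = \<phi> (adj (contract G e) f) \<and> invol (canon n ?F) (\<psi> f) = \<psi> (invol (contract G e) f)"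
    if f: "f \<in> flags (contract G e)" for f
  proof -
    have f': "f \<in> flags G" "f \<notin> e" using f Fl by auto
    obtain Y b where Y: "\<psi> f = (Y, b)" by (cases "\<psi> f")
    have "\<psi> f \<notin> \<psi> ` e" using inj_on_image_mem_iff[OF iso_facts(7) f'(1) a(8)] f'(2) by simp
    then have YX: "Y \<noteq> ?X" unfolding pe Y by (cases b) auto
    have m: "\<phi> (adj (contract G e) f) = (if \<phi> (adj G f) = ?X then par n F ?X else \<phi> (adj G f))"
      using merge_code[OF e graph_facts(4)[OF f'(1)]] by (simp add: contract_def)
    have "adj (canon n ?F) (\<psi> f) = \<phi> (adj (contract G e) f)"
    proof (cases b)
      case True
      then show ?thesis using m iso_facts(3)[OF f'(1)] Y YX by simp
    next
      case False
      have Yi: "Y \<in> inputs n F" using iso_facts(10)[OF f'(1)] Y False by simp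
      have "\<phi> (adj G f) = par n F Y" using iso_facts(3)[OF f'(1)] Y False by simp
      then show ?thesis using m par_remove[OF h a(1) Yi YX] Y False by simp
    qed
    moreover have "invol (canon n ?F) (\<psi> f) = \<psi> (invol (contract G e) f)"
      using iso_facts(4)[OF f'(1)] Y YX by (simp add: contract_def)
    ultimately show ?thesis ..
  qed
  have 4: "lab (canon n ?F) (\<psi> f) = lab (contract G e) f" if f: "f \<in> legs (contract G e)" for f
  proof -
    have "f \<in> legs G" using f by (auto simp: legs_def contract_def)
    then show ?thesis using iso_facts(5) by (simp add: canon_def contract_def)
  qed
  show ?thesis unfolding graph_iso_def using 1 2 3 4 by blast
qed

lemma contract_coded:
  assumes e: "e \<in> edges G"
  shows "coded n (contract G e) (F - {eclus G e}) \<phi> \<psi>"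
  using hier_remove[OF h] contract_iso[OF e] contract_flag_graph[OF e] by (rule coded.intro)

end

lemma stable_tree_coded:
  fixes G :: "('v, 'f) flag_graph"
  assumes "stable_tree n G"
  shows "\<exists>F \<phi> \<psi>. coded n G F \<phi> \<psi>"
  using hier_tree_hier[OF assms] stable_tree_iso_canon[OF assms] stable_flag_graph[OF assms]
  by (blast intro: coded.intro)

section \<open>From oriented Stirling trees to cells\<close>

definition encode :: "oriented \<Rightarrow> nat set list \<times> nat set list" where
  "encode = (\<lambda>(S, es, as). (map (eclus (st_tree S)) es, map (clus (st_tree S)) as))"

definition cell_of :: "oriented \<Rightarrow> nat set set \<times> nat set set" where
  "cell_of g = (set (fst (encode g)), set (snd (encode g)))"

text \<open>The comparison map from generators to cells. It commutes with the boundaries, is onto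
  for \<open>k \<ge> 2\<close>, and its kernel consists of the relations, so homology can be
  computed on cells.\<close>

definition to_cells :: "(oriented \<Rightarrow>\<^sub>0 rat) \<Rightarrow> (nat set set \<times> nat set set \<Rightarrow>\<^sub>0 rat)" where
  "to_cells = lin (\<lambda>g. orient (encode g))"

lemma oriented_treesD:
  assumes "(S, es, as) \<in> oriented_trees n k j"
  shows "stable_tree n (st_tree S)" "st_vert S \<in> verts (st_tree S)"
    "\<And>a. a \<in> st_alt S \<Longrightarrow> is_input (st_tree S) a" "\<And>a. a \<in> st_alt S \<Longrightarrow> adj (st_tree S) a = st_vert S"
    "card (st_alt S) = k" "2 \<le> k" "int (card (edges (st_tree S))) + int k = j"
    "distinct es" "set es = edges (st_tree S)" "distinct as" "set as = st_alt S" "int (length es) + int k = j"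
    "finite (st_alt S)"
proof -
  show "stable_tree n (st_tree S)" "st_vert S \<in> verts (st_tree S)"
    "\<And>a. a \<in> st_alt S \<Longrightarrow> is_input (st_tree S) a" "\<And>a. a \<in> st_alt S \<Longrightarrow> adj (st_tree S) a = st_vert S"
    "card (st_alt S) = k" and k: "2 \<le> k" and c: "int (card (edges (st_tree S))) + int k = j"
    and d: "distinct es" "set es = edges (st_tree S)" "distinct as" "set as = st_alt S"
    using assms by (auto simp: oriented_trees_def is_stirling_tree_def)
  show "int (length es) + int k = j" using c d distinct_card[of es] by simp
  show "finite (st_alt S)" using d(4) by (metis finite_set)
qed

lemma oriented_treesI:
  assumes "is_stirling_tree n k S" "distinct es" "set es = edges (st_tree S)" "distinct as" "set as = st_alt S"
    "int (length es) + int k = j"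
  shows "(S, es, as) \<in> oriented_trees n k j"
  using assms distinct_card[of es] by (simp add: oriented_trees_def)

lemma encode_cells:
  assumes g: "(S, es, as) \<in> oriented_trees n k j" and cd: "coded n (st_tree S) F \<phi> \<psi>"
  shows "encode (S, es, as) \<in> list_cells n k" "cell_of (S, es, as) = (F, clus (st_tree S) ` st_alt S)"
    "length (fst (encode (S, es, as))) = length es"
proof -
  interpret G: coded n "st_tree S" F \<phi> \<psi> by (rule cd)
  note o = oriented_treesD[OF g]
  let ?G = "st_tree S"
  have e: "set (map (eclus ?G) es) = F" "distinct (map (eclus ?G) es)"
    using G.eclus_bij o(8,9) by (auto simp: bij_betw_def distinct_map)
  have inj: "inj_on (clus ?G) (st_alt S)" using G.clus_inj o(3) by (auto simp: inj_on_def)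
  then have a: "set (map (clus ?G) as) = clus ?G ` st_alt S" "distinct (map (clus ?G) as)"
    using o(10,11) by (auto simp: distinct_map)
  have "(F, clus ?G ` st_alt S) \<in> cells n k"
    unfolding cells_def
  proof (clarify, intro conjI)
    show "hier n F" by (rule G.h)
    show "clus ?G ` st_alt S \<subseteq> inputs n F" using G.input_code(2) o(3) by blast
    show "card (clus ?G ` st_alt S) = k" using card_image[OF inj] o(5) by simp
    show "\<exists>P. \<forall>X\<in>clus ?G ` st_alt S. par n F X = P"
      using G.adj_input o(3,4) by (intro exI[of _ "\<phi> (st_vert S)"]) (metis imageE)
  qed
  then show "encode (S, es, as) \<in> list_cells n k" "cell_of (S, es, as) = (F, clus ?G ` st_alt S)"
    "length (fst (encode (S, es, as))) = length es"
    using e a by (auto simp: encode_def list_cells_def cell_of_def)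
qed

lemma oriented_coded:
  assumes "(S, es, as) \<in> oriented_trees n k j"
  shows "\<exists>F \<phi> \<psi>. coded n (st_tree S) F \<phi> \<psi>"
  using stable_tree_coded[OF oriented_treesD(1)[OF assms]] .

lemma encode_list_cells: "g \<in> oriented_trees n k j \<Longrightarrow> encode g \<in> list_cells n k"
  using oriented_coded encode_cells(1) by (metis prod_cases3)

subsection \<open>Contraction of an edge\<close>

lemma edges_contract:
  assumes G: "is_flag_graph G" and e: "e \<in> edges G"
  shows "edges (contract G e) = edges G - {e}"
proof -
  note g = flag_graphD[OF G]
  obtain f0 where f0: "f0 \<in> flags G" "invol G f0 \<noteq> f0" "e = {f0, invol G f0}" using e by (auto simp: edges_def)
  have *: "{f, invol G f} = e \<longleftrightarrow> f \<in> e" if "f \<in> flags G" for f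
    using f0 g(6) that by auto
  show ?thesis
  proof (intro equalityI subsetI)
    fix e' assume "e' \<in> edges (contract G e)"
    then obtain f where f: "f \<in> flags G" "f \<notin> e" "invol G f \<noteq> f" "e' = {f, invol G f}"
      by (auto simp: edges_def contract_def)
    then have "e' \<in> edges G" "e' \<noteq> e" using * by (auto simp: edges_def)
    then show "e' \<in> edges G - {e}" by blast
  next
    fix e' assume e': "e' \<in> edges G - {e}"
    then obtain f where f: "f \<in> flags G" "invol G f \<noteq> f" "e' = {f, invol G f}" by (auto simp: edges_def)
    then have "f \<notin> e" using * e' by blast
    then show "e' \<in> edges (contract G e)" using f by (auto simp: edges_def contract_def)
  qed
qed

context coded
begin

lemma input_of_edge:
  assumes e: "e \<in> edges G" and f: "f \<in> e" "is_input G f"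
  shows "f = in_end G e"
proof (rule ccontr)
  note a = edge_ends[OF e]
  assume "f \<noteq> in_end G e"
  moreover have "f \<in> {out_end G e, in_end G e}" using f(1) a(4) by (rule subst[rotated])
  ultimately have "f = out_end G e" by blast
  then show False using f(2) a(5) input_iff by simp
qed

lemma in_end_mem: "e \<in> edges G \<Longrightarrow> in_end G e \<in> e"
  using edge_ends(4) by blast

context
  fixes e assumes e: "e \<in> edges G"
begin

interpretation c: coded n "contract G e" "F - {eclus G e}" \<phi> \<psi>
  by (rule contract_coded[OF e])

text \<open>Input flags are recognised by \<open>\<psi>\<close>, which serves both for the tree and
  for its contraction; the label sets \<open>clus\<close> of inputs are read off in the same
  way.\<close>

lemma contract_input: "is_input (contract G e) f \<longleftrightarrow> is_input G f \<and> f \<notin> e"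
  unfolding input_iff c.input_iff by (auto simp: contract_def)

lemma contract_clus: "is_input G f \<Longrightarrow> f \<notin> e \<Longrightarrow> clus (contract G e) f = clus G f"
  using c.input_code(1)[of f] input_code(1)[of f] contract_input[of f] by simp

lemma contract_eclus:
  assumes e': "e' \<in> edges G" "e' \<noteq> e"
  shows "eclus (contract G e) e' = eclus G e'"
proof -
  have e'c: "e' \<in> edges (contract G e)" using e' edges_contract[OF G e] by simp
  note b = c.edge_ends(7)[OF e'c]
  have "in_end (contract G e) e' = in_end G e'"
    by (rule input_of_edge[OF e'(1) c.in_end_mem[OF e'c]]) (use b contract_input in blast)
  then show ?thesis unfolding eclus_def using contract_clus b contract_input by metis
qed

end
end

lemma map_delnth: "map f (delnth i xs) = delnth i (map f xs)"
  by (simp add: delnth_def take_map drop_map)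

text \<open>The two cases of \<open>edge_bdry\<close> become the two cases of
  \<open>alt_bdry\<close>: contraction leaves the codes of all surviving edges and inputs unchanged,
  and the alternating flag \<open>a\<close> of the edge has the same code as the edge
  itself.\<close>

lemma edge_bdry_list_term:
  assumes g: "(S, es, as) \<in> oriented_trees n k j" and i: "i < length es"
  shows "lin (\<lambda>g. Poly_Mapping.single (encode g) 1) (edge_bdry (S, es, as) i) = list_term n (encode (S, es, as)) i"
    and "Poly_Mapping.keys (edge_bdry (S, es, as) i) \<subseteq> oriented_trees n k (j - 1)"
proof -
  obtain F \<phi> \<psi> where cd: "coded n (st_tree S) F \<phi> \<psi>" using oriented_coded[OF g] by blast
  note o = oriented_treesD[OF g]
  define G where "G = st_tree S"
  define A where "A = st_alt S"
  define e where "e = es ! i"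
  define X where "X = eclus G e"
  define a where "a = in_end G e"
  define B where "B = {b. is_input G b \<and> adj G b = adj G (out_end G e)}"
  define v where "v = merge_vert G e (st_vert S)"
  define s :: rat where "s = (- 1) ^ (length es - Suc i)"
  note defs = G_def[symmetric] A_def[symmetric] e_def[symmetric] a_def[symmetric]
  interpret G: coded n G F \<phi> \<psi> unfolding G_def by (rule cd)
  have e: "e \<in> edges G" using i o(9) unfolding e_def G_def by (metis nth_mem)
  interpret C: coded n "contract G e" "F - {X}" \<phi> \<psi> unfolding X_def by (rule G.contract_coded[OF e])
  note ee = G.edge_ends[OF e] and ad = G.adj_ends[OF e]
  have A: "\<And>f. f \<in> A \<Longrightarrow> is_input G f" "\<And>f. f \<in> A \<Longrightarrow> adj G f = st_vert S" "set as = A" "distinct as" "card A = k" "finite A"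
    using o unfolding A_def G_def by auto
  have es': "delnth i es = take i es @ drop (Suc i) es" by (simp add: delnth_def)
  have des: "distinct (delnth i es)" "set (delnth i es) = edges (contract G e)"
    "int (length (delnth i es)) + int k = j - 1"
  proof -
    show "distinct (delnth i es)" using distinct_delnth[OF o(8)] .
    show "set (delnth i es) = edges (contract G e)"
      using edges_contract[OF G.G e] set_delnth[OF o(8) i] o(9) by (simp add: e_def G_def)
    show "int (length (delnth i es)) + int k = j - 1" using length_delnth[OF i] i o(12) by auto
  qed
  have Ee: "map (eclus (contract G e)) (delnth i es) = delnth i (map (eclus G) es)"
  proof -
    have "map (eclus (contract G e)) (delnth i es) = map (eclus G) (delnth i es)"
    proof (rule map_cong[OF refl])
      fix e' assume "e' \<in> set (delnth i es)"
      then have "e' \<in> edges G" "e' \<noteq> e" using des(2) edges_contract[OF G.G e] by auto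
      then show "eclus (contract G e) e' = eclus G e'" by (rule G.contract_eclus[OF e])
    qed
    then show ?thesis by (simp add: map_delnth)
  qed
  have sv: "st_vert S \<in> verts G" using o(2) G_def by simp
  have vv: "v \<in> verts (contract G e)" using sv by (simp add: contract_def v_def)
  have adjc: "adj (contract G e) f = merge_vert G e (adj G f)" for f by (simp add: contract_def)
  have st: "is_stirling_tree n k \<lparr>st_tree = contract G e, st_vert = v, st_alt = A'\<rparr>"
    if "\<And>f. f \<in> A' \<Longrightarrow> is_input G f \<and> f \<notin> e \<and> merge_vert G e (adj G f) = v" "card A' = k" for A'
    unfolding is_stirling_tree_def using C.stable vv that o(6) G.contract_input[OF e] adjc by auto
  have eX: "map (eclus G) es ! i = X" using i by (simp add: X_def e_def)
  have sE: "set (map (eclus G) es) = F" using G.eclus_bij o(9) by (simp add: bij_betw_def G_def)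
  have rhs: "list_term n (encode (S, es, as)) i
      = lin (\<lambda>as'. Poly_Mapping.single (delnth i (map (eclus G) es), as') s) (alt_bdry n F X (map (clus G) as))"
    using eX sE by (simp add: list_term_def encode_def s_def flip: G_def)
  have Xa: "X = clus G a" by (simp add: X_def a_def eclus_def)
  \<comment> \<open>Alternating flags are inputs and the edge has a single input flag, so the edge
    meets \<open>A\<close> in \<open>a\<close> or not at all.\<close>
  have aA: "e \<inter> A \<noteq> {} \<longleftrightarrow> a \<in> A"
    using G.input_of_edge[OF e] G.in_end_mem[OF e] A(1) unfolding a_def by blast
  have XA: "X \<in> set (map (clus G) as) \<longleftrightarrow> a \<in> A"
    using G.clus_inj[OF ee(7)] A(1,3) unfolding Xa a_def by auto
  have "lin (\<lambda>g. Poly_Mapping.single (encode g) 1) (edge_bdry (S, es, as) i) = list_term n (encode (S, es, as)) i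
    \<and> Poly_Mapping.keys (edge_bdry (S, es, as) i) \<subseteq> oriented_trees n k (j - 1)"
  proof (cases "a \<in> A")
    case False
    then have eA: "e \<inter> A = {}" using aA by blast
    let ?S = "\<lparr>st_tree = contract G e, st_vert = v, st_alt = A\<rparr>"
    have eb: "edge_bdry (S, es, as) i = Poly_Mapping.single (?S, delnth i es, as) s"
      using eA by (simp add: Let_def defs v_def s_def es')
    have "(?S, delnth i es, as) \<in> oriented_trees n k (j - 1)"
      by (rule oriented_treesI[OF st]) (use A des eA in \<open>auto simp: v_def\<close>)
    moreover have "map (clus (contract G e)) as = map (clus G) as"
      by (rule map_cong[OF refl], rule G.contract_clus[OF e]) (use A(1,3) eA in auto)
    then have "encode (?S, delnth i es, as) = (delnth i (map (eclus G) es), map (clus G) as)"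
      by (simp add: encode_def Ee)
    ultimately show ?thesis
      unfolding rhs eb using XA False by (simp add: alt_bdry_def)
  next
    case True
    let ?S = "\<lambda>b. \<lparr>st_tree = contract G e, st_vert = v, st_alt = insert b (A - {a})\<rparr>"
    let ?as = "\<lambda>b. map (\<lambda>x. if x = a then b else x) as"
    have eb: "edge_bdry (S, es, as) i = (\<Sum>b\<in>B. Poly_Mapping.single (?S b, delnth i es, ?as b) s)"
      using aA True by (simp add: Let_def defs v_def s_def es' B_def)
    have va: "adj G a = st_vert S" using A(2)[OF True] .
    \<comment> \<open>An edge is not a loop, so the vertex carrying \<open>a\<close> differs from
      the one absorbed and keeps its name.\<close>
    have vout: "adj G (out_end G e) \<noteq> st_vert S" using ad(5) va unfolding a_def by simp
    have vv': "v = st_vert S" unfolding v_def using vout by (simp add: merge_vert_def)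
    have Bf: "is_input G b" "b \<notin> e" "b \<notin> A" "b \<noteq> a" "merge_vert G e (adj G b) = v" if b: "b \<in> B" for b
    proof -
      show bi: "is_input G b" and "b \<notin> A" using b A(2) vout by (auto simp: B_def)
      then show "b \<noteq> a" using True by blast
      then show "b \<notin> e" using G.input_of_edge[OF e] bi unfolding a_def by blast
      show "merge_vert G e (adj G b) = v" using b va unfolding vv' a_def by (simp add: B_def merge_vert_def)
    qed
    have nota: "f \<notin> e" if "f \<in> A - {a}" for f
      using that G.input_of_edge[OF e] A(1) unfolding a_def by blast
    have ot: "(?S b, delnth i es, ?as b) \<in> oriented_trees n k (j - 1)" if b: "b \<in> B" for b
    proof (rule oriented_treesI[OF st])
      note B = Bf[OF b]
      show "is_input G f \<and> f \<notin> e \<and> merge_vert G e (adj G f) = v" if f: "f \<in> insert b (A - {a})" for f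
        using f B nota A(1,2) by (auto simp: v_def)
      show "card (insert b (A - {a})) = k"
        using B(3) A(5,6) True by (metis DiffD1 card_Suc_Diff1 card_insert_disjoint finite_Diff)
      show "distinct (?as b)" using A(3,4) B(3) by (auto simp: distinct_map inj_on_def)
      show "set (?as b) = st_alt (?S b)" using A(3) True by auto
    qed (use des in auto)
    have en: "encode (?S b, delnth i es, ?as b) = (delnth i (map (eclus G) es), map (repl X (clus G b)) (map (clus G) as))"
      if b: "b \<in> B" for b
    proof -
      note B = Bf[OF b]
      have "map (clus (contract G e)) (?as b) = map (repl X (clus G b)) (map (clus G) as)"
        unfolding map_map
      proof (rule map_cong[OF refl])
        fix x assume x: "x \<in> set as"
        show "(clus (contract G e) \<circ> (\<lambda>x. if x = a then b else x)) x = (repl X (clus G b) \<circ> clus G) x"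
        proof (cases "x = a")
          case True
          then show ?thesis using G.contract_clus[OF e B(1,2)] by (simp add: repl_def Xa)
        next
          case False
          then have "clus G x \<noteq> X" using G.clus_inj[OF _ ee(7)] x A(1,3) unfolding Xa a_def by blast
          then show ?thesis using False G.contract_clus[OF e] nota[of x] x A(1,3) by (simp add: repl_def)
        qed
      qed
      then show ?thesis by (simp add: encode_def Ee)
    qed
    have "lin (\<lambda>g. Poly_Mapping.single (encode g) 1) (edge_bdry (S, es, as) i)
        = (\<Sum>b\<in>B. Poly_Mapping.single (delnth i (map (eclus G) es), map (repl X (clus G b)) (map (clus G) as)) s)"
      unfolding eb lin_sum by (rule sum.cong[OF refl]) (simp add: en del: map_map)
    \<comment> \<open>Distinct input flags have distinct label sets, so the sum over flags becomes a
      sum over children.\<close>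
    also have "\<dots> = (\<Sum>b\<in>clus G ` B. Poly_Mapping.single (delnth i (map (eclus G) es), map (repl X b) (map (clus G) as)) s)"
      by (subst sum.reindex) (use G.clus_inj Bf(1) in \<open>auto simp: inj_on_def simp del: map_map\<close>)
    also have "clus G ` B = kids n F X"
      unfolding B_def G.kids_clus[OF ad(3)] ad(1) X_def ..
    also have "(\<Sum>b\<in>kids n F X. Poly_Mapping.single (delnth i (map (eclus G) es), map (repl X b) (map (clus G) as)) s)
        = list_term n (encode (S, es, as)) i"
      unfolding rhs alt_bdry_def using XA True by (simp add: lin_sum del: map_map set_map)
    finally show ?thesis unfolding eb using ot by (intro conjI keys_sum_subset) (auto split: if_splits)
  qed
  then show "lin (\<lambda>g. Poly_Mapping.single (encode g) 1) (edge_bdry (S, es, as) i) = list_term n (encode (S, es, as)) i"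
    "Poly_Mapping.keys (edge_bdry (S, es, as) i) \<subseteq> oriented_trees n k (j - 1)" by blast+
qed

lemma tree_bdry_list_bdry:
  assumes g: "g \<in> oriented_trees n k j"
  shows "lin (\<lambda>g. Poly_Mapping.single (encode g) 1) (tree_bdry g) = list_bdry n (encode g)"
    and "Poly_Mapping.keys (tree_bdry g) \<subseteq> oriented_trees n k (j - 1)"
proof -
  obtain S es as where S: "g = (S, es, as)" by (cases g)
  note g' = g[unfolded S]
  have l: "length (fst (encode g)) = length es" by (simp add: S encode_def)
  show "lin (\<lambda>g. Poly_Mapping.single (encode g) 1) (tree_bdry g) = list_bdry n (encode g)"
    unfolding tree_bdry_def list_bdry_def lin_sum l
    by (rule sum.cong) (use edge_bdry_list_term(1)[OF g'] S in auto)
  show "Poly_Mapping.keys (tree_bdry g) \<subseteq> oriented_trees n k (j - 1)"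
    unfolding tree_bdry_def using edge_bdry_list_term(2)[OF g'] S by (intro keys_sum_subset) simp
qed

lemma stirling_bdry_lin: "stirling_bdry = lin tree_bdry"
  by (rule ext) (simp add: stirling_bdry_def lin_def)

lemma stirling_bdry_gens:
  assumes c: "c \<in> stirling_gens n k j"
  shows "stirling_bdry c \<in> stirling_gens n k (j - 1)"
proof -
  have "Poly_Mapping.keys (lin tree_bdry c) \<subseteq> (\<Union>g\<in>Poly_Mapping.keys c. Poly_Mapping.keys (tree_bdry g))"
    by (rule keys_lin)
  also have "\<dots> \<subseteq> oriented_trees n k (j - 1)"
    using tree_bdry_list_bdry(2) c by (fastforce simp: stirling_gens_def)
  finally show ?thesis by (simp add: stirling_gens_def stirling_bdry_lin)
qed

lemma to_cells_bdry:
  assumes c: "c \<in> stirling_gens n k j"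
  shows "to_cells (stirling_bdry c) = lin (cell_bdry n) (to_cells c)"
proof -
  have "to_cells (stirling_bdry c) = lin (\<lambda>g. lin orient (lin (\<lambda>g. Poly_Mapping.single (encode g) 1) (tree_bdry g))) c"
    by (simp add: to_cells_def stirling_bdry_lin lin_lin)
  also have "\<dots> = lin (\<lambda>g. lin (cell_bdry n) (orient (encode g))) c"
  proof (rule lin_cong)
    fix g assume "g \<in> Poly_Mapping.keys c"
    then have g: "g \<in> oriented_trees n k j" using c by (auto simp: stirling_gens_def)
    show "lin orient (lin (\<lambda>g. Poly_Mapping.single (encode g) 1) (tree_bdry g)) = lin (cell_bdry n) (orient (encode g))"
      unfolding tree_bdry_list_bdry(1)[OF g]
      using list_bdry_orient[of "fst (encode g)" "snd (encode g)" n k] encode_list_cells[OF g] by simp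
  qed
  finally show ?thesis by (simp add: to_cells_def lin_lin)
qed

subsection \<open>The relations are the kernel\<close>

lemma subspace_gens: "chain.subspace (stirling_gens n k j)"
  unfolding stirling_gens_def by (rule subspace_supp)

lemma iso_eclus:
  assumes iso: "graph_iso \<phi> \<psi> G G'" and st: "stable_tree n G" and e: "e \<in> edges G"
  shows "eclus G' (\<psi> ` e) = eclus G e"
proof -
  obtain F \<phi>0 \<psi>0 where "coded n G F \<phi>0 \<psi>0" using stable_tree_coded[OF st] by blast
  then interpret Q: coded n G F \<phi>0 \<psi>0 .
  note ee = Q.edge_ends[OF e]
  have "in_end G' (\<psi> ` e) = \<psi> (in_end G e)"
    unfolding in_end_def[of G']
  proof (rule the_equality)
    show "\<psi> (in_end G e) \<in> \<psi> ` e \<and> is_input G' (\<psi> (in_end G e))"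
      using ee(2,4,7) iso_is_input[OF iso st] by blast
    fix x assume x: "x \<in> \<psi> ` e \<and> is_input G' x"
    then obtain f where f: "f \<in> e" "x = \<psi> f" by blast
    then have "is_input G f" using iso_is_input[OF iso st] x ee(8) by blast
    then have "f = in_end G e" by (rule Q.input_of_edge[OF e f(1)])
    then show "x = \<psi> (in_end G e)" using f by simp
  qed
  then show ?thesis using iso_clus[OF iso st ee(2)] by (simp add: eclus_def)
qed

lemma oriented_iso:
  assumes g: "(S, es, as) \<in> oriented_trees n k j" and S': "is_stirling_tree n k S'" and iso: "stirling_iso \<phi> \<psi> S S'"
  shows "(S', map (image \<psi>) es, map \<psi> as) \<in> oriented_trees n k j"
    "encode (S', map (image \<psi>) es, map \<psi> as) = encode (S, es, as)"
proof -
  note o = oriented_treesD[OF g]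
  have gi: "graph_iso \<phi> \<psi> (st_tree S) (st_tree S')" and alt: "st_alt S' = \<psi> ` st_alt S"
    using iso by (auto simp: stirling_iso_graph_iso)
  note i = graph_isoD[OF gi]
  have G: "is_flag_graph (st_tree S)" using stable_flag_graph[OF o(1)] .
  have ef: "\<Union>(edges (st_tree S)) \<subseteq> flags (st_tree S)" using flag_graphD(5)[OF G] by (auto simp: edges_def)
  have af: "st_alt S \<subseteq> flags (st_tree S)" using is_input_flags[OF o(3)] by blast
  have "inj_on (image \<psi>) (edges (st_tree S))"
    by (rule inj_on_image) (use inj_on_subset[OF i(7) ef] in simp)
  then show "(S', map (image \<psi>) es, map \<psi> as) \<in> oriented_trees n k j"
    using S' o(8-12) iso_edges(1)[OF gi G] inj_on_subset[OF i(7) af] alt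
    by (intro oriented_treesI) (simp_all add: distinct_map)
  show "encode (S', map (image \<psi>) es, map \<psi> as) = encode (S, es, as)"
    using iso_eclus[OF gi o(1)] iso_clus[OF gi o(1)] o(9,11) af by (auto simp: encode_def)
qed

lemma oriented_permute:
  assumes g: "(S, es, as) \<in> oriented_trees n k j"
    and p: "p permutes {..<length es}" and q: "q permutes {..<length as}"
  shows "(S, permute_list p es, permute_list q as) \<in> oriented_trees n k j"
    "orient (encode (S, permute_list p es, permute_list q as)) = chain_scale (of_int (sign p * sign q)) (orient (encode (S, es, as)))"
proof -
  note o = oriented_treesD[OF g]
  show "(S, permute_list p es, permute_list q as) \<in> oriented_trees n k j"
    using g p q unfolding oriented_trees_def by simp
  let ?E = "map (eclus (st_tree S)) es" and ?A = "map (clus (st_tree S)) as"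
  have l: "(?E, ?A) \<in> list_cells n k" using encode_list_cells[OF g] by (simp add: encode_def)
  then have c: "distinct ?E" "distinct ?A" "(set ?E, set ?A) \<in> cells n k" by (auto simp: list_cells_def)
  note f = cells_finite_sets(3,4)[OF c(3)]
  have p': "p permutes {..<length ?E}" "q permutes {..<length ?A}" using p q by simp_all
  have "encode (S, permute_list p es, permute_list q as) = (permute_list p ?E, permute_list q ?A)"
    by (simp add: encode_def permute_list_map[OF p] permute_list_map[OF q])
  then show "orient (encode (S, permute_list p es, permute_list q as)) = chain_scale (of_int (sign p * sign q)) (orient (encode (S, es, as)))"
    using lsgn_permute[OF p'(1) c(1) f(1)] lsgn_permute[OF p'(2) c(2) f(2)] set_permute_list[OF p'(1)] set_permute_list[OF p'(2)]
    by (simp add: orient_def encode_def mult_ac del: set_map)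
qed

text \<open>Isomorphic trees have the same codes, and reordering the lists changes
  \<open>orient\<close> by the sign built into \<open>lsgn\<close>.\<close>

lemma rels_kernel: "stirling_rels n k j \<subseteq> {c \<in> stirling_gens n k j. to_cells c = 0}"
  unfolding stirling_rels_def
proof (rule chain.span_minimal)
  show "chain.subspace {c \<in> stirling_gens n k j. to_cells c = 0}"
    using subspace_gens[of n k j]
    by (auto simp: chain.subspace_def to_cells_def lin_add lin_scale)
  have s: "Poly_Mapping.single g q \<in> stirling_gens n k j" if "g \<in> oriented_trees n k j" for g q
    using that by (auto simp: stirling_gens_def)
  show "{Poly_Mapping.single (S, permute_list p es, permute_list q as) 1 -
         Poly_Mapping.single (S, es, as) (of_int (sign p * sign q)) | S es as p q.
         (S, es, as) \<in> oriented_trees n k j \<and>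
         p permutes {..<length es} \<and> q permutes {..<length as}} \<union>
      {Poly_Mapping.single (S', map (image \<psi>) es, map \<psi> as) 1 -
         Poly_Mapping.single (S, es, as) 1 | S S' es as \<phi> \<psi>.
         (S, es, as) \<in> oriented_trees n k j \<and> is_stirling_tree n k S' \<and>
         stirling_iso \<phi> \<psi> S S'} \<subseteq> {c \<in> stirling_gens n k j. to_cells c = 0}"
  proof (rule Un_least; clarify)
    fix S es as p q
    assume g: "(S, es, as) \<in> oriented_trees n k j" "p permutes {..<length es}" "q permutes {..<length as}"
    note o = oriented_permute[OF g]
    show "Poly_Mapping.single (S, permute_list p es, permute_list q as) 1 -
         Poly_Mapping.single (S, es, as) (of_int (sign p * sign q)) \<in> stirling_gens n k j \<and>
       to_cells (Poly_Mapping.single (S, permute_list p es, permute_list q as) 1 -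
         Poly_Mapping.single (S, es, as) (of_int (sign p * sign q))) = 0"
      using chain.subspace_diff[OF subspace_gens s[OF o(1)] s[OF g(1)]] o(2) by (simp add: to_cells_def lin_diff)
  next
    fix S S' :: "(nat, nat) stirling_tree" and es as \<phi> \<psi>
    assume g: "(S, es, as) \<in> oriented_trees n k j" "is_stirling_tree n k S'" "stirling_iso \<phi> \<psi> S S'"
    note o = oriented_iso[OF g]
    show "Poly_Mapping.single (S', map (image \<psi>) es, map \<psi> as) 1 - Poly_Mapping.single (S, es, as) 1 \<in> stirling_gens n k j \<and>
       to_cells (Poly_Mapping.single (S', map (image \<psi>) es, map \<psi> as) 1 - Poly_Mapping.single (S, es, as) 1) = 0"
      using chain.subspace_diff[OF subspace_gens s[OF o(1)] s[OF g(1)]] o(2) by (simp add: to_cells_def lin_diff)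
  qed
qed

lemma subspace_rels: "chain.subspace (stirling_rels n k j)"
  unfolding stirling_rels_def by (rule chain.subspace_span)

text \<open>Equal hierarchies make the composite of one code with the inverse of the other an
  isomorphism of trees; equal alternating label sets make it respect the rest of the structure. What
  remains is a reordering of both lists.\<close>

lemma same_cell_rels:
  assumes g: "g \<in> oriented_trees n k j" and g': "g' \<in> oriented_trees n k j" and eq: "cell_of g = cell_of g'"
  shows "\<exists>s. Poly_Mapping.single g' 1 - Poly_Mapping.single g s \<in> stirling_rels n k j"
proof -
  obtain S es as where S: "g = (S, es, as)" by (cases g)
  obtain S' es' as' where S': "g' = (S', es', as')" by (cases g')
  note g1 = g[unfolded S] and g2 = g'[unfolded S']
  note o = oriented_treesD[OF g1] and o' = oriented_treesD[OF g2]
  obtain F \<phi> \<psi> where cd: "coded n (st_tree S) F \<phi> \<psi>" using oriented_coded[OF g1] by blast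
  obtain F' \<phi>' \<psi>' where cd': "coded n (st_tree S') F' \<phi>' \<psi>'" using oriented_coded[OF g2] by blast
  interpret G: coded n "st_tree S" F \<phi> \<psi> by (rule cd)
  interpret G': coded n "st_tree S'" F' \<phi>' \<psi>' by (rule cd')
  have FF: "F' = F" and AA: "clus (st_tree S) ` st_alt S = clus (st_tree S') ` st_alt S'"
    using eq encode_cells(2)[OF g1 cd] encode_cells(2)[OF g2 cd'] S S' by auto
  define \<alpha> where "\<alpha> = inv_into (verts (st_tree S')) \<phi>' \<circ> \<phi>"
  define \<beta> where "\<beta> = inv_into (flags (st_tree S')) \<psi>' \<circ> \<psi>"
  have gi: "graph_iso \<alpha> \<beta> (st_tree S) (st_tree S')"
    unfolding \<alpha>_def \<beta>_def
    using graph_iso_trans[OF G.iso graph_iso_inv[OF G'.iso[unfolded FF] G'.G] G.G] .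
  have \<beta>: "\<beta> f = f'" if "is_input (st_tree S) f" "is_input (st_tree S') f'" "clus (st_tree S) f = clus (st_tree S') f'" for f f'
  proof -
    have "\<psi> f = \<psi>' f'" using G.input_code(1)[OF that(1)] G'.input_code(1)[OF that(2)] that(3) by simp
    then show ?thesis using G'.iso_facts(7) is_input_flags[OF that(2)] by (simp add: \<beta>_def)
  qed
  have "\<beta> ` st_alt S = st_alt S'"
  proof (intro equalityI subsetI)
    fix x assume "x \<in> \<beta> ` st_alt S"
    then obtain f where f: "f \<in> st_alt S" "x = \<beta> f" by blast
    then have "clus (st_tree S) f \<in> clus (st_tree S') ` st_alt S'" using AA by blast
    then obtain f' where "f' \<in> st_alt S'" "clus (st_tree S) f = clus (st_tree S') f'" by blast
    then show "x \<in> st_alt S'" using \<beta>[OF o(3)[OF f(1)] o'(3)] f by simp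
  next
    fix f' assume f': "f' \<in> st_alt S'"
    then have "clus (st_tree S') f' \<in> clus (st_tree S) ` st_alt S" using AA by blast
    then obtain f where f: "f \<in> st_alt S" "clus (st_tree S) f = clus (st_tree S') f'" by force
    then have "\<beta> f = f'" using \<beta>[OF o(3) o'(3)] f' by simp
    then show "f' \<in> \<beta> ` st_alt S" using f(1) by blast
  qed
  moreover have "\<alpha> (st_vert S) = st_vert S'"
  proof -
    \<comment> \<open>The distinguished vertex carries some alternating flag, so its code is the
      parent of an alternating label set.\<close>
    have "st_alt S \<noteq> {}" using o(5,6) by auto
    then obtain f where f: "f \<in> st_alt S" by blast
    then have "clus (st_tree S) f \<in> clus (st_tree S') ` st_alt S'" using AA by blast
    then obtain f' where f': "f' \<in> st_alt S'" "clus (st_tree S) f = clus (st_tree S') f'" by blast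
    have "\<phi> (st_vert S) = \<phi>' (st_vert S')"
      using G.adj_input[OF o(3)[OF f]] G'.adj_input[OF o'(3)[OF f'(1)]] o(4)[OF f] o'(4)[OF f'(1)] f'(2) FF by simp
    then show ?thesis using G'.iso_facts(6) o'(2) by (simp add: \<alpha>_def)
  qed
  ultimately have iso: "stirling_iso \<alpha> \<beta> S S'" using gi by (simp add: stirling_iso_graph_iso)
  have st': "is_stirling_tree n k S'" using g2 by (simp add: oriented_trees_def)
  let ?es = "map (image \<beta>) es" and ?as = "map \<beta> as"
  have g3: "(S', ?es, ?as) \<in> oriented_trees n k j" using oriented_iso(1)[OF g1 st' iso] .
  note o3 = oriented_treesD[OF g3]
  have "mset es' = mset ?es" using o3(8,9) o'(8,9) set_eq_iff_mset_eq_distinct by metis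
  then obtain p where p: "p permutes {..<length ?es}" "permute_list p ?es = es'" by (rule mset_eq_permutation)
  have "mset as' = mset ?as" using o3(10,11) o'(10,11) set_eq_iff_mset_eq_distinct by metis
  then obtain q where q: "q permutes {..<length ?as}" "permute_list q ?as = as'" by (rule mset_eq_permutation)
  define s :: rat where "s = of_int (sign p * sign q)"
  have 1: "Poly_Mapping.single g' 1 - Poly_Mapping.single (S', ?es, ?as) s \<in> stirling_rels n k j"
    unfolding stirling_rels_def S' s_def using g3 p q by (intro chain.span_base UnI1) blast
  have 2: "Poly_Mapping.single (S', ?es, ?as) 1 - Poly_Mapping.single g 1 \<in> stirling_rels n k j"
    unfolding stirling_rels_def S using g1 st' iso by (intro chain.span_base UnI2) blast
  have "(Poly_Mapping.single g' 1 - Poly_Mapping.single (S', ?es, ?as) s)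
      + chain_scale s (Poly_Mapping.single (S', ?es, ?as) 1 - Poly_Mapping.single g 1) \<in> stirling_rels n k j"
    by (intro chain.subspace_add[OF subspace_rels] chain.subspace_scale[OF subspace_rels] 1 2)
  then have "Poly_Mapping.single g' 1 - Poly_Mapping.single g s \<in> stirling_rels n k j"
    by (simp add: chain.scale_right_diff_distrib)
  then show ?thesis by blast
qed

lemma orient_cell_of:
  "orient (encode g) = Poly_Mapping.single (cell_of g) (lsgn (fst (encode g)) * lsgn (snd (encode g)))"
  by (simp add: orient_def cell_of_def split: prod.split)

text \<open>Modulo the relations, every chain is a combination of one representative per cell. The
  representatives go to plus or minus distinct basis vectors, so such a combination in the kernel is
  zero.\<close>

lemma kernel_rels:
  assumes c: "c \<in> stirling_gens n k j" and z: "to_cells c = 0"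
  shows "c \<in> stirling_rels n k j"
proof -
  let ?T = "oriented_trees n k j"
  define rep where "rep x = (SOME g. g \<in> ?T \<and> cell_of g = x)" for x
  have rep: "rep (cell_of g) \<in> ?T \<and> cell_of (rep (cell_of g)) = cell_of g" if "g \<in> ?T" for g
    unfolding rep_def by (rule someI[of _ g]) (use that in simp)
  have "\<exists>s. Poly_Mapping.single g 1 - Poly_Mapping.single (rep (cell_of g)) s \<in> stirling_rels n k j" if "g \<in> ?T" for g
    using same_cell_rels[of "rep (cell_of g)" n k j g] rep[OF that] that by simp
  then obtain s where s: "\<And>g. g \<in> ?T \<Longrightarrow> Poly_Mapping.single g 1 - Poly_Mapping.single (rep (cell_of g)) (s g) \<in> stirling_rels n k j"
    by metis
  define c' where "c' = lin (\<lambda>g. Poly_Mapping.single (rep (cell_of g)) (s g)) c"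
  have kc: "g \<in> ?T" if "g \<in> Poly_Mapping.keys c" for g using c that by (auto simp: stirling_gens_def)
  have "c - c' = (\<Sum>g\<in>Poly_Mapping.keys c. chain_scale (Poly_Mapping.lookup c g)
      (Poly_Mapping.single g 1 - Poly_Mapping.single (rep (cell_of g)) (s g)))"
    unfolding c'_def by (subst (1) lin_id[symmetric])
      (simp only: lin_def chain.scale_right_diff_distrib sum_subtractf)
  also have "\<dots> \<in> stirling_rels n k j"
    by (intro chain.subspace_sum[OF subspace_rels] chain.subspace_scale[OF subspace_rels] s kc)
  finally have d: "c - c' \<in> stirling_rels n k j" .
  then have "to_cells (c - c') = 0" using rels_kernel by blast
  then have z': "to_cells c' = 0" using z by (simp add: to_cells_def lin_diff)
  have k': "\<exists>g\<in>?T. h = rep (cell_of g)" if h: "h \<in> Poly_Mapping.keys c'" for h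
  proof -
    have "Poly_Mapping.keys c' \<subseteq> (\<Union>g\<in>Poly_Mapping.keys c. Poly_Mapping.keys (Poly_Mapping.single (rep (cell_of g)) (s g)))"
      unfolding c'_def by (rule keys_lin)
    then obtain g where "g \<in> Poly_Mapping.keys c" "h \<in> Poly_Mapping.keys (Poly_Mapping.single (rep (cell_of g)) (s g))"
      using h by blast
    then have "g \<in> ?T" "h = rep (cell_of g)" using kc by (auto split: if_splits)
    then show ?thesis by blast
  qed
  have "c' = 0"
  proof (rule ccontr)
    assume "c' \<noteq> 0"
    then obtain h where h: "h \<in> Poly_Mapping.keys c'" by (metis all_not_in_conv keys_eq_empty)
    let ?s = "\<lambda>h. lsgn (fst (encode h)) * lsgn (snd (encode h))"
    have "Poly_Mapping.lookup (to_cells c') (cell_of h)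
        = (\<Sum>h'\<in>Poly_Mapping.keys c'. if h' = h then Poly_Mapping.lookup c' h * ?s h else 0)"
      unfolding to_cells_def lookup_lin
    proof (rule sum.cong[OF refl])
      fix h' assume h': "h' \<in> Poly_Mapping.keys c'"
      have "h' = h" if "cell_of h' = cell_of h"
        using k'[OF h] k'[OF h'] rep that by metis
      then show "Poly_Mapping.lookup c' h' * Poly_Mapping.lookup (orient (encode h')) (cell_of h)
         = (if h' = h then Poly_Mapping.lookup c' h * ?s h else 0)"
        by (auto simp: orient_cell_of lookup_single when_def)
    qed
    also have "\<dots> = Poly_Mapping.lookup c' h * ?s h" using h by (simp add: sum.delta)
    finally show False using z' h by (simp add: in_keys_iff)
  qed
  then show ?thesis using d by simp
qed

subsection \<open>Every cell comes from a Stirling tree\<close>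

text \<open>Bridges a difference of types: \<open>canon\<close> has sets for vertices and pairs for
  flags, whereas generators are trees on natural numbers.\<close>

lemma relabel_ex:
  fixes G :: "('v, 'f) flag_graph"
  assumes G: "is_flag_graph G"
  shows "\<exists>(G' :: (nat, nat) flag_graph) \<alpha> \<beta>. graph_iso \<alpha> \<beta> G G'"
proof -
  note g = flag_graphD[OF G]
  obtain \<alpha> :: "'v \<Rightarrow> nat" where \<alpha>: "inj_on \<alpha> (verts G)" using finite_imp_inj_to_nat_seg[OF g(1)] by blast
  obtain \<beta> :: "'f \<Rightarrow> nat" where \<beta>: "inj_on \<beta> (flags G)" using finite_imp_inj_to_nat_seg[OF g(2)] by blast
  let ?b = "inv_into (flags G) \<beta>"
  have b: "?b (\<beta> f) = f" if "f \<in> flags G" for f using \<beta> that by simp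
  let ?G = "\<lparr>verts = \<alpha> ` verts G, flags = \<beta> ` flags G, adj = \<alpha> \<circ> adj G \<circ> ?b,
    invol = \<beta> \<circ> invol G \<circ> ?b, lab = lab G \<circ> ?b\<rparr>"
  have "graph_iso \<alpha> \<beta> G ?G"
    using \<alpha> \<beta> b by (auto simp: graph_iso_def bij_betw_def legs_def)
  then show ?thesis by blast
qed

lemma cell_of_surj:
  assumes x: "(F, A) \<in> cells n k" and k: "2 \<le> k" and j: "int (card F) + int k = j"
  shows "\<exists>g\<in>oriented_trees n k j. cell_of g = (F, A)"
proof -
  note f = cells_finite_sets[OF x]
  obtain P where P: "\<And>X. X \<in> A \<Longrightarrow> par n F X = P" using x unfolding cells_def by blast
  have cA: "card A = k" using x by (simp add: cells_def)
  then have "A \<noteq> {}" using k by auto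
  then obtain X0 where X0: "X0 \<in> A" by blast
  then have PV: "P \<in> insert {1..n} F" using par(1)[OF f(5), of X0] P f(6) by auto
  obtain G :: "(nat, nat) flag_graph" and \<alpha> \<beta> where iso: "graph_iso \<alpha> \<beta> (canon n F) G"
    using relabel_ex[OF canon_flag_graph[OF f(5)]] by blast
  note ii = graph_isoD[OF iso]
  define \<phi> where "\<phi> = inv_into (verts (canon n F)) \<alpha>"
  define \<psi> where "\<psi> = inv_into (flags (canon n F)) \<beta>"
  have cd: "coded n G F \<phi> \<psi>"
    using f(5) graph_iso_inv[OF iso canon_flag_graph[OF f(5)]] iso_flag_graph[OF iso canon_flag_graph[OF f(5)]]
    unfolding \<phi>_def \<psi>_def by (rule coded.intro)
  then interpret G: coded n G F \<phi> \<psi> .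
  define B where "B = (\<lambda>X. \<beta> (X, False)) ` A"
  have fl: "(X, False) \<in> flags (canon n F)" if "X \<in> A" for X using that f(6) by auto
  have inp: "is_input G (\<beta> (X, False))" "clus G (\<beta> (X, False)) = X" "adj G (\<beta> (X, False)) = \<alpha> P" if X: "X \<in> A" for X
  proof -
    have ps: "\<psi> (\<beta> (X, False)) = (X, False)" unfolding \<psi>_def using ii(7) fl[OF X] by simp
    show i: "is_input G (\<beta> (X, False))"
      unfolding G.input_iff using ii(10)[OF fl[OF X]] ps by simp
    show "clus G (\<beta> (X, False)) = X" using G.input_code(1)[OF i] ps by simp
    show "adj G (\<beta> (X, False)) = \<alpha> P" using ii(3)[OF fl[OF X]] P[OF X] by simp
  qed
  let ?S = "\<lparr>st_tree = G, st_vert = \<alpha> P, st_alt = B\<rparr>"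
  have clB: "clus G ` B = A" unfolding B_def image_image using inp(2) by simp
  have "inj_on (\<lambda>X. \<beta> (X, False)) A" by (rule inj_on_inverseI[of _ "clus G"]) (rule inp(2))
  then have cB: "card B = k" unfolding B_def using cA by (simp add: card_image)
  have st: "is_stirling_tree n k ?S"
    unfolding is_stirling_tree_def using G.stable ii(11)[of P] PV inp cB k by (auto simp: B_def)
  have fe: "finite (edges G)" "card (edges G) = card F"
    using bij_betw_finite[OF G.eclus_bij] f(1) bij_betw_same_card[OF G.eclus_bij] by auto
  obtain es where es: "distinct es" "set es = edges G" using finite_distinct_list[OF fe(1)] by blast
  have "finite B" unfolding B_def using f(2) by simp
  then obtain as where as: "distinct as" "set as = B" using finite_distinct_list by blast
  have g: "(?S, es, as) \<in> oriented_trees n k j"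
    by (rule oriented_treesI[OF st]) (use es as j fe(2) distinct_card[OF es(1)] in auto)
  moreover have "cell_of (?S, es, as) = (F, A)" using encode_cells(2)[OF g, of F \<phi> \<psi>] cd clB by simp
  ultimately show ?thesis by blast
qed

definition cell_degree :: "nat \<Rightarrow> nat set set \<times> nat set set \<Rightarrow> int" where
  "cell_degree k x = int (card (fst x)) + int k"

lemma to_cells_keys:
  assumes c: "c \<in> stirling_gens n k j"
  shows "Poly_Mapping.keys (to_cells c) \<subseteq> {x \<in> cells n k. cell_degree k x = j}"
proof
  fix x assume "x \<in> Poly_Mapping.keys (to_cells c)"
  then have "x \<in> (\<Union>g\<in>Poly_Mapping.keys c. Poly_Mapping.keys (orient (encode g)))"
    unfolding to_cells_def by (rule subsetD[OF keys_lin])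
  then obtain g where g: "g \<in> Poly_Mapping.keys c" "x \<in> Poly_Mapping.keys (orient (encode g))" by blast
  then have gT: "g \<in> oriented_trees n k j" using c by (auto simp: stirling_gens_def)
  have xg: "x = cell_of g" using g(2) by (auto simp: orient_cell_of split: if_splits)
  obtain S es as where S: "g = (S, es, as)" by (cases g)
  have "encode g \<in> list_cells n k" using encode_list_cells[OF gT] .
  then have c: "cell_of g \<in> cells n k" "distinct (fst (encode g))" by (auto simp: list_cells_def cell_of_def)
  have "card (fst (cell_of g)) = length es"
    using distinct_card[OF c(2)] by (simp add: cell_of_def S encode_def)
  then show "x \<in> {x \<in> cells n k. cell_degree k x = j}"
    using c(1) xg oriented_treesD(12)[OF gT[unfolded S]] by (simp add: cell_degree_def)
qed

lemma to_cells_surj: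
  assumes k: "2 \<le> k" and z: "Poly_Mapping.keys z \<subseteq> {x \<in> cells n k. cell_degree k x = j}"
  shows "\<exists>c\<in>stirling_gens n k j. to_cells c = z"
proof -
  have "\<exists>g\<in>oriented_trees n k j. cell_of g = x" if "x \<in> Poly_Mapping.keys z" for x
    using cell_of_surj[of "fst x" "snd x" n k j] k z that by (auto simp: cell_degree_def)
  then obtain r where r: "\<And>x. x \<in> Poly_Mapping.keys z \<Longrightarrow> r x \<in> oriented_trees n k j"
    "\<And>x. x \<in> Poly_Mapping.keys z \<Longrightarrow> cell_of (r x) = x" by metis
  let ?s = "\<lambda>g. lsgn (fst (encode g)) * lsgn (snd (encode g))"
  define c where "c = lin (\<lambda>x. Poly_Mapping.single (r x) (?s (r x))) z"
  have "Poly_Mapping.keys c \<subseteq> (\<Union>x\<in>Poly_Mapping.keys z. Poly_Mapping.keys (Poly_Mapping.single (r x) (?s (r x))))"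
    unfolding c_def by (rule keys_lin)
  also have "\<dots> \<subseteq> oriented_trees n k j" using r(1) by (auto split: if_splits)
  finally have "c \<in> stirling_gens n k j" by (simp add: stirling_gens_def)
  moreover have "to_cells c = lin (\<lambda>x. Poly_Mapping.single x 1) z"
    unfolding to_cells_def c_def lin_lin
  proof (rule lin_cong)
    fix x assume x: "x \<in> Poly_Mapping.keys z"
    \<comment> \<open>The generator is weighted by its own orientation sign, and a sign squares to
      one.\<close>
    have "?s (r x) * ?s (r x) = (lsgn (fst (encode (r x))) * lsgn (fst (encode (r x)))) * (lsgn (snd (encode (r x))) * lsgn (snd (encode (r x))))"
      by (simp only: mult_ac)
    then have "?s (r x) * ?s (r x) = 1" by simp
    then show "lin (\<lambda>g. orient (encode g)) (Poly_Mapping.single (r x) (?s (r x))) = Poly_Mapping.single x 1"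
      using r(2)[OF x] by (simp only: lin_single orient_cell_of chain_scale_single)
  qed
  then have "to_cells c = z" by (simp only: lin_id)
  ultimately show ?thesis by blast
qed

section \<open>The Betti numbers\<close>

text \<open>Tested after \<open>to_cells\<close>, where the boundary squares to zero;
  \<open>kernel_rels\<close> turns vanishing there into membership in the relations.\<close>

lemma boundaries_subset_cycles: "stirling_boundaries n k j \<subseteq> stirling_cycles n k j"
proof
  fix b assume "b \<in> stirling_boundaries n k j"
  then obtain c r where c: "c \<in> stirling_gens n k (j + 1)" and r: "r \<in> stirling_rels n k j" and b: "b = stirling_bdry c + r"
    by (auto simp: stirling_boundaries_def)
  have r': "r \<in> stirling_gens n k j" "to_cells r = 0" using r rels_kernel by blast+
  have cg: "stirling_bdry c \<in> stirling_gens n k j" using stirling_bdry_gens[OF c] by simp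
  have bg: "b \<in> stirling_gens n k j" unfolding b by (rule chain.subspace_add[OF subspace_gens cg r'(1)])
  have "to_cells (stirling_bdry b) = lin (cell_bdry n) (to_cells b)" by (rule to_cells_bdry[OF bg])
  also have "to_cells b = lin (cell_bdry n) (to_cells c)"
    using to_cells_bdry[OF c] r'(2) by (simp add: b to_cells_def lin_add)
  also have "lin (cell_bdry n) (lin (cell_bdry n) (to_cells c)) = lin (\<lambda>x. 0) (to_cells c)"
    unfolding lin_lin
  proof (rule lin_cong)
    fix x assume "x \<in> Poly_Mapping.keys (to_cells c)"
    then have "x \<in> cells n k" using to_cells_keys[OF c] by blast
    then show "lin (cell_bdry n) (cell_bdry n x) = 0" using cell_bdry_square[of "fst x" "snd x"] by simp
  qed
  finally have "to_cells (stirling_bdry b) = 0" by (simp add: lin_def)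
  then have "stirling_bdry b \<in> stirling_rels n k (j - 1)" by (rule kernel_rels[OF stirling_bdry_gens[OF bg]])
  then show "b \<in> stirling_cycles n k j" using bg by (simp add: stirling_cycles_def)
qed

lemma subspace_cycles: "chain.subspace (stirling_cycles n k j)"
proof -
  note g = subspace_gens[of n k j] and r = subspace_rels[of n k "j - 1"]
  show ?thesis
    using chain.subspace_0[OF g] chain.subspace_0[OF r] chain.subspace_add[OF g] chain.subspace_add[OF r]
      chain.subspace_scale[OF g] chain.subspace_scale[OF r]
    by (intro chain.subspaceI) (simp_all add: stirling_cycles_def stirling_bdry_lin lin_add lin_scale)
qed

lemma subspace_boundaries: "chain.subspace (stirling_boundaries n k j)"
proof (rule chain.subspaceI)
  note g = subspace_gens[of n k "j + 1"] and r = subspace_rels[of n k j]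
  have I: "stirling_bdry c + d \<in> stirling_boundaries n k j" if "c \<in> stirling_gens n k (j + 1)" "d \<in> stirling_rels n k j" for c d
    unfolding stirling_boundaries_def using that by blast
  show "0 \<in> stirling_boundaries n k j"
    using I[OF chain.subspace_0[OF g] chain.subspace_0[OF r]] by (simp add: stirling_bdry_lin)
  fix x assume "x \<in> stirling_boundaries n k j"
  then obtain c d where x: "x = stirling_bdry c + d" "c \<in> stirling_gens n k (j + 1)" "d \<in> stirling_rels n k j"
    by (auto simp: stirling_boundaries_def)
  show "chain_scale q x \<in> stirling_boundaries n k j" for q
    using I[OF chain.subspace_scale[OF g x(2), of q] chain.subspace_scale[OF r x(3), of q]]
    by (simp add: x stirling_bdry_lin lin_scale chain.scale_right_distrib)
  fix y assume "y \<in> stirling_boundaries n k j"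
  then obtain c' d' where y: "y = stirling_bdry c' + d'" "c' \<in> stirling_gens n k (j + 1)" "d' \<in> stirling_rels n k j"
    by (auto simp: stirling_boundaries_def)
  show "x + y \<in> stirling_boundaries n k j"
    using I[OF chain.subspace_add[OF g x(2) y(2)] chain.subspace_add[OF r x(3) y(3)]]
    by (simp add: x y stirling_bdry_lin lin_add algebra_simps)
qed

text \<open>The generators in degree \<open>j + 1\<close> map onto the cell chains, so a bounding
  chain can be lifted; the error lies in the kernel and hence is a relation.\<close>

lemma boundaries_iff:
  assumes k: "2 \<le> k" and b: "b \<in> stirling_gens n k j"
  shows "b \<in> stirling_boundaries n k j \<longleftrightarrow>
    (\<exists>y. Poly_Mapping.keys y \<subseteq> {x \<in> cells n k. cell_degree k x = j + 1} \<and> to_cells b = lin (cell_bdry n) y)"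
proof
  assume "b \<in> stirling_boundaries n k j"
  then obtain c r where c: "c \<in> stirling_gens n k (j + 1)" and r: "r \<in> stirling_rels n k j" and b: "b = stirling_bdry c + r"
    by (auto simp: stirling_boundaries_def)
  have "to_cells r = 0" using r rels_kernel by blast
  then have "to_cells b = lin (cell_bdry n) (to_cells c)"
    using to_cells_bdry[OF c] by (simp add: b to_cells_def lin_add)
  then show "\<exists>y. Poly_Mapping.keys y \<subseteq> {x \<in> cells n k. cell_degree k x = j + 1} \<and> to_cells b = lin (cell_bdry n) y"
    using to_cells_keys[OF c] by blast
next
  assume "\<exists>y. Poly_Mapping.keys y \<subseteq> {x \<in> cells n k. cell_degree k x = j + 1} \<and> to_cells b = lin (cell_bdry n) y"
  then obtain y where y: "Poly_Mapping.keys y \<subseteq> {x \<in> cells n k. cell_degree k x = j + 1}" "to_cells b = lin (cell_bdry n) y" by blast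
  obtain c where c: "c \<in> stirling_gens n k (j + 1)" "to_cells c = y" using to_cells_surj[OF k y(1)] by blast
  have cg: "stirling_bdry c \<in> stirling_gens n k j" using stirling_bdry_gens[OF c(1)] by simp
  have "to_cells (b - stirling_bdry c) = 0"
    using y(2) to_cells_bdry[OF c(1)] c(2) by (simp add: to_cells_def lin_diff)
  then have "b - stirling_bdry c \<in> stirling_rels n k j"
    by (rule kernel_rels[OF chain.subspace_diff[OF subspace_gens b cg]])
  moreover have "b = stirling_bdry c + (b - stirling_bdry c)" by simp
  ultimately show "b \<in> stirling_boundaries n k j" unfolding stirling_boundaries_def using c(1) by blast
qed

theorem theorem4p1:
  fixes n k :: nat and i :: int
  assumes "1 \<le> n" and "2 \<le> k"
  shows "stirling_betti n k i (if i = int n then abs_stirling1 n k else 0)"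
proof -
  note k = assms(2)
  let ?D = "cell_bdry n" and ?K = "\<lambda>j. {x \<in> cells n k. cell_degree k x = j}"
  obtain C where C: "acyclic_matching (cells n k) (\<lambda>x y. Poly_Mapping.lookup (?D x) y \<noteq> 0) C"
    "card C = stirling n k" "\<And>x. x \<in> C \<Longrightarrow> card (fst x) + k = n"
    using cells_matching[OF k] by blast
  have degD: "Poly_Mapping.keys (?D x) \<subseteq> {y \<in> cells n k. cell_degree k y = cell_degree k x - 1}" if x: "x \<in> cells n k" for x
  proof
    fix y assume "y \<in> Poly_Mapping.keys (?D x)"
    then have "cell_step n x y" by (intro cell_step_if_lookup) (simp add: in_keys_iff)
    then show "y \<in> {y \<in> cells n k. cell_degree k y = cell_degree k x - 1}"
      using cells_cell_step[of "fst x" "snd x" n k "fst y" "snd y"] x by (simp add: cell_degree_def)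
  qed
  have DD: "lin ?D (?D x) = 0" if "x \<in> cells n k" for x
    using cell_bdry_square[of "fst x" "snd x"] that by simp
  have degC: "cell_degree k x = int n" if "x \<in> C" for x using C(3)[OF that] by (simp add: cell_degree_def)
  show ?thesis
  proof (rule matching_homology[OF finite_cells degD DD C(1) degC])
    fix w
    assume w: "\<And>c. c \<in> C \<Longrightarrow> Poly_Mapping.keys (w c) \<subseteq> ?K (int n) \<and> lin ?D (w c) = 0"
      and basis: "\<And>j z Cj. Cj = (if j = int n then C else {}) \<Longrightarrow> Poly_Mapping.keys z \<subseteq> ?K j \<Longrightarrow> lin ?D z = 0 \<Longrightarrow>
         \<exists>!a. a \<in> Cj \<rightarrow>\<^sub>E UNIV \<and> (\<exists>y. Poly_Mapping.keys y \<subseteq> ?K (j + 1) \<and>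
                z - (\<Sum>c\<in>Cj. chain_scale (a c) (w c)) = lin ?D y)"
    define Ci where "Ci = (if i = int n then C else {})"
    have Cn: "c \<in> C" "i = int n" if "c \<in> Ci" for c using that by (auto simp: Ci_def split: if_splits)
    have CX: "C \<subseteq> cells n k" using C(1) unfolding acyclic_matching_def by blast
    then have finC: "finite Ci" using finite_subset[OF CX finite_cells] by (simp add: Ci_def)
    \<comment> \<open>Lifts of the basis cycles of the cell complex; their classes will be the
      required basis.\<close>
    have "\<exists>W. W \<in> stirling_gens n k i \<and> to_cells W = w c" if "c \<in> Ci" for c
      using to_cells_surj[OF k, of "w c" n i] w[OF Cn(1)[OF that]] Cn(2)[OF that] by blast
    then obtain W where W: "\<And>c. c \<in> Ci \<Longrightarrow> W c \<in> stirling_gens n k i" "\<And>c. c \<in> Ci \<Longrightarrow> to_cells (W c) = w c"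
      by metis
    define Q where "Q z a \<longleftrightarrow> a \<in> Ci \<rightarrow>\<^sub>E UNIV \<and> (\<exists>y. Poly_Mapping.keys y \<subseteq> ?K (i + 1) \<and>
                z - (\<Sum>c\<in>Ci. chain_scale (a c) (w c)) = lin ?D y)" for z a
    have basis': "\<exists>!a. Q z a" if "Poly_Mapping.keys z \<subseteq> ?K i" "lin ?D z = 0" for z
      unfolding Q_def using basis[OF Ci_def that] .
    \<comment> \<open>\<open>quotient_has_dim\<close> counts a set of representatives, so distinct
      critical cells must have distinct lifts. Otherwise the cycle \<open>w c\<close> would have two
      different expansions.\<close>
    have Winj: "inj_on W Ci"
    proof (rule inj_onI)
      fix c c' assume c: "c \<in> Ci" "c' \<in> Ci" "W c = W c'"
      then have ww: "w c = w c'" using W(2) by metis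
      have Q: "Q (w c) (\<lambda>x\<in>Ci. if x = d then 1 else 0)" if "d \<in> Ci" "w d = w c" for d
      proof -
        have "(\<Sum>x\<in>Ci. chain_scale ((\<lambda>x\<in>Ci. if x = d then 1 else 0) x) (w x)) = (\<Sum>x\<in>Ci. if x = d then w d else 0)"
          by (rule sum.cong[OF refl]) auto
        then have "(\<Sum>x\<in>Ci. chain_scale ((\<lambda>x\<in>Ci. if x = d then 1 else 0) x) (w x)) = w c"
          using that finC by simp
        then show ?thesis unfolding Q_def by (intro conjI exI[of _ 0]) auto
      qed
      have "Poly_Mapping.keys (w c) \<subseteq> ?K i" "lin ?D (w c) = 0" using w[OF Cn(1)[OF c(1)]] Cn(2)[OF c(1)] by auto
      from basis'[OF this] have "(\<lambda>x\<in>Ci. if x = c then 1 else (0::rat)) = (\<lambda>x\<in>Ci. if x = c' then 1 else 0)"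
        using Q[OF c(1) refl] Q[OF c(2) ww[symmetric]] by blast
      from fun_cong[OF this, of c] show "c = c'" using c(1) by (simp split: if_splits)
    qed
    let ?Z = "stirling_cycles n k i" and ?B = "stirling_boundaries n k i"
    have WZ: "W ` Ci \<subseteq> ?Z"
    proof
      fix x assume "x \<in> W ` Ci"
      then obtain c where c: "c \<in> Ci" "x = W c" by blast
      have "to_cells (stirling_bdry x) = 0"
        using to_cells_bdry[OF W(1)[OF c(1)]] W(2)[OF c(1)] w[OF Cn(1)[OF c(1)]] c(2) by simp
      then have "stirling_bdry x \<in> stirling_rels n k (i - 1)"
        using kernel_rels[OF stirling_bdry_gens[OF W(1)[OF c(1)]]] c(2) by simp
      then show "x \<in> ?Z" using W(1)[OF c(1)] c(2) by (simp add: stirling_cycles_def)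
    qed
    have ex: "\<exists>!a. a \<in> W ` Ci \<rightarrow>\<^sub>E UNIV \<and> z - (\<Sum>x\<in>W ` Ci. chain_scale (a x) x) \<in> ?B" if z: "z \<in> ?Z" for z
    proof -
      have zg: "z \<in> stirling_gens n k i" and zb: "stirling_bdry z \<in> stirling_rels n k (i - 1)"
        using z by (auto simp: stirling_cycles_def)
      have "to_cells (stirling_bdry z) = 0" using zb rels_kernel by blast
      then have Dz: "lin ?D (to_cells z) = 0" using to_cells_bdry[OF zg] by simp
      \<comment> \<open>A coefficient function on the lifts is pulled back along \<open>W\<close>;
        \<open>restrict\<close> puts it into the extensional function space over \<open>Ci\<close>,
        where uniqueness is known.\<close>
      have iff: "z - (\<Sum>x\<in>W ` Ci. chain_scale (a x) x) \<in> ?B \<longleftrightarrow> Q (to_cells z) (restrict (a \<circ> W) Ci)" for a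
      proof -
        have s: "(\<Sum>x\<in>W ` Ci. chain_scale (a x) x) = (\<Sum>c\<in>Ci. chain_scale (a (W c)) (W c))"
          by (simp add: sum.reindex[OF Winj])
        have "(\<Sum>c\<in>Ci. chain_scale (a (W c)) (W c)) \<in> stirling_gens n k i"
          by (intro chain.subspace_sum[OF subspace_gens] chain.subspace_scale[OF subspace_gens] W(1))
        then have dg: "z - (\<Sum>c\<in>Ci. chain_scale (a (W c)) (W c)) \<in> stirling_gens n k i"
          by (rule chain.subspace_diff[OF subspace_gens zg])
        have t: "to_cells (z - (\<Sum>c\<in>Ci. chain_scale (a (W c)) (W c))) = to_cells z - (\<Sum>c\<in>Ci. chain_scale (a (W c)) (w c))"
          using W(2) unfolding to_cells_def by (simp add: lin_diff lin_sum lin_scale)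
        have r: "(\<Sum>c\<in>Ci. chain_scale (restrict (a \<circ> W) Ci c) (w c)) = (\<Sum>c\<in>Ci. chain_scale (a (W c)) (w c))"
          by (rule sum.cong) auto
        show ?thesis unfolding s boundaries_iff[OF k dg] t Q_def r by (simp only: restrict_PiE_iff) auto
      qed
      from basis'[OF to_cells_keys[OF zg] Dz] obtain a where a: "Q (to_cells z) a"
        and uniq: "\<And>b. Q (to_cells z) b \<Longrightarrow> b = a" by blast
      have aE: "a \<in> Ci \<rightarrow>\<^sub>E UNIV" using a by (simp add: Q_def)
      define a' where "a' = restrict (a \<circ> inv_into Ci W) (W ` Ci)"
      have "restrict (a' \<circ> W) Ci = a"
      proof
        fix c show "restrict (a' \<circ> W) Ci c = a c"
          using PiE_arb[OF aE, of c] Winj by (cases "c \<in> Ci") (auto simp: a'_def)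
      qed
      then have a'B: "z - (\<Sum>x\<in>W ` Ci. chain_scale (a' x) x) \<in> ?B" using iff a by simp
      show ?thesis
      proof (rule ex1I[of _ a'])
        show "a' \<in> W ` Ci \<rightarrow>\<^sub>E UNIV \<and> z - (\<Sum>x\<in>W ` Ci. chain_scale (a' x) x) \<in> ?B"
          using a'B by (simp add: a'_def)
        fix b assume b: "b \<in> W ` Ci \<rightarrow>\<^sub>E UNIV \<and> z - (\<Sum>x\<in>W ` Ci. chain_scale (b x) x) \<in> ?B"
        then have eq: "restrict (b \<circ> W) Ci = a" using uniq iff by blast
        have "b x = a' x" for x
        proof (cases "x \<in> W ` Ci")
          case True
          then obtain c where c: "c \<in> Ci" "x = W c" by blast
          then show ?thesis using fun_cong[OF eq, of c] Winj by (simp add: a'_def)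
        next
          case False
          then show ?thesis using b by (auto simp: a'_def dest: PiE_arb)
        qed
        then show "b = a'" by blast
      qed
    qed
    have "card (W ` Ci) = (if i = int n then abs_stirling1 n k else 0)"
      using card_image[OF Winj] C(2) by (simp add: Ci_def abs_stirling1_eq_stirling)
    then show ?thesis
      unfolding stirling_betti_def quotient_has_dim_def
      by (intro conjI exI[of _ "W ` Ci"] subspace_cycles subspace_boundaries boundaries_subset_cycles
          WZ finite_imageI finC ballI ex)
  qed
qed

end
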